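(* Let $X=\{X_t\}_{t\ge0}$ be the super-Brownian motion in random environment on $\mathbb{R}^d$ with covariance function $g$, started from a finite measure $\mu$ on $\mathbb{R}^d$, and let $\mathbf{E}_\mu$ denote the corresponding expectation. Let $\{P_t\}$ be the semigroup on $\mathbb{R}^d$ with generator $\Delta$, and let $\{Q^g_t\}$ be the semigroup on $\mathbb{R}^{2d}$ generated by $\Delta+g$, where $\Delta$ is the Laplacian on $\mathbb{R}^{2d}$ and $g$ acts by multiplication. Then for all $\phi\in C_b(\mathbb{R}^d)$ and $t\ge 0$, $$\mathbf{E}_\mu\big(X_t(\phi)^2\big)=\big\langle Q^g_t(\phi\otimes\phi),\mu\otimes\mu\big\rangle+\int_0^t\big\langle P_s\big(\pi Q^g_{t-s}(\phi\otimes\phi)\big),\mu\big\rangle\,ds ,$$ where $(\pi f)(x)=f(x,x)$ for $f\in\mathcal{B}(\mathbb{R}^{2d})$, $x\in\mathbb{R}^d$.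
   Context: Notation: $X_t(\phi)=\langle\phi,X_t\rangle=\int\phi\,dX_t$, $(f\otimes h)(x,y)=f(x)h(y)$ for $x,y\in\mathbb{R}^d$, and $\mathcal{B}(\mathbb{R}^{2d})$ denotes the measurable functions on $\mathbb{R}^{2d}$. Standing assumptions on $g$: $g:\mathbb{R}^d\times\mathbb{R}^d\to\mathbb{R}$ is the covariance function $g(x,y)=\mathbf{E}[\xi(x)\xi(y)]$ of a random field $\xi$ on $\mathbb{R}^d$ with $\mathbf{E}\xi(x)=0$ and $\sup_x\mathbf{E}|\xi(x)|^3<\infty$; $g$ is bounded, $g(x,\cdot)\in C_0(\mathbb{R}^d)$ for every $x$, and $g\in C^2_b$ (bounded and continuous with bounded continuous derivatives up to order 2). The super-Brownian motion in random environment with covariance $g$ started at $\mu$ is the measure-valued process $X$ (values in finite measures on $\mathbb{R}^d$) that is the unique (in law) solution of the martingale problem: for all $f\in C^2_b(\mathbb{R}^d)$, $$M^f_t=\langle f,X_t\rangle-\langle f,\mu\rangle-\int_0^t\langle\Delta f,X_s\rangle\,ds$$ is a continuous square-integrable martingale with quadratic variation $$\langle M^f\rangle_t=\int_0^t\langle f^2,X_s\rangle\,ds+\int_0^t\langle g\cdot(f\otimes f),X_s\otimes X_s\rangle\,ds .$$ The Laplacian appears without the factor $1/2$. *)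

theory Defs
  imports "HOL-Probability.Probability"
begin

text \<open>
  The library's \<^const>\<open>bcontfun\<close> (a set of plain functions) is $C_b$.
\<close>

definition C0 :: "('a::euclidean_space \<Rightarrow> real) set" where
  "C0 = {f. continuous_on UNIV f \<and> (f \<longlongrightarrow> 0) at_infinity}"

definition partial :: "'a::euclidean_space \<Rightarrow> ('a \<Rightarrow> real) \<Rightarrow> 'a \<Rightarrow> real" where
  "partial i f x = deriv (\<lambda>h. f (x + h *\<^sub>R i)) 0"

definition C1b :: "('a::euclidean_space \<Rightarrow> real) set" where
  "C1b = {f \<in> bcontfun. \<forall>i\<in>Basis.
     (\<forall>x. (\<lambda>h::real. f (x + h *\<^sub>R i)) differentiable at 0) \<and> partial i f \<in> bcontfun}"

definition C2b :: "('a::euclidean_space \<Rightarrow> real) set" where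
  "C2b = {f \<in> C1b. \<forall>i\<in>Basis. partial i f \<in> C1b}"

definition laplacian :: "('a::euclidean_space \<Rightarrow> real) \<Rightarrow> 'a \<Rightarrow> real" where
  "laplacian f x = (\<Sum>i\<in>Basis. partial i (partial i f) x)"

definition tensor :: "('a \<Rightarrow> real) \<Rightarrow> ('b \<Rightarrow> real) \<Rightarrow> 'a \<times> 'b \<Rightarrow> real" (infixr "\<otimes>\<^sub>f" 70) where
  "(f \<otimes>\<^sub>f h) = (\<lambda>(x, y). f x * h y)"

definition diag :: "('a \<times> 'a \<Rightarrow> real) \<Rightarrow> 'a \<Rightarrow> real" where
  "diag f x = f (x, x)"


section \<open>Covariance functions\<close>

definition field_covariance ::
  "'v measure \<Rightarrow> ('a \<Rightarrow> 'v \<Rightarrow> real) \<Rightarrow> ('a \<times> 'a \<Rightarrow> real) \<Rightarrow> bool" where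
  "field_covariance N \<xi> g \<longleftrightarrow>
     prob_space N \<and>
     (\<forall>x. \<xi> x \<in> borel_measurable N) \<and>
     (SUP x. \<integral>\<^sup>+v. ennreal (\<bar>\<xi> x v\<bar> ^ 3) \<partial>N) < \<infinity> \<and>
     (\<forall>x. integral\<^sup>L N (\<xi> x) = 0) \<and>
     (\<forall>x y. g (x, y) = (\<integral>v. \<xi> x v * \<xi> y v \<partial>N))"


section \<open>Semigroups and their generators\<close>

text \<open>
  A semigroup is given by its transition kernels $K_t(x,dy)$, so that it acts on all bounded
  measurable functions and not only on $C_0$. The kernels need not be sub-Markovian, since a
  potential may create mass.
\<close>

definition kernel_op ::
  "(real \<Rightarrow> 'a \<Rightarrow> 'a measure) \<Rightarrow> real \<Rightarrow> ('a \<Rightarrow> real) \<Rightarrow> 'a \<Rightarrow> real" where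
  "kernel_op K t f x = (\<integral>y. f y \<partial>K t x)"

definition C0_semigroup :: "(real \<Rightarrow> 'a::euclidean_space \<Rightarrow> 'a measure) \<Rightarrow> bool" where
  "C0_semigroup K \<longleftrightarrow>
     (\<forall>t\<ge>0. \<forall>x. finite_measure (K t x) \<and> sets (K t x) = sets borel) \<and>
     (\<forall>t\<ge>0. \<forall>A\<in>sets borel. (\<lambda>x. measure (K t x) A) \<in> borel_measurable borel) \<and>
     (\<forall>t\<ge>0. bounded (range (\<lambda>x. measure (K t x) UNIV))) \<and>
     (\<forall>t\<ge>0. \<forall>f\<in>C0. kernel_op K t f \<in> C0) \<and>
     (\<forall>f\<in>C0. kernel_op K 0 f = f) \<and>
     (\<forall>s\<ge>0. \<forall>t\<ge>0. \<forall>f\<in>C0. kernel_op K (s + t) f = kernel_op K s (kernel_op K t f)) \<and>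
     (\<forall>f\<in>C0. uniform_limit UNIV (\<lambda>t. kernel_op K t f) f (at_right 0))"

text \<open>Operators on $C_0$ with the supremum norm are represented by their graphs.\<close>

definition generator ::
  "(real \<Rightarrow> 'a::euclidean_space \<Rightarrow> 'a measure) \<Rightarrow> (('a \<Rightarrow> real) \<times> ('a \<Rightarrow> real)) set" where
  "generator K = {(f, h). f \<in> C0 \<and> h \<in> C0 \<and>
     uniform_limit UNIV (\<lambda>t x. (kernel_op K t f x - f x) / t) h (at_right 0)}"

definition graph_closure ::
  "(('a \<Rightarrow> real) \<times> ('a \<Rightarrow> real)) set \<Rightarrow> (('a \<Rightarrow> real) \<times> ('a \<Rightarrow> real)) set" where
  "graph_closure G = {(f, h). \<exists>u v. (\<forall>n::nat. (u n, v n) \<in> G) \<and>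
     uniform_limit UNIV u f sequentially \<and> uniform_limit UNIV v h sequentially}"

definition laplacian_plus ::
  "('a::euclidean_space \<Rightarrow> real) \<Rightarrow> (('a \<Rightarrow> real) \<times> ('a \<Rightarrow> real)) set" where
  "laplacian_plus V = {(f, \<lambda>x. laplacian f x + V x * f x) | f.
     f \<in> C2b \<and> compact (closure (support_on UNIV f))}"

text \<open>
  The differential operator $\Delta + V$ on $C^2_c$ is not closed. As usual, the semigroup
  generated by it is the one whose generator is its closure; this determines the kernels at all
  nonnegative times.
\<close>

definition generated_by_laplacian_plus ::
  "(real \<Rightarrow> 'a::euclidean_space \<Rightarrow> 'a measure) \<Rightarrow> ('a \<Rightarrow> real) \<Rightarrow> bool" where
  "generated_by_laplacian_plus K V \<longleftrightarrow>
     C0_semigroup K \<and> generator K = graph_closure (laplacian_plus V)"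


section \<open>Martingales on the time set $[0,\infty)$\<close>

text \<open>
  Processes are indexed by \<^typ>\<open>real\<close>, but only nonnegative times matter. A filtration indexed
  by $[0,\infty)$ extends to negative times by its value at time 0.
\<close>

definition adapted :: "(real \<Rightarrow> 'w measure) \<Rightarrow> (real \<Rightarrow> 'w \<Rightarrow> real) \<Rightarrow> bool" where
  "adapted F Y \<longleftrightarrow> (\<forall>t\<ge>0. Y t \<in> borel_measurable (F t))"

definition martingale ::
  "'w measure \<Rightarrow> (real \<Rightarrow> 'w measure) \<Rightarrow> (real \<Rightarrow> 'w \<Rightarrow> real) \<Rightarrow> bool" where
  "martingale M F Y \<longleftrightarrow>
     adapted F Y \<and> (\<forall>t\<ge>0. integrable M (Y t)) \<and>
     (\<forall>s t. 0 \<le> s \<and> s \<le> t \<longrightarrow> (AE \<omega> in M. real_cond_exp M (F s) (Y t) \<omega> = Y s \<omega>))"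

definition continuous_paths :: "'w measure \<Rightarrow> (real \<Rightarrow> 'w \<Rightarrow> real) \<Rightarrow> bool" where
  "continuous_paths M Y \<longleftrightarrow> (\<forall>\<omega>\<in>space M. continuous_on {0..} (\<lambda>t. Y t \<omega>))"

text \<open>Square integrability is required at each time, not uniformly in time.\<close>

definition continuous_L2_martingale ::
  "'w measure \<Rightarrow> (real \<Rightarrow> 'w measure) \<Rightarrow> (real \<Rightarrow> 'w \<Rightarrow> real) \<Rightarrow> bool" where
  "continuous_L2_martingale M F Y \<longleftrightarrow>
     martingale M F Y \<and> continuous_paths M Y \<and> (\<forall>t\<ge>0. integrable M (\<lambda>\<omega>. (Y t \<omega>)\<^sup>2))"

definition quadratic_variation ::
  "'w measure \<Rightarrow> (real \<Rightarrow> 'w measure) \<Rightarrow> (real \<Rightarrow> 'w \<Rightarrow> real) \<Rightarrow> (real \<Rightarrow> 'w \<Rightarrow> real) \<Rightarrow> bool" where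
  "quadratic_variation M F Y A \<longleftrightarrow>
     adapted F A \<and> continuous_paths M A \<and>
     (\<forall>\<omega>\<in>space M. A 0 \<omega> = 0 \<and> mono_on {0..} (\<lambda>t. A t \<omega>)) \<and>
     martingale M F (\<lambda>t \<omega>. (Y t \<omega>)\<^sup>2 - A t \<omega>)"


section \<open>Super-Brownian motion in random environment\<close>

definition mart_process ::
  "(real \<Rightarrow> 'w \<Rightarrow> 'a::euclidean_space measure) \<Rightarrow> 'a measure \<Rightarrow> ('a \<Rightarrow> real)
    \<Rightarrow> real \<Rightarrow> 'w \<Rightarrow> real" where
  "mart_process X \<mu> f t \<omega> =
     integral\<^sup>L (X t \<omega>) f - integral\<^sup>L \<mu> f
       - (LBINT s:{0..t}. integral\<^sup>L (X s \<omega>) (laplacian f))"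

definition mart_variation ::
  "(real \<Rightarrow> 'w \<Rightarrow> 'a::euclidean_space measure) \<Rightarrow> ('a \<times> 'a \<Rightarrow> real) \<Rightarrow> ('a \<Rightarrow> real)
    \<Rightarrow> real \<Rightarrow> 'w \<Rightarrow> real" where
  "mart_variation X g f t \<omega> =
     (LBINT s:{0..t}. integral\<^sup>L (X s \<omega>) (\<lambda>x. (f x)\<^sup>2))
       + (LBINT s:{0..t}. integral\<^sup>L (X s \<omega> \<Otimes>\<^sub>M X s \<omega>) (\<lambda>z. g z * (f \<otimes>\<^sub>f f) z))"

text \<open>
  Solutions of the martingale problem with weakly continuous paths in the finite measures,
  with respect to an arbitrary filtration. Adaptedness is measurability for the Borel sets of the
  weak topology, which are generated by the maps $\nu \mapsto \langle f,\nu\rangle$, $f \in C_b$.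
\<close>

locale sbm_random_environment = prob_space M + filtration "space M" F
  for M :: "'w measure" and F :: "real \<Rightarrow> 'w measure" +
  fixes X :: "real \<Rightarrow> 'w \<Rightarrow> 'a::euclidean_space measure"
    and g :: "'a \<times> 'a \<Rightarrow> real"
    and \<mu> :: "'a measure"
  assumes subalgebra: "\<And>t. subalgebra M (F t)"
    and finite_measures:
      "\<And>t \<omega>. 0 \<le> t \<Longrightarrow> \<omega> \<in> space M \<Longrightarrow> finite_measure (X t \<omega>) \<and> sets (X t \<omega>) = sets borel"
    and weakly_continuous:
      "\<And>f. f \<in> bcontfun \<Longrightarrow> continuous_paths M (\<lambda>t \<omega>. integral\<^sup>L (X t \<omega>) f)"
    and adapted: "\<And>f. f \<in> bcontfun \<Longrightarrow> adapted F (\<lambda>t \<omega>. integral\<^sup>L (X t \<omega>) f)"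
    and start: "AE \<omega> in M. X 0 \<omega> = \<mu>"
    and mart: "\<And>f. f \<in> C2b \<Longrightarrow> continuous_L2_martingale M F (mart_process X \<mu> f)"
    and variation: "\<And>f. f \<in> C2b \<Longrightarrow>
      quadratic_variation M F (mart_process X \<mu> f) (mart_variation X g f)"

end

theory Submission
  imports Defs
begin

text \<open>
  Put $m_1(s,f) = E X_s(f)$ and $m_2(s,\psi) = E \langle \psi, X_s \otimes X_s \rangle$. The martingale problem
  gives $\partial_s m_1(f) = m_1(\Delta f)$ and, after polarisation,
  $\partial_s m_2(\psi) = m_2((\Delta + g) \psi) + m_1(\pi \psi)$ for $\psi = f \otimes h$. Mollification with
  product bumps extends the second identity to $C^2_c$ on the product space, and closedness extends both to
  the domains of the generators. Duhamel's principle for the two semigroups then gives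
  $m_1(s,f) = \langle P_s f, \mu \rangle$ and the formula for $m_2(t,\psi)$ with $\psi \in C_0$; truncating
  $\phi \otimes \phi$ and dominated convergence finish the proof.
\<close>

section \<open>Functions vanishing at infinity and strongly continuous semigroups\<close>

text \<open>Three obstacles shape the proof. The quadratic variation prescribes the evolution of the
  second moment only on products, while the generator of \<open>Q\<close> is the closure of an
  operator on all of C^2_c of the product space. Mollification bridges this gap because it is
  written as an integral with values in the bounded continuous functions, so that any bounded
  functional may be moved inside it. Secondly, only integrability in s of the second moment is
  established, not continuity, so Duhamel's formula cannot come from a product rule. Instead the
  generator image is approximated by an element of the domain, along which the functional is
  Lipschitz in time. Thirdly, the kernels may create mass, and the definition of a semigroup bounds
  their mass only at each fixed time. The bound uniform on [0,t] is extracted from strong continuity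
  by a gliding hump; continuity of the semigroup, Duhamel's formula and the final limit all use
  it.\<close>

instance bcontfun :: (metric_space, banach) banach ..

text \<open>\<open>C0\<close> is a set of bare functions; this copy lives in the type of bounded
  continuous functions, where the supremum norm, limits and vector-valued integrals are
  available.\<close>

definition C0c :: "('b::euclidean_space \<Rightarrow>\<^sub>C real) set" where
  "C0c = {f. apply_bcontfun f \<in> C0}"

lemma abs_apply_bcontfun_le: "\<bar>apply_bcontfun (f :: 'b::topological_space \<Rightarrow>\<^sub>C real) x\<bar> \<le> norm f"
  using norm_bounded[of f x] by simp

lemma bounded_linear_apply_bcontfun:
  "bounded_linear (\<lambda>h :: 'b::topological_space \<Rightarrow>\<^sub>C real. apply_bcontfun h y)"
  by (rule bounded_linear_intro[of _ 1]) (auto intro: abs_apply_bcontfun_le)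

lemma C0_bcontfun:
  fixes f :: "'b::euclidean_space \<Rightarrow> real"
  assumes "f \<in> C0"
  shows "f \<in> bcontfun"
proof -
  have c: "continuous_on UNIV f" and l: "(f \<longlongrightarrow> 0) at_infinity" using assms by (auto simp: C0_def)
  have "\<forall>\<^sub>F x in at_infinity. norm (f x) < 1"
    using tendstoD[OF l, of 1] by (simp add: dist_norm)
  then obtain b where b: "\<And>x. b \<le> norm x \<Longrightarrow> norm (f x) < 1" by (auto simp: eventually_at_infinity)
  have "bounded (f ` cball 0 b)"
    by (intro compact_imp_bounded compact_continuous_image continuous_on_subset[OF c]) auto
  then obtain B where B: "\<And>x. norm x \<le> b \<Longrightarrow> norm (f x) \<le> B" by (force simp: bounded_iff)
  have "norm (f x) \<le> max B 1" for x
    using B[of x] b[of x] by (cases "norm x \<le> b") auto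
  then show ?thesis using c by (rule bcontfun_normI[rotated])
qed

lemma Bcontfun_C0c: "f \<in> C0 \<Longrightarrow> Bcontfun f \<in> C0c"
  by (simp add: C0c_def Bcontfun_inverse C0_bcontfun)

lemma subspace_C0c: "subspace C0c"
  by (auto simp: subspace_def C0c_def C0_def intro: continuous_intros tendsto_eq_intros)

lemma closed_C0c: "closed C0c"
  unfolding closed_sequential_limits
proof safe
  fix f :: "nat \<Rightarrow> 'a \<Rightarrow>\<^sub>C real" and l
  assume f: "\<forall>n. f n \<in> C0c" and l: "f \<longlonglongrightarrow> l"
  have "(apply_bcontfun l \<longlongrightarrow> 0) at_infinity"
  proof (rule tendstoI)
    fix e :: real assume "0 < e"
    then have "\<forall>\<^sub>F n in sequentially. dist (f n) l < e/2" by (intro tendstoD[OF l]) auto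
    then obtain n where n: "dist (f n) l < e/2" by (auto simp: eventually_sequentially)
    have "(apply_bcontfun (f n) \<longlongrightarrow> 0) at_infinity" using f by (auto simp: C0c_def C0_def)
    then have "\<forall>\<^sub>F x in at_infinity. dist (f n x) 0 < e/2" using \<open>0 < e\<close> by (intro tendstoD) auto
    then show "\<forall>\<^sub>F x in at_infinity. dist (l x) 0 < e"
    proof eventually_elim
      case (elim x)
      have "\<bar>l x\<bar> \<le> \<bar>f n x\<bar> + \<bar>f n x - l x\<bar>" by linarith
      moreover
      have "dist (f n x) (l x) < e/2" using dist_fun_lt_imp_dist_val_lt[OF n] .
      ultimately show ?case using elim by (simp add: dist_norm)
    qed
  qed
  then show "l \<in> C0c" by (auto simp: C0c_def C0_def)
qed

text \<open>Riemann sums over tagged divisions stay in the subspace and closedness keeps their limit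
  there. The semigroup is controlled only on \<open>C0c\<close>, while integrals are formed in the
  whole space, so averages have to be brought back to \<open>C0c\<close>.\<close>

lemma integral_in_closed_subspace:
  fixes f :: "'n::euclidean_space \<Rightarrow> 'e::banach"
  assumes "subspace S" "closed S" "\<And>x. x \<in> cbox a b \<Longrightarrow> f x \<in> S"
  shows "integral (cbox a b) f \<in> S"
proof (cases "f integrable_on cbox a b")
  case False
  \<comment> \<open>The integral of a nonintegrable function is 0 by convention, and 0 lies in every
    subspace.\<close>
  then show ?thesis using assms(1) by (simp add: not_integrable_integral subspace_0)
next
  case True
  have "integral (cbox a b) f \<in> closure S"
    unfolding closure_approachable
  proof safe
    fix e :: real assume "0 < e"
    from has_integral_integral[THEN iffD1, OF True, unfolded has_integral, rule_format, OF this]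
    obtain d where d: "gauge d" and
      *: "\<And>D. D tagged_division_of cbox a b \<and> d fine D \<Longrightarrow>
        norm ((\<Sum>(x,k)\<in>D. measure lborel k *\<^sub>R f x) - integral (cbox a b) f) < e" by auto
    obtain D where D: "D tagged_division_of cbox a b" "d fine D" using fine_division_exists[OF d] by blast
    have "(\<Sum>(x,k)\<in>D. measure lborel k *\<^sub>R f x) \<in> S"
    proof (intro subspace_sum[OF assms(1)], clarsimp)
      fix x k assume "(x, k) \<in> D"
      then have "x \<in> cbox a b" using D(1) by (meson tag_in_interval tagged_division_ofD)
      then show "measure lborel k *\<^sub>R f x \<in> S" by (intro subspace_scale[OF assms(1)] assms(3))
    qed
    then show "\<exists>y\<in>S. dist y (integral (cbox a b) f) < e"
      using *[OF conjI[OF D]] by (auto simp: dist_norm)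
  qed
  then show ?thesis using assms(2) by simp
qed

text \<open>Elements of \<open>C0\<close> that tend to 1 pointwise: the bridge from
  \<open>C0\<close>, where the semigroup law is stated, to the total mass of a kernel and to test
  functions that do not vanish at infinity.\<close>

definition cutoff :: "nat \<Rightarrow> 'b::euclidean_space \<Rightarrow> real" where
  "cutoff n x = max 0 (min 1 (real n + 1 - norm x))"

lemma cutoff_bounds: "0 \<le> cutoff n x" "cutoff n x \<le> 1" "\<bar>cutoff n x\<bar> \<le> 1"
  by (auto simp: cutoff_def)

lemma C0I_support:
  assumes "continuous_on UNIV f" "\<And>x. r < norm x \<Longrightarrow> f x = 0"
  shows "f \<in> C0"
proof -
  have "\<forall>\<^sub>F x in at_infinity. f x = 0"
    unfolding eventually_at_infinity by (intro exI[of _ "r+1"]) (auto intro: assms(2))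
  then show ?thesis using assms(1) by (simp add: C0_def tendsto_eventually)
qed

lemma cutoff_mult_C0:
  assumes "continuous_on UNIV f"
  shows "(\<lambda>x. cutoff n x * f x) \<in> C0"
  by (rule C0I_support[of _ "real n + 1"])
     (auto simp: cutoff_def intro!: continuous_intros assms)

lemma cutoff_C0: "cutoff n \<in> C0"
  using cutoff_mult_C0[of "\<lambda>_. 1" n] by simp

lemma cutoff_LIMSEQ: "(\<lambda>n. cutoff n x) \<longlonglongrightarrow> 1"
proof -
  obtain N :: nat where N: "norm x \<le> real N" using real_arch_simple by blast
  have "\<forall>\<^sub>F n in sequentially. cutoff n x = 1"
    using eventually_ge_at_top[of N]
    by eventually_elim (use N in \<open>auto simp: cutoff_def\<close>)
  then show ?thesis by (rule tendsto_eventually)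
qed

lemma bcontfun_integrable:
  fixes f :: "'b::topological_space \<Rightarrow>\<^sub>C real"
  assumes "finite_measure m" "sets m = sets borel"
  shows "integrable m (apply_bcontfun f)"
proof -
  interpret finite_measure m by fact
  show ?thesis
    by (rule integrable_const_bound[of _ "norm f"])
       (use norm_bounded[of f] in \<open>auto simp: measurable_cong_sets[OF assms(2) refl]
          intro!: borel_measurable_continuous_onI\<close>)
qed

lemma bcontfun_abs_bound:
  fixes f :: "'b::topological_space \<Rightarrow> real"
  assumes "f \<in> bcontfun" obtains B where "\<And>x. \<bar>f x\<bar> \<le> B"
proof -
  have "\<bar>f x\<bar> \<le> norm (Bcontfun f)" for x
    using abs_apply_bcontfun_le[of "Bcontfun f" x] by (simp add: Bcontfun_inverse assms)
  then show ?thesis using that by blast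
qed

lemma bcontfun_integrable':
  fixes f :: "'b::topological_space \<Rightarrow> real"
  assumes "finite_measure m" "sets m = sets borel" "f \<in> bcontfun"
  shows "integrable m f"
  using bcontfun_integrable[OF assms(1,2), of "Bcontfun f"] by (simp add: Bcontfun_inverse assms(3))

lemma bcontfun_integral_bound:
  fixes f :: "'b::topological_space \<Rightarrow>\<^sub>C real"
  assumes "finite_measure m" "sets m = sets borel"
  shows "\<bar>integral\<^sup>L m (apply_bcontfun f)\<bar> \<le> measure m UNIV * norm f"
proof -
  interpret finite_measure m by fact
  have sp: "space m = UNIV" using sets_eq_imp_space_eq[OF assms(2)] by simp
  have "\<bar>integral\<^sup>L m (apply_bcontfun f)\<bar> \<le> (\<integral>x. \<bar>f x\<bar> \<partial>m)"
    using integral_abs_bound by blast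
  also have "\<dots> \<le> (\<integral>x. norm f \<partial>m)"
    by (intro integral_mono integrable_abs bcontfun_integrable assms)
       (use norm_bounded[of f] in auto)
  finally show ?thesis by (simp add: sp)
qed

lemma bcontfun_integral_bounded_linear:
  assumes "finite_measure m" "sets m = sets borel"
  shows "bounded_linear (\<lambda>f :: 'b::topological_space \<Rightarrow>\<^sub>C real. integral\<^sup>L m (apply_bcontfun f))"
  by (rule bounded_linear_intro[of _ "measure m UNIV"])
     (use assms bcontfun_integral_bound[OF assms] in
       \<open>auto simp: bcontfun_integrable mult.commute\<close>)

section \<open>Strongly continuous semigroups of kernels\<close>

locale C0_sg =
  fixes K :: "real \<Rightarrow> 'b::euclidean_space \<Rightarrow> 'b measure"
  assumes sg: "C0_semigroup K"
begin

text \<open>\<open>Bcontfun\<close> has a meaningful value only on bounded continuous functions, so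
  facts about \<open>T\<close> are confined to nonnegative times and arguments in
  \<open>C0c\<close>.\<close>

definition T :: "real \<Rightarrow> ('b \<Rightarrow>\<^sub>C real) \<Rightarrow> 'b \<Rightarrow>\<^sub>C real" where
  "T t f = Bcontfun (kernel_op K t (apply_bcontfun f))"

lemma finite_K: "0 \<le> t \<Longrightarrow> finite_measure (K t x)" "0 \<le> t \<Longrightarrow> sets (K t x) = sets borel"
  using sg by (auto simp: C0_semigroup_def)

lemma space_K: "0 \<le> t \<Longrightarrow> space (K t x) = UNIV"
  using sets_eq_imp_space_eq[OF finite_K(2)] by simp

lemma apply_T:
  assumes "0 \<le> t" "f \<in> C0c"
  shows "apply_bcontfun (T t f) x = (\<integral>y. f y \<partial>K t x)"
proof -
  have "kernel_op K t (apply_bcontfun f) \<in> C0"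
    using assms sg by (auto simp: C0_semigroup_def C0c_def)
  then show ?thesis by (simp add: T_def Bcontfun_inverse C0_bcontfun kernel_op_def)
qed

lemma apply_T': "0 \<le> t \<Longrightarrow> f \<in> C0c \<Longrightarrow> apply_bcontfun (T t f) = kernel_op K t (apply_bcontfun f)"
  by (auto simp: apply_T kernel_op_def)

lemma T_C0c: "0 \<le> t \<Longrightarrow> f \<in> C0c \<Longrightarrow> T t f \<in> C0c"
  using sg by (auto simp: C0_semigroup_def C0c_def apply_T')

lemma T_diff: "0 \<le> t \<Longrightarrow> f \<in> C0c \<Longrightarrow> g \<in> C0c \<Longrightarrow> T t (f - g) = T t f - T t g"
  by (intro bcontfun_eqI) (simp add: apply_T subspace_diff[OF subspace_C0c] bcontfun_integrable finite_K)

lemma T_scale: "0 \<le> t \<Longrightarrow> f \<in> C0c \<Longrightarrow> T t (c *\<^sub>R f) = c *\<^sub>R T t f"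
  by (intro bcontfun_eqI) (simp add: apply_T subspace_scale[OF subspace_C0c])

lemma T_zero: "f \<in> C0c \<Longrightarrow> T 0 f = f"
  using sg by (intro bcontfun_eqI) (auto simp: apply_T' C0_semigroup_def C0c_def)

lemma T_semigroup: "0 \<le> s \<Longrightarrow> 0 \<le> t \<Longrightarrow> f \<in> C0c \<Longrightarrow> T (s + t) f = T s (T t f)"
  using sg by (intro bcontfun_eqI) (simp add: apply_T' T_C0c C0_semigroup_def C0c_def)

lemma T_right_0:
  assumes "f \<in> C0c" shows "((\<lambda>t. T t f) \<longlongrightarrow> f) (at_right 0)"
proof (rule uniform_limit_tendsto_bcontfun)
  have ev: "\<forall>\<^sub>F t in at_right 0. \<forall>x\<in>UNIV. kernel_op K t (apply_bcontfun f) x = T t f x"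
    by (auto simp: eventually_at_right_field assms apply_T' intro!: exI[of _ 1])
  have "uniform_limit UNIV (\<lambda>t. kernel_op K t (apply_bcontfun f)) f (at_right 0)"
    using sg assms by (auto simp: C0_semigroup_def C0c_def)
  then show "uniform_limit UNIV (\<lambda>x. apply_bcontfun (T x f)) (apply_bcontfun f) (at_right 0)"
    by (rule iffD1[OF uniform_limit_cong[OF ev refl]])
qed

text \<open>The constant 1 is not in \<open>C0\<close>, so the semigroup law says nothing about it
  directly; estimates are proved for the cutoffs and passed to the total mass.\<close>

lemma mass_approx:
  assumes "0 \<le> t"
  shows "(\<lambda>n. \<integral>y. cutoff n y \<partial>K t x) \<longlonglongrightarrow> measure (K t x) UNIV"
proof -
  interpret finite_measure "K t x" using assms by (rule finite_K)
  have [measurable]: "cutoff n \<in> borel_measurable (K t x)" for n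
    unfolding measurable_cong_sets[OF finite_K(2)[OF assms] refl]
    using cutoff_C0[of n] by (auto simp: C0_def intro: borel_measurable_continuous_onI)
  have "(\<lambda>n. \<integral>y. cutoff n y \<partial>K t x) \<longlonglongrightarrow> (\<integral>y. 1 \<partial>K t x)"
    by (rule integral_dominated_convergence[where w="\<lambda>_. 1"])
       (auto simp: cutoff_LIMSEQ cutoff_bounds)
  then show ?thesis by (simp add: space_K[OF assms])
qed

lemma mass_leI:
  assumes "0 \<le> t" "\<And>n. (\<integral>y. cutoff n y \<partial>K t x) \<le> c"
  shows "measure (K t x) UNIV \<le> c"
  using LIMSEQ_le_const2[OF mass_approx[OF assms(1)]] assms(2) by blast

lemma mass_zero: "measure (K 0 x) UNIV \<le> 1"
proof (rule mass_leI)
  fix n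
  have "kernel_op K 0 (cutoff n) = cutoff n" using sg cutoff_C0[of n] by (auto simp: C0_semigroup_def)
  then show "(\<integral>y. cutoff n y \<partial>K 0 x) \<le> 1" by (metis kernel_op_def cutoff_bounds(2))
qed simp

text \<open>Gliding hump. If the mass were unbounded near time 0, there would be times tending to 0
  at which the kernel integrates some cutoff to more than \<open>4 ^ n\<close>. A weighted sum
  \<open>F\<close> of these cutoffs lies in \<open>C0c\<close>, and \<open>T (t n) F\<close> blows
  up although it must converge to \<open>F\<close>.\<close>

lemma mass_bounded_near_0: "\<exists>d>0. \<exists>C. \<forall>t x. 0 < t \<and> t < d \<longrightarrow> measure (K t x) UNIV \<le> C"
proof (rule ccontr)
  assume neg: "\<not> ?thesis"
  have "\<exists>t x k. 0 < t \<and> t < inverse (real (Suc n)) \<and> 4 ^ n < (\<integral>y. cutoff k y \<partial>K t x)" for n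
  proof -
    obtain t x where tx: "0 < t" "t < inverse (real (Suc n))" "4^n < measure (K t x) UNIV"
      using neg not_less by (metis inverse_positive_iff_positive of_nat_0_less_iff zero_less_Suc)
    then have "\<forall>\<^sub>F k in sequentially. 4 ^ n < (\<integral>y. cutoff k y \<partial>K t x)"
      using order_tendstoD(1)[OF mass_approx, of t] by simp
    then obtain k where "4 ^ n < (\<integral>y. cutoff k y \<partial>K t x)" by (auto simp: eventually_sequentially)
    then show ?thesis using tx by blast
  qed
  then obtain t x k where t: "\<And>n. 0 < t n" "\<And>n. t n < inverse (real (Suc n))"
    and big: "\<And>n. 4 ^ n < (\<integral>y. cutoff (k n) y \<partial>K (t n) (x n))" by metis
  \<comment> \<open>The weights \<open>(1/2) ^ n\<close> make the series converge in norm and still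
    leave \<open>(1/2) ^ n * 4 ^ n = 2 ^ n\<close> to diverge.\<close>
  define f :: "nat \<Rightarrow> 'b \<Rightarrow>\<^sub>C real" where "f n = (1/2) ^ n *\<^sub>R Bcontfun (cutoff (k n))" for n
  have ap: "apply_bcontfun (f n) y = (1/2)^n * cutoff (k n) y" for n y
    by (simp add: f_def Bcontfun_inverse C0_bcontfun cutoff_C0)
  have fC: "f n \<in> C0c" for n
    unfolding f_def by (intro subspace_scale[OF subspace_C0c] Bcontfun_C0c cutoff_C0)
  have nf: "norm (f n) \<le> (1/2) ^ n" for n
    by (rule norm_bound) (simp add: ap abs_mult mult_left_le cutoff_bounds)
  have sm: "summable f"
    by (rule summable_comparison_test[OF _ summable_geometric[of "1/2::real"]]) (use nf in auto)
  define F where "F = suminf f"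
  have FC: "F \<in> C0c" unfolding F_def
    using sm fC by (intro closed_sequentially[OF closed_C0c _ summable_LIMSEQ])
      (auto intro: subspace_sum[OF subspace_C0c])
  \<comment> \<open>All summands are nonnegative and the kernels are measures, so the n-th hump
    cannot be cancelled by the other summands.\<close>
  have Fge: "f n y \<le> F y" for n y
  proof -
    note bl = bounded_linear_apply_bcontfun[where 'b='b, of y]
    have s: "summable (\<lambda>n. f n y)" and e: "F y = (\<Sum>n. f n y)"
      using bounded_linear.summable[OF bl sm] bounded_linear.suminf[OF bl sm] by (auto simp: F_def)
    show ?thesis unfolding e using sum_le_suminf[OF s, of "{n}"] by (auto simp: ap cutoff_bounds)
  qed
  have lower: "2 ^ n < norm (T (t n) F)" for n
  proof -
    have t0: "0 \<le> t n" using t(1)[of n] by simp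
    have "2 ^ n = (1/2)^n * (4::real)^n" by (simp flip: power_mult_distrib)
    also have "\<dots> < (1/2)^n * (\<integral>y. cutoff (k n) y \<partial>K (t n) (x n))"
      using big[of n] by (intro mult_strict_left_mono) auto
    also have "\<dots> = (\<integral>y. f n y \<partial>K (t n) (x n))" by (simp add: ap)
    also have "\<dots> \<le> (\<integral>y. F y \<partial>K (t n) (x n))"
      by (intro integral_mono bcontfun_integrable finite_K t0 Fge)
    also have "\<dots> = T (t n) F (x n)" by (simp add: apply_T t0 FC)
    also have "\<dots> \<le> norm (T (t n) F)" using norm_bounded[of "T (t n) F" "x n"] by simp
    finally show ?thesis .
  qed
  have "t \<longlonglongrightarrow> 0"
    by (rule tendsto_sandwich[OF _ _ tendsto_const LIMSEQ_inverse_real_of_nat])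
       (use t in \<open>auto intro!: always_eventually less_imp_le\<close>)
  then have "filterlim t (at_right 0) sequentially"
    using t(1) by (simp add: filterlim_at less_imp_neq[symmetric])
  from filterlim_compose[OF T_right_0[OF FC] this] have "(\<lambda>n. T (t n) F) \<longlonglongrightarrow> F" .
  then have "Bseq (\<lambda>n. T (t n) F)" by (intro convergent_imp_Bseq convergentI)
  then obtain B where B: "\<And>n. norm (T (t n) F) \<le> B" by (auto simp: Bseq_def)
  obtain n where "B < 2 ^ n" using real_arch_pow[of 2 B] by auto
  then show False using lower[of n] B[of n] by simp
qed

text \<open>The semigroup law applied to a cutoff: the inner operator maps it to a function of size
  at most \<open>C\<close>, the outer one integrates that bound. \<open>mass_leI\<close> then
  removes the cutoff.\<close>

lemma mass_add:
  assumes "0 \<le> s" "0 \<le> t" "\<And>y. measure (K t y) UNIV \<le> C"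
  shows "measure (K (s + t) x) UNIV \<le> C * measure (K s x) UNIV"
proof (rule mass_leI)
  fix n
  let ?c = "Bcontfun (cutoff n) :: 'b \<Rightarrow>\<^sub>C real"
  have ap: "apply_bcontfun ?c = cutoff n" by (simp add: Bcontfun_inverse C0_bcontfun cutoff_C0)
  have cC: "?c \<in> C0c" by (intro Bcontfun_C0c cutoff_C0)
  interpret finite_measure "K s x" using assms by (intro finite_K)
  have "T t ?c y \<le> C" for y
  proof -
    have "norm ?c \<le> 1" by (rule norm_bound) (simp add: ap cutoff_bounds)
    then have "\<bar>T t ?c y\<bar> \<le> measure (K t y) UNIV * 1"
      using bcontfun_integral_bound[OF finite_K[OF assms(2)], of y ?c]
        mult_left_mono[of "norm ?c" 1 "measure (K t y) UNIV"]
      by (simp add: apply_T assms cC)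
    then show ?thesis using assms(3)[of y] by simp
  qed
  then have "(\<integral>y. T t ?c y \<partial>K s x) \<le> (\<integral>y. C \<partial>K s x)"
    by (intro integral_mono bcontfun_integrable finite_K assms) auto
  moreover have "(\<integral>y. cutoff n y \<partial>K (s + t) x) = T (s + t) ?c x"
    using assms by (simp add: apply_T cC ap)
  moreover have "\<dots> = (\<integral>y. T t ?c y \<partial>K s x)"
    using assms by (simp add: T_semigroup apply_T T_C0c cC)
  ultimately show "(\<integral>y. cutoff n y \<partial>K (s + t) x) \<le> C * measure (K s x) UNIV"
    by (simp add: space_K assms mult.commute)
qed (use assms in auto)

text \<open>Steps of length \<open>d/2\<close>, shorter than the window \<open>d\<close> of the
  local bound, cover [0,t], and each step multiplies the bound by \<open>C\<close>.\<close>

lemma mass_bounded: "\<exists>C\<ge>1. \<forall>s\<in>{0..t}. \<forall>x. measure (K s x) UNIV \<le> C"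
proof -
  obtain d C0 where d: "0 < d" and C0: "\<And>t x. 0 < t \<Longrightarrow> t < d \<Longrightarrow> measure (K t x) UNIV \<le> C0"
    using mass_bounded_near_0 by blast
  define C where "C = max 1 C0"
  have C1: "1 \<le> C" by (simp add: C_def)
  have C: "measure (K t x) UNIV \<le> C" if "0 \<le> t" "t < d" for t x
    using that mass_zero[of x] C0[of t x] by (cases "t = 0") (auto simp: C_def)
  \<comment> \<open>Times below \<open>d\<close> are covered by the local bound, since
    \<open>1 \<le> C\<close> makes the powers increase. For \<open>d \<le> s\<close> the time
    \<open>s - d/2\<close> is nonnegative and falls under the induction hypothesis.\<close>
  have "\<forall>s\<in>{0..real n * (d/2)}. \<forall>x. measure (K s x) UNIV \<le> C ^ Suc n" for n
  proof (induction n)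
    case 0
    then show ?case using C[of 0] d by auto
  next
    case (Suc n)
    show ?case
    proof safe
      fix s x assume s: "s \<in> {0..real (Suc n) * (d/2)}"
      show "measure (K s x) UNIV \<le> C ^ Suc (Suc n)"
      proof (cases "s < d")
        case True
        have "C ^ 1 \<le> C ^ Suc (Suc n)" using C1 by (intro power_increasing) auto
        then show ?thesis using C[of s x] True s by auto
      next
        case False
        have "measure (K ((s - d/2) + d/2) x) UNIV \<le> C * measure (K (s - d/2) x) UNIV"
          using False d by (intro mass_add C) auto
        also have "\<dots> \<le> C * C ^ Suc n"
          using Suc False s d C1 by (intro mult_left_mono) (auto simp: algebra_simps)
        finally show ?thesis by simp
      qed
    qed
  qed
  moreover obtain n where "t / (d/2) \<le> real n" using real_arch_simple by blast
  then have "t \<le> real n * (d/2)" using d by (simp add: field_simps)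
  moreover have "1 \<le> C ^ Suc n" using C1 by (rule one_le_power)
  ultimately show ?thesis by (intro exI[of _ "C ^ Suc n"]) (meson atLeastAtMost_iff order_trans)
qed

lemma norm_T_bounded:
  obtains C where "1 \<le> C" "\<And>s f. 0 \<le> s \<Longrightarrow> s \<le> t \<Longrightarrow> f \<in> C0c \<Longrightarrow> norm (T s f) \<le> C * norm f"
proof -
  obtain C where C: "1 \<le> C" "\<And>s x. s \<in> {0..t} \<Longrightarrow> measure (K s x) UNIV \<le> C"
    using mass_bounded by blast
  have "norm (T s f) \<le> C * norm f" if "0 \<le> s" "s \<le> t" "f \<in> C0c" for s f
  proof (rule norm_bound)
    fix x
    have "\<bar>T s f x\<bar> \<le> measure (K s x) UNIV * norm f"
      using bcontfun_integral_bound[OF finite_K[OF that(1)]] that by (simp add: apply_T)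
    also have "\<dots> \<le> C * norm f" using C(2)[of s x] that by (intro mult_right_mono) auto
    finally show "norm (T s f x) \<le> C * norm f" by simp
  qed
  then show ?thesis using C that by blast
qed

lemma T_increment:
  assumes "0 \<le> r" "r \<le> s" "f \<in> C0c"
  shows "T s f - T r f = T r (T (s - r) f - f)"
  using assms T_semigroup[of r "s - r" f] by (simp add: T_diff T_C0c)

text \<open>The increment between two times is \<open>T\<close> at the smaller one applied to an
  increment at 0. Local boundedness of \<open>T\<close> therefore gives left continuity by the same
  estimate as right continuity.\<close>

lemma T_continuous:
  assumes "f \<in> C0c"
  shows "continuous_on {0..} (\<lambda>t. T t f)"
  unfolding continuous_on_iff
proof safe
  fix t e :: real assume t: "0 \<le> t" and e: "0 < e"
  obtain C where C: "1 \<le> C" "\<And>s f. 0 \<le> s \<Longrightarrow> s \<le> t + 1 \<Longrightarrow> f \<in> C0c \<Longrightarrow> norm (T s f) \<le> C * norm f"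
    using norm_T_bounded by blast
  have "\<forall>\<^sub>F u in at_right 0. dist (T u f) f < e / C"
    using T_right_0[OF assms] e C(1) by (intro tendstoD) auto
  then obtain d where d: "0 < d" "\<And>u. 0 < u \<Longrightarrow> u < d \<Longrightarrow> norm (T u f - f) < e / C"
    by (auto simp: eventually_at_right_field dist_norm)
  have *: "norm (T s f - T r f) < e" if "0 \<le> r" "r \<le> s" "s - r < d" "r \<le> t + 1" for r s
  proof (cases "r = s")
    case False
    have "norm (T s f - T r f) \<le> C * norm (T (s - r) f - f)"
      using that assms by (simp add: T_increment C(2) subspace_diff[OF subspace_C0c] T_C0c)
    also have "\<dots> < C * (e / C)" using d(2)[of "s - r"] that False C(1) by (intro mult_strict_left_mono) auto
    finally show ?thesis using C(1) by simp
  qed (use e in simp)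
  show "\<exists>d>0. \<forall>s\<in>{0..}. dist s t < d \<longrightarrow> dist (T s f) (T t f) < e"
  proof (intro exI[of _ d] conjI ballI impI d(1))
    fix s assume s: "s \<in> {0..}" "dist s t < d"
    show "dist (T s f) (T t f) < e"
    proof (cases "s \<le> t")
      case True
      then show ?thesis using *[of s t] s t by (auto simp: dist_norm norm_minus_commute)
    next
      case False
      then show ?thesis using *[of t s] s t by (auto simp: dist_norm)
    qed
  qed
qed

definition gen :: "('b \<Rightarrow>\<^sub>C real) \<Rightarrow> ('b \<Rightarrow>\<^sub>C real) \<Rightarrow> bool" where
  "gen f h \<longleftrightarrow> (apply_bcontfun f, apply_bcontfun h) \<in> generator K"

lemma gen_C0c: "gen f h \<Longrightarrow> f \<in> C0c" "gen f h \<Longrightarrow> h \<in> C0c"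
  by (auto simp: gen_def generator_def C0c_def)

lemma gen_iff:
  "gen f h \<longleftrightarrow> f \<in> C0c \<and> h \<in> C0c \<and> ((\<lambda>t. (T t f - f) /\<^sub>R t) \<longlongrightarrow> h) (at_right 0)"
proof (cases "f \<in> C0c \<and> h \<in> C0c")
  case True
  have "\<forall>\<^sub>F t in at_right 0. \<forall>x\<in>UNIV. (kernel_op K t (apply_bcontfun f) x - f x) / t = ((T t f - f) /\<^sub>R t) x"
    by (auto simp: eventually_at_right_field True apply_T' divide_inverse mult.commute intro!: exI[of _ 1])
  from uniform_limit_cong[OF this, of "apply_bcontfun h" "apply_bcontfun h"]
  have "gen f h \<longleftrightarrow> uniform_limit UNIV (\<lambda>t. apply_bcontfun ((T t f - f) /\<^sub>R t)) h (at_right 0)"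
    using True by (auto simp: gen_def generator_def C0c_def)
  also have "\<dots> \<longleftrightarrow> ((\<lambda>t. (T t f - f) /\<^sub>R t) \<longlongrightarrow> h) (at_right 0)"
    by (rule iffI, erule uniform_limit_tendsto_bcontfun, erule tendsto_bcontfun_uniform_limit)
  finally show ?thesis using True by simp
qed (auto dest: gen_C0c)

text \<open>The remainder equals \<open>(s - r)\<close> times \<open>T r\<close> of the remainder at
  time 0, so a bound on the norms of \<open>T r\<close> makes the first-order expansion uniform in
  the base point. \<open>duhamel\<close> needs this uniformity.\<close>

lemma gen_derivative:
  assumes "gen f h" "0 < e"
  obtains d where "0 < d"
    "\<And>r s. 0 \<le> r \<Longrightarrow> r \<le> s \<Longrightarrow> s \<le> t \<Longrightarrow> s - r < d \<Longrightarrow>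
       norm (T s f - T r f - (s - r) *\<^sub>R T r h) \<le> e * (s - r)"
proof -
  obtain C where C: "1 \<le> C" "\<And>s f. 0 \<le> s \<Longrightarrow> s \<le> t \<Longrightarrow> f \<in> C0c \<Longrightarrow> norm (T s f) \<le> C * norm f"
    using norm_T_bounded by blast
  have fh: "f \<in> C0c" "h \<in> C0c" and lim: "((\<lambda>t. (T t f - f) /\<^sub>R t) \<longlongrightarrow> h) (at_right 0)"
    using assms(1) by (auto simp: gen_iff)
  have "\<forall>\<^sub>F u in at_right 0. dist ((T u f - f) /\<^sub>R u) h < e / C"
    using assms C(1) by (intro tendstoD[OF lim]) auto
  then obtain d where d: "0 < d" "\<And>u. 0 < u \<Longrightarrow> u < d \<Longrightarrow> norm ((T u f - f) /\<^sub>R u - h) < e / C"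
    by (auto simp: eventually_at_right_field dist_norm)
  show ?thesis
  proof (rule that[OF d(1)])
    fix r s assume *: "0 \<le> r" "r \<le> s" "s \<le> t" "s - r < d"
    show "norm (T s f - T r f - (s - r) *\<^sub>R T r h) \<le> e * (s - r)"
    proof (cases "r = s")
      case False
      let ?u = "s - r"
      let ?w = "(T ?u f - f) /\<^sub>R ?u - h"
      have u: "0 < ?u" using False * by simp
      have wC: "?w \<in> C0c" using fh *
        by (intro subspace_diff[OF subspace_C0c] subspace_scale[OF subspace_C0c] T_C0c) auto
      have "T s f - T r f - ?u *\<^sub>R T r h = T r (T ?u f - f) - T r (?u *\<^sub>R h)"
        using * fh by (simp add: T_increment T_scale)
      also have "\<dots> = T r (?u *\<^sub>R ?w)"
        using * fh u by (subst T_diff[symmetric])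
          (auto intro!: subspace_diff[OF subspace_C0c] subspace_scale[OF subspace_C0c] T_C0c simp: scaleR_diff_right)
      also have "\<dots> = ?u *\<^sub>R T r ?w" using * wC by (simp add: T_scale)
      finally have "norm (T s f - T r f - ?u *\<^sub>R T r h) = ?u * norm (T r ?w)" using u by simp
      also have "\<dots> \<le> ?u * (C * norm ?w)" using u * wC by (intro mult_left_mono C(2)) auto
      also have "\<dots> \<le> ?u * (C * (e / C))"
        using u * C(1) d(2)[of ?u] by (intro mult_left_mono) auto
      finally show ?thesis using C(1) by (simp add: mult.commute)
    qed simp
  qed
qed

text \<open>\<open>T s\<close> commutes with the difference quotients at 0 and is bounded, so it
  preserves their limit.\<close>

lemma gen_T:
  assumes "gen f h" "0 \<le> s"
  shows "gen (T s f) (T s h)"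
proof -
  obtain C where C: "1 \<le> C" "\<And>f. f \<in> C0c \<Longrightarrow> norm (T s f) \<le> C * norm f"
    using norm_T_bounded[of s] assms by (metis order_refl)
  have fh: "f \<in> C0c" "h \<in> C0c" and lim: "((\<lambda>t. (T t f - f) /\<^sub>R t) \<longlongrightarrow> h) (at_right 0)"
    using assms(1) by (auto simp: gen_iff)
  have "((\<lambda>t. (T t (T s f) - T s f) /\<^sub>R t - T s h) \<longlongrightarrow> 0) (at_right 0)"
  proof (rule Lim_null_comparison)
    show "((\<lambda>t. C * norm ((T t f - f) /\<^sub>R t - h)) \<longlongrightarrow> 0) (at_right 0)"
      using lim by (intro tendsto_mult_right_zero tendsto_norm_zero) (rule LIM_zero)
    have "norm ((T t (T s f) - T s f) /\<^sub>R t - T s h) \<le> C * norm ((T t f - f) /\<^sub>R t - h)" if "0 < t" for t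
    proof -
      have "T t (T s f) = T s (T t f)" using that assms fh by (metis T_semigroup add.commute less_imp_le)
      then have "(T t (T s f) - T s f) /\<^sub>R t - T s h = T s ((T t f - f) /\<^sub>R t - h)"
        using that assms fh
        by (simp add: T_diff T_scale T_C0c subspace_diff[OF subspace_C0c] subspace_scale[OF subspace_C0c])
      then show ?thesis using that fh
        by (simp add: C(2) T_C0c subspace_diff[OF subspace_C0c] subspace_scale[OF subspace_C0c])
    qed
    then show "\<forall>\<^sub>F t in at_right 0. norm ((T t (T s f) - T s f) /\<^sub>R t - T s h) \<le> C * norm ((T t f - f) /\<^sub>R t - h)"
      by (auto simp: eventually_at_right_field intro!: exI[of _ 1])
  qed
  then show ?thesis using fh assms(2) by (auto simp: gen_iff T_C0c intro: LIM_zero_cancel)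
qed

end

text \<open>Linearity and the bound are required on all bounded continuous functions, uniformly over
  [0,t]. Regularity in s is left out because it differs between the two families that enter
  \<open>duhamel\<close>.\<close>

definition bounded_family :: "real \<Rightarrow> real \<Rightarrow> (real \<Rightarrow> 'e::real_normed_vector \<Rightarrow> real) \<Rightarrow> bool" where
  "bounded_family t C k \<longleftrightarrow> (\<forall>s\<in>{0..t}. bounded_linear (k s) \<and> (\<forall>f. \<bar>k s f\<bar> \<le> C * norm f))"

lemma bounded_familyD:
  assumes "bounded_family t C k" "s \<in> {0..t}"
  shows "bounded_linear (k s)" "\<bar>k s f\<bar> \<le> C * norm f"
  using assms by (auto simp: bounded_family_def)

section \<open>Density of the domain and Duhamel's principle\<close>

context C0_sg
begin

text \<open>The time average of \<open>T v f\<close> over a short interval [0,\<delta>] is close to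
  \<open>f\<close> and lies in the domain, because applying the semigroup to it only moves the
  endpoints of the interval.\<close>

lemma gen_dense:
  assumes "f \<in> C0c" "0 < e"
  obtains u h where "gen u h" "norm (u - f) \<le> e"
proof -
  have cont: "continuous_on {0..} (\<lambda>t. T t f)" using T_continuous[OF assms(1)] .
  have "\<forall>\<^sub>F u in at_right 0. dist (T u f) f < e"
    using T_right_0[OF assms(1)] assms(2) by (rule tendstoD)
  then obtain d where d: "0 < d" "\<And>u. 0 < u \<Longrightarrow> u < d \<Longrightarrow> norm (T u f - f) < e"
    by (auto simp: eventually_at_right_field dist_norm)
  define \<delta> where "\<delta> = d / 2"
  have \<delta>: "0 < \<delta>" "\<delta> < d" using d by (auto simp: \<delta>_def)
  define J where "J s = integral {0..s} (\<lambda>v. T v f)" for s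
  define u where "u = J \<delta> /\<^sub>R \<delta>"
  have int: "(\<lambda>v. T v f) integrable_on {a..b}" if "0 \<le> a" for a b
    by (intro integrable_continuous_interval continuous_on_subset[OF cont]) (use that in auto)
  have JC: "J s \<in> C0c" if "0 \<le> s" for s
    unfolding J_def box_real(2)[symmetric]
    by (rule integral_in_closed_subspace[OF subspace_C0c closed_C0c]) (use assms in \<open>auto intro: T_C0c\<close>)
  have uC: "u \<in> C0c" unfolding u_def using JC[of \<delta>] \<delta> by (intro subspace_scale[OF subspace_C0c]) auto
  have near: "norm (T v f - f) \<le> e" if "v \<in> {0..\<delta>}" for v
    using that d(2)[of v] \<delta> assms by (cases "v = 0") (auto simp: T_zero)
  have "u - f = integral {0..\<delta>} (\<lambda>v. T v f - f) /\<^sub>R \<delta>"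
  proof -
    have "integral {0..\<delta>} (\<lambda>v. T v f - f) = J \<delta> - integral {0..\<delta>} (\<lambda>v. f)"
      unfolding J_def by (intro Henstock_Kurzweil_Integration.integral_diff int) auto
    also have "integral {0..\<delta>} (\<lambda>v. f) = \<delta> *\<^sub>R f" using \<delta> by simp
    finally show ?thesis using \<delta> by (simp add: u_def scaleR_diff_right)
  qed
  moreover have "norm (integral {0..\<delta>} (\<lambda>v. T v f - f)) \<le> e * (\<delta> - 0)"
    by (rule integral_bound)
       (use near \<delta> in \<open>auto intro!: continuous_intros continuous_on_subset[OF cont]\<close>)
  ultimately have norm_u: "norm (u - f) \<le> e" using \<delta> by (simp add: field_simps)
  \<comment> \<open>\<open>T\<close> is controlled only on \<open>C0c\<close>, so it is not moved
    through the vector-valued integral as an operator. At a fixed point x it is integration against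
    a finite kernel, which is a bounded functional on the whole space.\<close>
  have Tu: "T \<tau> (J \<delta>) = J (\<delta> + \<tau>) - J \<tau>" if \<tau>: "0 \<le> \<tau>" for \<tau>
  proof (rule bcontfun_eqI)
    fix x
    have ev: "apply_bcontfun (integral {a..b} (\<lambda>v. T v f)) x = integral {a..b} (\<lambda>v. T v f x)" if "0 \<le> a" for a b
      using integral_linear[OF int[OF that] bounded_linear_apply_bcontfun[of x]] by (simp add: o_def)
    have "apply_bcontfun (T \<tau> (J \<delta>)) x = (\<integral>y. J \<delta> y \<partial>K \<tau> x)" using \<tau> \<delta> JC by (simp add: apply_T)
    also have "\<dots> = integral {0..\<delta>} (\<lambda>v. \<integral>y. T v f y \<partial>K \<tau> x)"
      using integral_linear[OF int[OF order_refl] bcontfun_integral_bounded_linear[OF finite_K[OF \<tau>, of x]], of \<delta>]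
      by (simp add: o_def J_def)
    also have "\<dots> = integral {0..\<delta>} (\<lambda>v. T (v + \<tau>) f x)"
      by (rule integral_cong) (use \<tau> assms in \<open>simp add: apply_T[symmetric] T_C0c T_semigroup add.commute[of _ \<tau>]\<close>)
    also have "\<dots> = integral {\<tau>..\<delta> + \<tau>} (\<lambda>v. T v f x)"
    proof -
      have "continuous_on {0 + \<tau>..\<delta> + \<tau>} (\<lambda>v. T v f x)"
        by (intro bounded_linear.continuous_on[OF bounded_linear_apply_bcontfun] continuous_on_subset[OF cont])
           (use \<tau> in auto)
      from integral_shift[OF this] show ?thesis by (simp add: o_def add.commute)
    qed
    also have "\<dots> = apply_bcontfun (integral {\<tau>..\<delta> + \<tau>} (\<lambda>v. T v f)) x" using \<tau> by (simp add: ev)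
    also have "integral {\<tau>..\<delta> + \<tau>} (\<lambda>v. T v f) = J (\<delta> + \<tau>) - J \<tau>"
      using Henstock_Kurzweil_Integration.integral_combine[of 0 \<tau> "\<delta> + \<tau>" "\<lambda>v. T v f"] \<tau> \<delta> int[of 0] by (simp add: J_def algebra_simps)
    finally show "apply_bcontfun (T \<tau> (J \<delta>)) x = (J (\<delta> + \<tau>) - J \<tau>) x" .
  qed
  \<comment> \<open>Fundamental theorem of calculus for the continuous curve \<open>T v f\<close>,
    restricted to increments to the right and rewritten as a difference quotient; s = 0 is
    included.\<close>
  have deriv: "((\<lambda>\<tau>. (J (s + \<tau>) - J s) /\<^sub>R \<tau>) \<longlongrightarrow> T s f) (at_right 0)" if s: "0 \<le> s" for s
  proof -
    have "((\<lambda>x. J x) has_vector_derivative T s f) (at s within {0..s+1})"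
      unfolding J_def using s
      by (intro integral_has_vector_derivative continuous_on_subset[OF cont]) auto
    then have "((\<lambda>x. J x) has_vector_derivative T s f) (at s within {s..s+1})"
      by (rule has_vector_derivative_within_subset) (use s in auto)
    then have "((\<lambda>y. (1 / norm (y - s)) *\<^sub>R (J y - (J s + (y - s) *\<^sub>R T s f))) \<longlongrightarrow> 0) (at_right s)"
      by (simp add: has_vector_derivative_def has_derivative_within at_within_Icc_at_right)
    then have "((\<lambda>\<tau>. (1 / norm \<tau>) *\<^sub>R (J (s + \<tau>) - (J s + \<tau> *\<^sub>R T s f))) \<longlongrightarrow> 0) (at_right 0)"
      by (subst (asm) at_right_to_0) (simp add: filterlim_filtermap add.commute)
    then have "((\<lambda>\<tau>. (J (s + \<tau>) - J s) /\<^sub>R \<tau> - T s f) \<longlongrightarrow> 0) (at_right 0)"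
    proof (rule Lim_transform_eventually)
      have "(1 / norm \<tau>) *\<^sub>R (J (s + \<tau>) - (J s + \<tau> *\<^sub>R T s f)) = (J (s + \<tau>) - J s) /\<^sub>R \<tau> - T s f"
        if "0 < \<tau>" for \<tau>
        using that by (simp add: algebra_simps divide_inverse)
      then show "\<forall>\<^sub>F \<tau> in at_right 0. (1 / norm \<tau>) *\<^sub>R (J (s + \<tau>) - (J s + \<tau> *\<^sub>R T s f)) = (J (s + \<tau>) - J s) /\<^sub>R \<tau> - T s f"
        by (auto simp: eventually_at_right_field intro!: exI[of _ 1])
    qed
    then show ?thesis by (rule LIM_zero_cancel)
  qed
  have J0: "J 0 = 0" by (simp add: J_def)
  \<comment> \<open>By \<open>Tu\<close> the increment of \<open>J \<delta>\<close> under
    \<open>T \<tau>\<close> is the increment of \<open>J\<close> at \<delta> minus its increment at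
    0, and \<open>deriv\<close> applies to both.\<close>
  have "((\<lambda>\<tau>. (T \<tau> u - u) /\<^sub>R \<tau>) \<longlongrightarrow> (T \<delta> f - T 0 f) /\<^sub>R \<delta>) (at_right 0)"
  proof (rule Lim_transform_eventually)
    show "((\<lambda>\<tau>. ((J (\<delta> + \<tau>) - J \<delta>) /\<^sub>R \<tau> - (J (0 + \<tau>) - J 0) /\<^sub>R \<tau>) /\<^sub>R \<delta>) \<longlongrightarrow> (T \<delta> f - T 0 f) /\<^sub>R \<delta>) (at_right 0)"
      using \<delta> by (intro tendsto_intros deriv) auto
    have "((J (\<delta> + \<tau>) - J \<delta>) /\<^sub>R \<tau> - (J (0 + \<tau>) - J 0) /\<^sub>R \<tau>) /\<^sub>R \<delta> = (T \<tau> u - u) /\<^sub>R \<tau>" if "0 < \<tau>" for \<tau>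
    proof -
      have "T \<tau> u = (J (\<delta> + \<tau>) - J \<tau>) /\<^sub>R \<delta>"
        using that \<delta> by (simp add: u_def T_scale JC Tu)
      then show ?thesis by (simp add: J0 u_def scaleR_diff_right mult.commute)
    qed
    then show "\<forall>\<^sub>F \<tau> in at_right 0. ((J (\<delta> + \<tau>) - J \<delta>) /\<^sub>R \<tau> - (J (0 + \<tau>) - J 0) /\<^sub>R \<tau>) /\<^sub>R \<delta> = (T \<tau> u - u) /\<^sub>R \<tau>"
      by (auto simp: eventually_at_right_field intro!: exI[of _ 1])
  qed
  then have "gen u ((T \<delta> f - T 0 f) /\<^sub>R \<delta>)"
    unfolding gen_iff using uC assms \<delta>
    by (auto intro!: subspace_scale[OF subspace_C0c] subspace_diff[OF subspace_C0c] T_C0c)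
  then show ?thesis using norm_u that by blast
qed

text \<open>Split the increment into \<open>k r (F r - F s)\<close>, small by the uniform bound on
  the family, and \<open>k r (F s) - k s (F s)\<close>, small by continuity for the fixed argument
  \<open>F s\<close>.\<close>

lemma continuous_on_family:
  fixes k :: "real \<Rightarrow> ('b \<Rightarrow>\<^sub>C real) \<Rightarrow> real"
  assumes fam: "bounded_family t C k"
    and cont: "\<And>f. f \<in> C0c \<Longrightarrow> continuous_on {0..t} (\<lambda>s. k s f)"
    and F: "continuous_on {0..t} F" "\<And>s. s \<in> {0..t} \<Longrightarrow> F s \<in> C0c"
  shows "continuous_on {0..t} (\<lambda>s. k s (F s))"
  unfolding continuous_on
proof
  let ?S = "{0..t}"
  note lin = bounded_familyD(1)[OF fam] and bd = bounded_familyD(2)[OF fam]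
  fix s assume s: "s \<in> ?S"
  have "((\<lambda>r. k r (F s) - k s (F s)) \<longlongrightarrow> 0) (at s within ?S)"
    using cont[OF F(2)[OF s]] s by (auto simp: continuous_on intro: LIM_zero)
  moreover have "((\<lambda>r. k r (F r - F s)) \<longlongrightarrow> 0) (at s within ?S)"
  proof (rule Lim_null_comparison)
    show "\<forall>\<^sub>F r in at s within ?S. norm (k r (F r - F s)) \<le> C * norm (F r - F s)"
      using bd by (auto simp: eventually_at_filter)
    show "((\<lambda>r. C * norm (F r - F s)) \<longlongrightarrow> 0) (at s within ?S)"
      using F(1) s by (intro tendsto_mult_right_zero tendsto_norm_zero LIM_zero) (auto simp: continuous_on)
  qed
  ultimately have "((\<lambda>r. k r (F r - F s) + (k r (F s) - k s (F s))) \<longlongrightarrow> 0 + 0) (at s within ?S)"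
    by (intro tendsto_add)
  moreover have "\<forall>\<^sub>F r in at s within ?S. k r (F r - F s) + (k r (F s) - k s (F s)) = k r (F r) - k s (F s)"
    using lin by (auto simp: eventually_at_filter bounded_linear.linear linear_diff)
  ultimately have "((\<lambda>r. k r (F r) - k s (F s)) \<longlongrightarrow> 0 + 0) (at s within ?S)"
    by (rule Lim_transform_eventually)
  then have "((\<lambda>r. k r (F r) - k s (F s)) \<longlongrightarrow> 0) (at s within ?S)" by simp
  then show "((\<lambda>r. k r (F r)) \<longlongrightarrow> k s (F s)) (at s within ?S)" by (rule LIM_zero_cancel)
qed

text \<open>\<open>s \<mapsto> L s (T (t - s) f)\<close> has derivative \<open>k s (T (t - s) f)\<close>.\<close>

lemma duhamel:
  fixes L k :: "real \<Rightarrow> ('b \<Rightarrow>\<^sub>C real) \<Rightarrow> real"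
  assumes t: "0 \<le> t"
    and Lfam: "bounded_family t C L" and kfam: "bounded_family t C k"
    and Lint: "\<And>f. f \<in> C0c \<Longrightarrow> (\<lambda>s. L s f) integrable_on {0..t}"
    and kcont: "\<And>f. f \<in> C0c \<Longrightarrow> continuous_on {0..t} (\<lambda>s. k s f)"
    and evol: "\<And>f h s. gen f h \<Longrightarrow> s \<in> {0..t} \<Longrightarrow>
      L s f = L 0 f + integral {0..s} (\<lambda>v. L v h + k v f)"
    and f: "f \<in> C0c"
  shows "L t f = L 0 (T t f) + integral {0..t} (\<lambda>s. k s (T (t - s) f))"
proof -
  note Llin = bounded_familyD(1)[OF Lfam] and Lbd = bounded_familyD(2)[OF Lfam]
    and klin = bounded_familyD(1)[OF kfam] and kbd = bounded_familyD(2)[OF kfam]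
  have C0: "0 \<le> C"
  proof -
    have "\<bar>L 0 (const_bcontfun 1)\<bar> \<le> C * norm (const_bcontfun 1 :: 'b \<Rightarrow>\<^sub>C real)" using Lbd[of 0] t by simp
    moreover have "1 \<le> norm (const_bcontfun 1 :: 'b \<Rightarrow>\<^sub>C real)"
      using abs_apply_bcontfun_le[of "const_bcontfun 1 :: 'b \<Rightarrow>\<^sub>C real"] by simp
    ultimately show ?thesis by (smt (verit) mult_less_0_iff)
  qed
  obtain B where B: "1 \<le> B" "\<And>s f. 0 \<le> s \<Longrightarrow> s \<le> t \<Longrightarrow> f \<in> C0c \<Longrightarrow> norm (T s f) \<le> B * norm f"
    using norm_T_bounded by blast
  have Tcont: "continuous_on {0..t} (\<lambda>s. T (t - s) f)" if "f \<in> C0c" for f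
    by (rule continuous_on_compose2[OF T_continuous[OF that]]) (auto intro!: continuous_intros)
  have kTcont: "continuous_on {0..t} (\<lambda>s. k s (T (t - s) f))" if "f \<in> C0c" for f
    by (rule continuous_on_family[OF kfam kcont Tcont[OF that]]) (use that in \<open>auto intro: T_C0c\<close>)
  have kTint: "(\<lambda>s. k s (T (t - s) f)) integrable_on {a..b}" if "f \<in> C0c" "0 \<le> a" "b \<le> t" for f a b
    by (intro integrable_continuous_interval continuous_on_subset[OF kTcont]) (use that in auto)
  have Lint': "(\<lambda>s. L s f) integrable_on {a..b}" if "f \<in> C0c" "0 \<le> a" "b \<le> t" for f a b
    by (rule integrable_subinterval_real[OF Lint[OF that(1)]]) (use that in auto)
  have kint: "(\<lambda>s. k s f) integrable_on {a..b}" if "f \<in> C0c" "0 \<le> a" "b \<le> t" for f a b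
    by (intro integrable_continuous_interval continuous_on_subset[OF kcont]) (use that in auto)
  have Ldiff: "L s (f - g) = L s f - L s g" if "s \<in> {0..t}" for s f g
    using Llin[OF that] by (simp add: bounded_linear.linear linear_diff)
  have kdiff: "k s (f - g) = k s f - k s g" if "s \<in> {0..t}" for s f g
    using klin[OF that] by (simp add: bounded_linear.linear linear_diff)
  have Lscale: "L s (c *\<^sub>R f) = c * L s f" if "s \<in> {0..t}" for s c f
    using Llin[OF that] by (simp add: bounded_linear.linear linear_scale)
  \<comment> \<open>On the domain of the generator the difference \<open>G\<close> below turns out
    to be constant; its values at 0 and at \<open>t\<close> give the two sides of the
    formula.\<close>
  have on_gen: "L t f = L 0 (T t f) + integral {0..t} (\<lambda>s. k s (T (t - s) f))" if fh: "gen f h" for f h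
  proof -
    have fC: "f \<in> C0c" and hC: "h \<in> C0c" using gen_C0c[OF fh] by auto
    define G where "G s = L s (T (t - s) f) - integral {0..s} (\<lambda>v. k v (T (t - v) f))" for s
    have incr: "\<exists>d>0. \<forall>r s. 0 \<le> r \<and> r \<le> s \<and> s \<le> t \<and> s - r < d \<longrightarrow> \<bar>G s - G r\<bar> \<le> e * (s - r)"
      if "0 < e" for e
    proof -
      \<comment> \<open>The errors collected below add up to
        \<open>2 * (C * (B * \<eta>)) + \<eta> + 2 * (C * \<eta>)\<close> per unit of time. Each of
        the three products is at most e/6, so the sum is at most 5e/6.\<close>
      define \<eta> where "\<eta> = e / (6 * (C + 1) * (B + 1))"
      have \<eta>: "0 < \<eta>" using \<open>0 < e\<close> C0 B(1) by (auto simp: \<eta>_def intro!: divide_pos_pos mult_pos_pos)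
      have \<eta>e: "6 * (C * (B * \<eta>)) \<le> e" "6 * (C * \<eta>) \<le> e" "6 * \<eta> \<le> e"
      proof -
        have "6 * (C + 1) * (B + 1) \<noteq> 0" using C0 B(1) by simp
        then have "6 * (C + 1) * (B + 1) * \<eta> = e" unfolding \<eta>_def by (rule nonzero_mult_div_cancel_left[THEN trans[OF times_divide_eq_right]])
        then have e: "6 * ((C + 1) * ((B + 1) * \<eta>)) = e" by (simp only: mult.assoc)
        have "C * (B * \<eta>) \<le> (C + 1) * ((B + 1) * \<eta>)" "C * (1 * \<eta>) \<le> (C + 1) * ((B + 1) * \<eta>)"
          "1 * (1 * \<eta>) \<le> (C + 1) * ((B + 1) * \<eta>)"
          using C0 B(1) \<eta> by (intro mult_mono; simp)+
        then show "6 * (C * (B * \<eta>)) \<le> e" "6 * (C * \<eta>) \<le> e" "6 * \<eta> \<le> e" using e by auto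
      qed
      \<comment> \<open>\<open>h\<close> need not be in the domain, so \<open>evol\<close> gives no
        control of the time dependence of \<open>L\<close> on it. For the approximation
        \<open>h'\<close> in the domain, \<open>evol\<close> makes this dependence
        Lipschitz.\<close>
      obtain h' k' where h': "gen h' k'" "norm (h' - h) \<le> \<eta>" using gen_dense[OF hC \<eta>] by blast
      note h'C = gen_C0c[OF h'(1)]
      obtain d1 where d1: "0 < d1" "\<And>r s. 0 \<le> r \<Longrightarrow> r \<le> s \<Longrightarrow> s \<le> t \<Longrightarrow> s - r < d1 \<Longrightarrow>
          norm (T s f - T r f - (s - r) *\<^sub>R T r h) \<le> \<eta> * (s - r)"
        using gen_derivative[OF fh \<eta>] by blast
      have "uniformly_continuous_on {0..t} (\<lambda>s. T (t - s) f)"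
        by (intro compact_uniformly_continuous Tcont fC) auto
      then obtain d2 where d2: "0 < d2" "\<And>r s. r \<in> {0..t} \<Longrightarrow> s \<in> {0..t} \<Longrightarrow> dist s r < d2 \<Longrightarrow>
          norm (T (t - s) f - T (t - r) f) < \<eta>"
        using \<eta> unfolding uniformly_continuous_on_def dist_norm by meson
      \<comment> \<open>Lipschitz constant in time of \<open>L\<close> along the image of
        \<open>h'\<close> under the semigroup, enlarged by 1 so that it can be divided by.\<close>
      define A where "A = C * (B * norm k') + C * (B * norm h') + 1"
      have A: "0 < A" using C0 B(1) by (auto simp: A_def intro!: add_nonneg_pos add_nonneg_nonneg mult_nonneg_nonneg)
      define d where "d = min (min d1 d2) (\<eta> / A)"
      have d: "0 < d" "d \<le> d1" "d \<le> d2" "d \<le> \<eta> / A"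
        using d1(1) d2(1) A \<eta> by (auto simp: d_def)
      have dA: "d * A \<le> \<eta>" using d(4) A by (simp add: pos_le_divide_eq)
      have "\<bar>G s - G r\<bar> \<le> e * (s - r)" if rs: "0 \<le> r" "r \<le> s" "s \<le> t" "s - r < d" for r s
      proof -
        let ?f = "T (t - s) f" and ?h = "T (t - s) h"
        \<comment> \<open>Remainder of the first-order expansion about the smaller semigroup time
          \<open>t - s\<close>: time runs backwards in the argument of \<open>L\<close>.\<close>
        define R where "R = T (t - r) f - ?f - (s - r) *\<^sub>R ?h"
        have r0: "r \<in> {0..t}" and s0: "s \<in> {0..t}" using rs by auto
        have ts: "0 \<le> t - s" using rs by simp
        have CC: "?f \<in> C0c" "?h \<in> C0c" using ts fC hC by (auto intro: T_C0c)
        have step: "L v u - L r u = integral {r..v} (\<lambda>w. L w y + k w u)"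
          if "gen u y" "r \<le> v" "v \<le> s" for u y v
        proof -
          have "(\<lambda>w. L w y + k w u) integrable_on {0..v}"
            using gen_C0c[OF that(1)] rs that by (intro integrable_add Lint' kint) auto
          from Henstock_Kurzweil_Integration.integral_combine[OF _ _ this, of r] rs that
          have "integral {0..r} (\<lambda>w. L w y + k w u) + integral {r..v} (\<lambda>w. L w y + k w u)
             = integral {0..v} (\<lambda>w. L w y + k w u)" by simp
          then show ?thesis using evol[OF that(1), of v] evol[OF that(1), of r] rs that by auto
        qed
        have nR: "norm R \<le> \<eta> * (s - r)"
          using d1(2)[of "t - s" "t - r"] rs d by (simp add: R_def)
        \<comment> \<open>Replacing \<open>?h\<close> by \<open>?h'\<close> at both times costs
          \<open>C * (B * \<eta>)\<close> each; the Lipschitz bound over an interval shorter than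
          \<open>d\<close> costs at most \<eta>.\<close>
        have Lh: "\<bar>L v ?h - L r ?h\<bar> \<le> 2 * (C * (B * \<eta>)) + \<eta>" if v: "r \<le> v" "v \<le> s" for v
        proof -
          let ?h' = "T (t - s) h'" and ?k' = "T (t - s) k'"
          have hk: "norm ?h' \<le> B * norm h'" "norm ?k' \<le> B * norm k'"
            using ts rs h'C by (auto intro: B(2))
          have "norm (T (t - s) (h' - h)) \<le> B * norm (h' - h)"
            using ts rs h'C hC by (intro B(2) subspace_diff[OF subspace_C0c]) auto
          also have "\<dots> \<le> B * \<eta>" using h'(2) B(1) by (intro mult_left_mono) auto
          finally have n: "norm (?h' - ?h) \<le> B * \<eta>" using ts h'C hC by (simp add: T_diff)
          have near: "\<bar>L w ?h' - L w ?h\<bar> \<le> C * (B * \<eta>)" if "w \<in> {0..t}" for w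
          proof -
            have "\<bar>L w (?h' - ?h)\<bar> \<le> C * norm (?h' - ?h)" using Lbd[OF that] .
            also have "\<dots> \<le> C * (B * \<eta>)" using n C0 by (rule mult_left_mono)
            finally show ?thesis using Ldiff[OF that] by simp
          qed
          have g': "gen ?h' ?k'" using gen_T[OF h'(1) ts] .
          have "\<bar>L w ?k' + k w ?h'\<bar> \<le> A" if "w \<in> {r..v}" for w
          proof -
            have w: "w \<in> {0..t}" using that v rs by auto
            have "\<bar>L w ?k' + k w ?h'\<bar> \<le> C * norm ?k' + C * norm ?h'"
              using Lbd[OF w, of ?k'] kbd[OF w, of ?h'] by linarith
            also have "\<dots> \<le> C * (B * norm k') + C * (B * norm h')"
              using hk C0 by (intro add_mono mult_left_mono) auto
            finally show ?thesis by (simp add: A_def)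
          qed
          then have "norm (integral {r..v} (\<lambda>w. L w ?k' + k w ?h')) \<le> integral {r..v} (\<lambda>w. A)"
            using gen_C0c[OF g'] v rs
            by (intro integral_norm_bound_integral integrable_add Lint' kint) auto
          also have "\<dots> = A * (v - r)" using v by simp
          also have "\<dots> \<le> A * d" using A v rs by (intro mult_left_mono) auto
          also have "\<dots> \<le> \<eta>" using dA by (simp add: mult.commute)
          finally have "\<bar>L v ?h' - L r ?h'\<bar> \<le> \<eta>" using step[OF g' v] by simp
          then show ?thesis using near[of v] near[OF r0] v rs by auto
        qed
        have kf: "\<bar>k v (?f - T (t - v) f)\<bar> \<le> C * \<eta>" if v: "r \<le> v" "v \<le> s" for v
        proof -
          have "\<bar>k v (?f - T (t - v) f)\<bar> \<le> C * norm (?f - T (t - v) f)"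
            using v rs by (intro kbd) auto
          also have "\<dots> \<le> C * \<eta>"
            using d2(2)[of v s] v rs d C0 by (intro mult_left_mono) (auto simp: dist_norm)
          finally show ?thesis .
        qed
        \<comment> \<open>After the expansion at time r, \<open>evol\<close> expresses
          \<open>L s ?f - L r ?f\<close> through \<open>L w ?h\<close> and \<open>k w ?f\<close>.
          The former nearly cancels against \<open>L r ?h\<close> by \<open>Lh\<close>, the latter
          against the integrand of \<open>G\<close> by \<open>kf\<close>, and only
          \<open>L r R\<close> is left.\<close>
        have "G s - G r = (L s ?f - L r ?f) - (s - r) * L r ?h - L r R
            - integral {r..s} (\<lambda>v. k v (T (t - v) f))"
        proof -
          have "L r R = L r (T (t - r) f) - L r ?f - (s - r) * L r ?h"
            using r0 by (simp add: R_def Ldiff Lscale)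
          moreover have "integral {0..r} (\<lambda>v. k v (T (t - v) f)) + integral {r..s} (\<lambda>v. k v (T (t - v) f))
            = integral {0..s} (\<lambda>v. k v (T (t - v) f))"
            using rs fC by (intro Henstock_Kurzweil_Integration.integral_combine kTint) auto
          ultimately show ?thesis by (simp add: G_def)
        qed
        also have "L s ?f - L r ?f = integral {r..s} (\<lambda>w. L w ?h + k w ?f)"
          using rs by (intro step gen_T[OF fh ts]) auto
        also have "(s - r) * L r ?h = integral {r..s} (\<lambda>w. L r ?h)" using rs by simp
        also have "integral {r..s} (\<lambda>w. L w ?h + k w ?f) - integral {r..s} (\<lambda>w. L r ?h) - L r R
            - integral {r..s} (\<lambda>v. k v (T (t - v) f))
          = integral {r..s} (\<lambda>w. L w ?h + k w ?f - L r ?h - k w (T (t - w) f)) - L r R"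
        proof -
          have i: "(\<lambda>w. L w ?h + k w ?f) integrable_on {r..s}" "(\<lambda>w. L r ?h) integrable_on {r..s}"
            "(\<lambda>w. k w (T (t - w) f)) integrable_on {r..s}"
            using rs CC fC by (auto intro!: integrable_add Lint' kint kTint)
          show ?thesis
            by (simp only: Henstock_Kurzweil_Integration.integral_diff[OF integrable_diff[OF i(1,2)] i(3)]
              Henstock_Kurzweil_Integration.integral_diff[OF i(1,2)])
        qed
        finally have G: "G s - G r = \<dots>" .
        have "norm (integral {r..s} (\<lambda>w. L w ?h + k w ?f - L r ?h - k w (T (t - w) f)))
          \<le> integral {r..s} (\<lambda>w. 2 * (C * (B * \<eta>)) + \<eta> + C * \<eta>)"
        proof (rule integral_norm_bound_integral)
          show "(\<lambda>w. L w ?h + k w ?f - L r ?h - k w (T (t - w) f)) integrable_on {r..s}"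
            using rs CC fC by (intro integrable_add integrable_diff Lint' kint kTint) auto
          fix w assume w: "w \<in> {r..s}"
          then have "k w ?f - k w (T (t - w) f) = k w (?f - T (t - w) f)" using rs by (simp add: kdiff)
          then show "norm (L w ?h + k w ?f - L r ?h - k w (T (t - w) f)) \<le> 2 * (C * (B * \<eta>)) + \<eta> + C * \<eta>"
            using Lh[of w] kf[of w] w by auto
        qed (rule integrable_const_ivl)
        also have "\<dots> = (2 * (C * (B * \<eta>)) + \<eta> + C * \<eta>) * (s - r)" using rs by simp
        finally have I: "\<bar>integral {r..s} (\<lambda>w. L w ?h + k w ?f - L r ?h - k w (T (t - w) f))\<bar>
          \<le> (2 * (C * (B * \<eta>)) + \<eta> + C * \<eta>) * (s - r)" by simp
        have "\<bar>L r R\<bar> \<le> C * norm R" using Lbd[OF r0] .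
        also have "\<dots> \<le> C * (\<eta> * (s - r))" using nR C0 by (rule mult_left_mono)
        finally have "\<bar>G s - G r\<bar> \<le> (2 * (C * (B * \<eta>)) + \<eta> + 2 * (C * \<eta>)) * (s - r)"
          using I G by (simp add: algebra_simps)
        also have "\<dots> \<le> e * (s - r)" using \<eta>e rs \<open>0 < e\<close> by (intro mult_right_mono) auto
        finally show ?thesis .
      qed
      then show ?thesis using d(1) by blast
    qed
    \<comment> \<open>The bound in \<open>incr\<close> concerns ordered pairs, so it covers
      increments to either side of s, and its arbitrary slope e forces derivative 0.\<close>
    have "(G has_derivative (\<lambda>_. 0)) (at s within {0..t})" if s: "s \<in> {0..t}" for s
      unfolding has_derivative_within_alt
    proof (intro conjI bounded_linear_zero allI impI)
      fix e :: real assume "0 < e"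
      from incr[OF this] obtain d where d: "0 < d"
        "\<And>r s. 0 \<le> r \<Longrightarrow> r \<le> s \<Longrightarrow> s \<le> t \<Longrightarrow> s - r < d \<Longrightarrow> \<bar>G s - G r\<bar> \<le> e * (s - r)" by blast
      show "\<exists>d>0. \<forall>y\<in>{0..t}. norm (y - s) < d \<longrightarrow> norm (G y - G s - 0) \<le> e * norm (y - s)"
      proof (intro exI[of _ d] conjI d(1) ballI impI)
        fix y assume y: "y \<in> {0..t}" "norm (y - s) < d"
        show "norm (G y - G s - 0) \<le> e * norm (y - s)"
        proof (cases "y \<le> s")
          case True
          then show ?thesis using d(2)[of y s] y s by (auto simp: abs_minus_commute)
        next
          case False
          then show ?thesis using d(2)[of s y] y s by auto
        qed
      qed
    qed
    from has_derivative_zero_constant[OF _ this] t have "G t = G 0" by fastforce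
    then show ?thesis using t fC by (simp add: G_def T_zero)
  qed
  \<comment> \<open>The defect of the formula, which vanishes on the dense domain. It is Lipschitz
    in \<open>f\<close> with constant \<open>A\<close>; the three summands of \<open>A\<close> bound
    the three terms of the defect.\<close>
  define D where "D f = L t f - L 0 (T t f) - integral {0..t} (\<lambda>s. k s (T (t - s) f))" for f
  define A where "A = C + C * B + C * B * t"
  have A: "0 \<le> A" using C0 B(1) t by (auto simp: A_def)
  have t0: "t \<in> {0..t}" "0 \<in> {0..t}" using t by auto
  have approx: "\<bar>D f\<bar> \<le> A * e" if e: "0 < e" for e
  proof -
    obtain u h where u: "gen u h" "norm (u - f) \<le> e" using gen_dense[OF f e] by blast
    have uC: "u \<in> C0c" using gen_C0c[OF u(1)] by simp
    have D: "D u = 0" using on_gen[OF u(1)] by (simp add: D_def)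
    have nT: "norm (T s u - T s f) \<le> B * e" if "0 \<le> s" "s \<le> t" for s
    proof -
      have "norm (T s (u - f)) \<le> B * norm (u - f)"
        using that uC f by (intro B(2) subspace_diff[OF subspace_C0c]) auto
      also have "\<dots> \<le> B * e" using u(2) B(1) by (intro mult_left_mono) auto
      finally show ?thesis using that uC f by (simp add: T_diff)
    qed
    have 1: "\<bar>L t u - L t f\<bar> \<le> C * e"
      using order_trans[OF Lbd[OF t0(1)] mult_left_mono[OF u(2) C0]] by (simp only: Ldiff[OF t0(1)])
    have 2: "\<bar>L 0 (T t u) - L 0 (T t f)\<bar> \<le> C * (B * e)"
      using order_trans[OF Lbd[OF t0(2)] mult_left_mono[OF nT C0]] t by (simp flip: Ldiff[OF t0(2)])
    have "norm (integral {0..t} (\<lambda>s. k s (T (t - s) u) - k s (T (t - s) f))) \<le> integral {0..t} (\<lambda>s. C * (B * e))"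
    proof (rule integral_norm_bound_integral)
      fix s assume s: "s \<in> {0..t}"
      then show "norm (k s (T (t - s) u) - k s (T (t - s) f)) \<le> C * (B * e)"
        using order_trans[OF kbd[OF s] mult_left_mono[OF nT[of "t - s"] C0]] by (simp flip: kdiff[OF s])
    qed (use uC f in \<open>auto intro!: integrable_diff kTint\<close>)
    then have 3: "\<bar>integral {0..t} (\<lambda>s. k s (T (t - s) u)) - integral {0..t} (\<lambda>s. k s (T (t - s) f))\<bar> \<le> C * (B * e) * t"
      using uC f t by (simp add: Henstock_Kurzweil_Integration.integral_diff kTint mult_ac)
    have "\<bar>D f\<bar> \<le> C * e + C * (B * e) + C * (B * e) * t" using 1 2 3 D unfolding D_def by linarith
    then show ?thesis by (simp add: A_def algebra_simps)
  qed
  have "D f = 0"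
  proof (rule ccontr)
    assume "D f \<noteq> 0"
    \<comment> \<open>This choice of e makes the bound at most half of the defect itself.\<close>
    then have "\<bar>D f\<bar> \<le> A * (\<bar>D f\<bar> / (2 * (A + 1)))" using A by (intro approx) auto
    also have "\<dots> \<le> \<bar>D f\<bar> / 2" using A by (simp add: field_simps)
    finally show False using \<open>D f \<noteq> 0\<close> by simp
  qed
  then show ?thesis by (simp add: D_def)
qed

end

section \<open>Twice continuously differentiable functions\<close>

text \<open>Bounded support, which in a Euclidean space means that the closure of the support is
  compact.\<close>

definition csupp :: "('b::real_normed_vector \<Rightarrow> real) \<Rightarrow> bool" where
  "csupp f \<longleftrightarrow> (\<exists>r. \<forall>x. r < norm x \<longrightarrow> f x = 0)"

text \<open>A relation rather than the function \<open>partial\<close>, because \<open>deriv\<close>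
  has some value even where no derivative exists.\<close>

definition has_partial :: "'b::euclidean_space \<Rightarrow> ('b \<Rightarrow> real) \<Rightarrow> ('b \<Rightarrow> real) \<Rightarrow> bool" where
  "has_partial i f f' \<longleftrightarrow> (\<forall>x. ((\<lambda>h. f (x + h *\<^sub>R i)) has_real_derivative f' x) (at 0))"

lemma partial_eqI: "has_partial i f f' \<Longrightarrow> partial i f = f'"
  by (auto simp: has_partial_def partial_def fun_eq_iff intro: DERIV_imp_deriv)

lemma has_partial_line:
  assumes "has_partial i f f'"
  shows "((\<lambda>h. f (x + h *\<^sub>R i)) has_real_derivative f' (x + s *\<^sub>R i)) (at s)"
proof -
  have "((\<lambda>h. f ((x + s *\<^sub>R i) + h *\<^sub>R i)) has_real_derivative f' (x + s *\<^sub>R i)) (at (s + - s))"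
    using assms by (simp add: has_partial_def)
  then have "((\<lambda>h. f ((x + s *\<^sub>R i) + (h + - s) *\<^sub>R i)) has_real_derivative f' (x + s *\<^sub>R i)) (at s)"
    by (subst (asm) DERIV_shift)
  then show ?thesis by (simp add: algebra_simps)
qed

lemma C1bI:
  assumes "f \<in> bcontfun" "\<And>i. i \<in> Basis \<Longrightarrow> has_partial i f (f' i)" "\<And>i. i \<in> Basis \<Longrightarrow> f' i \<in> bcontfun"
  shows "f \<in> C1b"
  using assms by (auto simp: C1b_def partial_eqI[OF assms(2)] has_partial_def real_differentiable_def)

lemma C1bD:
  assumes "f \<in> C1b"
  shows "f \<in> bcontfun" "i \<in> Basis \<Longrightarrow> has_partial i f (partial i f)" "i \<in> Basis \<Longrightarrow> partial i f \<in> bcontfun"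
  using assms by (auto simp: C1b_def has_partial_def partial_def DERIV_deriv_iff_real_differentiable)

lemma C2bI:
  assumes "f \<in> C1b" "\<And>i. i \<in> Basis \<Longrightarrow> has_partial i f (f' i)" "\<And>i. i \<in> Basis \<Longrightarrow> f' i \<in> C1b"
  shows "f \<in> C2b"
  using assms by (auto simp: C2b_def partial_eqI[OF assms(2)])

lemma C2bD:
  assumes "f \<in> C2b"
  shows "f \<in> C1b" "f \<in> bcontfun" "i \<in> Basis \<Longrightarrow> partial i f \<in> C1b"
  using assms by (auto simp: C2b_def C1b_def)

lemma bcontfun_sum:
  fixes f :: "'i \<Rightarrow> 'b::topological_space \<Rightarrow> real"
  shows "(\<And>i. i \<in> I \<Longrightarrow> f i \<in> bcontfun) \<Longrightarrow> (\<lambda>x. \<Sum>i\<in>I. f i x) \<in> bcontfun"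
  by (induction I rule: infinite_finite_induct) (auto intro: plus_cont const_bcontfun)

lemma bcontfun_mult:
  fixes f g :: "'b::topological_space \<Rightarrow> real"
  assumes "f \<in> bcontfun" "g \<in> bcontfun"
  shows "(\<lambda>x. f x * g x) \<in> bcontfun"
proof -
  obtain a b where a: "\<And>x. \<bar>f x\<bar> \<le> a" and b: "\<And>x. \<bar>g x\<bar> \<le> b"
    using assms by (fastforce simp: bcontfun_def bounded_iff)
  have "norm (f x * g x) \<le> a * b" for x
    using mult_mono[OF a b, of x x] abs_ge_zero[of "f x"] a[of x] by (simp add: abs_mult)
  moreover have "continuous_on UNIV (\<lambda>x. f x * g x)"
    using assms by (intro continuous_intros) (auto simp: bcontfun_def)
  ultimately show ?thesis by (rule bcontfun_normI[rotated])
qed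

lemma bcontfun_compose:
  fixes f :: "'b::topological_space \<Rightarrow> 'c::metric_space"
  assumes "f \<in> bcontfun" "continuous_on UNIV k"
  shows "(\<lambda>x. f (k x)) \<in> bcontfun"
  using assms continuous_on_compose2[of UNIV f UNIV k] bounded_subset[of "range f" "range (\<lambda>x. f (k x))"]
  by (auto simp: bcontfun_def)

lemma laplacian_bcontfun: "f \<in> C2b \<Longrightarrow> laplacian f \<in> bcontfun"
  unfolding laplacian_def by (intro bcontfun_sum C1bD(3)[OF C2bD(3)])

lemma C1b_lincomb:
  assumes "f \<in> C1b" "h \<in> C1b"
  shows "(\<lambda>x. a * f x + b * h x) \<in> C1b"
    and "i \<in> Basis \<Longrightarrow> partial i (\<lambda>x. a * f x + b * h x) = (\<lambda>x. a * partial i f x + b * partial i h x)"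
proof -
  have *: "has_partial i (\<lambda>x. a * f x + b * h x) (\<lambda>x. a * partial i f x + b * partial i h x)" if "i \<in> Basis" for i
    using C1bD(2)[OF assms(1) that] C1bD(2)[OF assms(2) that] unfolding has_partial_def
    by (auto intro!: derivative_eq_intros)
  show "(\<lambda>x. a * f x + b * h x) \<in> C1b"
    using assms by (intro C1bI[OF _ *] plus_cont bcontfun_mult const_bcontfun) (auto dest: C1bD)
  show "i \<in> Basis \<Longrightarrow> partial i (\<lambda>x. a * f x + b * h x) = (\<lambda>x. a * partial i f x + b * partial i h x)"
    by (rule partial_eqI[OF *])
qed

lemma C2b_lincomb:
  assumes "f \<in> C2b" "h \<in> C2b"
  shows "(\<lambda>x. a * f x + b * h x) \<in> C2b"
    and "laplacian (\<lambda>x. a * f x + b * h x) = (\<lambda>x. a * laplacian f x + b * laplacian h x)"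
  using assms
  by (auto simp: C2b_def C1b_lincomb laplacian_def fun_eq_iff sum.distrib sum_distrib_left)

lemma C2b_const: "(\<lambda>x :: 'b::euclidean_space. c) \<in> C2b" and laplacian_const: "laplacian (\<lambda>x :: 'b::euclidean_space. c) = (\<lambda>x. 0)"
proof -
  have *: "has_partial i (\<lambda>x :: 'b. c) (\<lambda>x. 0)" for i :: 'b and c by (auto simp: has_partial_def)
  have 1: "(\<lambda>x :: 'b. c) \<in> C1b" for c
    by (rule C1bI[OF _ *]) (auto intro: const_bcontfun)
  show "(\<lambda>x :: 'b. c) \<in> C2b" by (rule C2bI[OF 1 * 1])
  show "laplacian (\<lambda>x :: 'b. c) = (\<lambda>x. 0)"
    by (simp add: laplacian_def fun_eq_iff partial_eqI[OF *])
qed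

lemma C1b_translate:
  assumes "f \<in> C1b"
  shows "(\<lambda>x. f (x - a)) \<in> C1b"
    and "i \<in> Basis \<Longrightarrow> partial i (\<lambda>x. f (x - a)) = (\<lambda>x. partial i f (x - a))"
proof -
  have *: "has_partial i (\<lambda>x. f (x - a)) (\<lambda>x. partial i f (x - a))" if "i \<in> Basis" for i
    unfolding has_partial_def
  proof
    fix x
    have "((\<lambda>h. f (x - a + h *\<^sub>R i)) has_real_derivative partial i f (x - a)) (at 0)"
      using C1bD(2)[OF assms that] unfolding has_partial_def by blast
    then show "((\<lambda>h. f (x + h *\<^sub>R i - a)) has_real_derivative partial i f (x - a)) (at 0)"
      by (simp add: algebra_simps)
  qed
  show "(\<lambda>x. f (x - a)) \<in> C1b"
    using assms
    by (intro C1bI[OF _ *] bcontfun_compose[of _ "\<lambda>x. x - a"]) (auto dest: C1bD intro!: continuous_intros)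
  show "i \<in> Basis \<Longrightarrow> partial i (\<lambda>x. f (x - a)) = (\<lambda>x. partial i f (x - a))"
    by (rule partial_eqI[OF *])
qed

lemma C2b_translate:
  assumes "f \<in> C2b"
  shows "(\<lambda>x. f (x - a)) \<in> C2b" "laplacian (\<lambda>x. f (x - a)) = (\<lambda>x. laplacian f (x - a))"
  using assms by (auto simp: C2b_def C1b_translate laplacian_def fun_eq_iff)

lemma tensor_bcontfun:
  fixes f :: "'b::topological_space \<Rightarrow> real" and h :: "'c::topological_space \<Rightarrow> real"
  assumes "f \<in> bcontfun" "h \<in> bcontfun"
  shows "f \<otimes>\<^sub>f h \<in> bcontfun"
  unfolding tensor_def split_beta
  by (intro bcontfun_mult bcontfun_compose[OF assms(1)] bcontfun_compose[OF assms(2)] continuous_intros)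

lemma C1b_tensor:
  assumes "f \<in> C1b" "h \<in> C1b"
  shows "f \<otimes>\<^sub>f h \<in> C1b"
    and "i \<in> Basis \<Longrightarrow> partial (i, 0) (f \<otimes>\<^sub>f h) = partial i f \<otimes>\<^sub>f h"
    and "j \<in> Basis \<Longrightarrow> partial (0, j) (f \<otimes>\<^sub>f h) = f \<otimes>\<^sub>f partial j h"
proof -
  have 1: "has_partial (i, 0) (f \<otimes>\<^sub>f h) (partial i f \<otimes>\<^sub>f h)" if "i \<in> Basis" for i
    using C1bD(2)[OF assms(1) that] unfolding has_partial_def
    by (auto simp: tensor_def intro!: derivative_eq_intros)
  have 2: "has_partial (0, j) (f \<otimes>\<^sub>f h) (f \<otimes>\<^sub>f partial j h)" if "j \<in> Basis" for j
    using C1bD(2)[OF assms(2) that] unfolding has_partial_def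
    by (auto simp: tensor_def intro!: derivative_eq_intros)
  show p: "i \<in> Basis \<Longrightarrow> partial (i, 0) (f \<otimes>\<^sub>f h) = partial i f \<otimes>\<^sub>f h"
    "j \<in> Basis \<Longrightarrow> partial (0, j) (f \<otimes>\<^sub>f h) = f \<otimes>\<^sub>f partial j h" for i j
    using partial_eqI[OF 1] partial_eqI[OF 2] by auto
  show "f \<otimes>\<^sub>f h \<in> C1b"
  proof (rule C1bI[where f'="\<lambda>k. partial k (f \<otimes>\<^sub>f h)"])
    fix k :: "'a \<times> 'b" assume "k \<in> Basis"
    then consider i where "k = (i, 0)" "i \<in> Basis" | j where "k = (0, j)" "j \<in> Basis"
      by (auto simp: Basis_prod_def)
    then show "has_partial k (f \<otimes>\<^sub>f h) (partial k (f \<otimes>\<^sub>f h))" "partial k (f \<otimes>\<^sub>f h) \<in> bcontfun"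
      using assms by (cases; auto simp: p 1 2 intro!: tensor_bcontfun dest: C1bD)+
  qed (use assms in \<open>auto intro!: tensor_bcontfun dest: C1bD\<close>)
qed

lemma sum_Basis_prod:
  fixes F :: "'a::euclidean_space \<times> 'b::euclidean_space \<Rightarrow> real"
  shows "(\<Sum>k\<in>Basis. F k) = (\<Sum>i\<in>Basis. F (i, 0)) + (\<Sum>j\<in>Basis. F (0, j))"
proof -
  have "(\<Sum>k\<in>Basis. F k) = (\<Sum>k\<in>(\<lambda>i. (i, 0)) ` Basis. F k) + (\<Sum>k\<in>(\<lambda>j. (0, j)) ` Basis. F k)"
    unfolding Basis_prod_def by (intro sum.union_disjoint) (auto simp: nonzero_Basis)
  then show ?thesis by (simp add: sum.reindex inj_on_def)
qed

lemma C2b_tensor: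
  assumes "f \<in> C2b" "h \<in> C2b"
  shows "f \<otimes>\<^sub>f h \<in> C2b"
    and "laplacian (f \<otimes>\<^sub>f h) z = (laplacian f \<otimes>\<^sub>f h) z + (f \<otimes>\<^sub>f laplacian h) z"
proof -
  show "f \<otimes>\<^sub>f h \<in> C2b"
    using assms by (auto simp: C2b_def C1b_tensor Basis_prod_def)
  have "laplacian (f \<otimes>\<^sub>f h) z = (\<Sum>i\<in>Basis. (partial i (partial i f) \<otimes>\<^sub>f h) z) + (\<Sum>j\<in>Basis. (f \<otimes>\<^sub>f partial j (partial j h)) z)"
    using assms by (simp add: laplacian_def sum_Basis_prod C1b_tensor C2bD)
  then show "laplacian (f \<otimes>\<^sub>f h) z = (laplacian f \<otimes>\<^sub>f h) z + (f \<otimes>\<^sub>f laplacian h) z"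
    by (simp add: tensor_def laplacian_def split_beta sum_distrib_left sum_distrib_right)
qed

lemma csupp_bcontfun:
  fixes f :: "'b::euclidean_space \<Rightarrow> real"
  assumes "csupp f" "continuous_on UNIV f"
  shows "f \<in> bcontfun"
  using assms C0I_support[of f] C0_bcontfun by (auto simp: csupp_def)

lemma csupp_tensor:
  fixes f :: "'b::real_normed_vector \<Rightarrow> real" and h :: "'c::real_normed_vector \<Rightarrow> real"
  assumes "csupp f" "csupp h" shows "csupp (f \<otimes>\<^sub>f h)"
proof -
  obtain r s where r: "\<And>x. r < norm x \<Longrightarrow> f x = 0" and s: "\<And>x. s < norm x \<Longrightarrow> h x = 0"
    using assms by (auto simp: csupp_def)
  have "(f \<otimes>\<^sub>f h) z = 0" if "\<bar>r\<bar> + \<bar>s\<bar> < norm z" for z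
  proof -
    have "norm z \<le> norm (fst z) + norm (snd z)" by (metis norm_Pair_le prod.collapse)
    then have "r < norm (fst z) \<or> s < norm (snd z)" using that by linarith
    then show ?thesis using r[of "fst z"] s[of "snd z"] by (auto simp: tensor_def split_beta)
  qed
  then show ?thesis by (auto simp: csupp_def)
qed

text \<open>Near a point strictly outside the ball the function vanishes identically, and
  \<open>deriv\<close> depends only on the values near the point.\<close>

lemma csupp_partial:
  assumes "csupp f" shows "csupp (partial i f)"
proof -
  obtain r where r: "\<And>x. r < norm x \<Longrightarrow> f x = 0" using assms by (auto simp: csupp_def)
  have "partial i f x = 0" if "r < norm x" for x
  proof -
    have "((\<lambda>h. norm (x + h *\<^sub>R i)) \<longlongrightarrow> norm (x + 0 *\<^sub>R i)) (nhds 0)"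
      by (intro tendsto_intros filterlim_ident)
    then have "\<forall>\<^sub>F h in nhds 0. r < norm (x + h *\<^sub>R i)" using that by (intro order_tendstoD(1)) auto
    then have "\<forall>\<^sub>F h in nhds 0. f (x + h *\<^sub>R i) = 0" by eventually_elim (rule r)
    then have "deriv (\<lambda>h. f (x + h *\<^sub>R i)) 0 = deriv (\<lambda>h. 0) 0" by (intro deriv_cong_ev) auto
    then show ?thesis by (simp add: partial_def)
  qed
  then show ?thesis by (auto simp: csupp_def)
qed

lemma csupp_add:
  assumes "csupp f" "csupp g" shows "csupp (\<lambda>x. f x + g x)"
proof -
  obtain r where r: "\<And>x. r < norm x \<Longrightarrow> f x = 0" using assms(1) by (auto simp: csupp_def)
  obtain s where s: "\<And>x. s < norm x \<Longrightarrow> g x = 0" using assms(2) by (auto simp: csupp_def)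
  show ?thesis using r s by (auto simp: csupp_def intro!: exI[of _ "max r s"])
qed

lemma csupp_sum:
  assumes "\<And>i. i \<in> I \<Longrightarrow> csupp (f i)" shows "csupp (\<lambda>x. \<Sum>i\<in>I. f i x)"
  using assms
  by (induction I rule: infinite_finite_induct) (auto intro: csupp_add, auto simp: csupp_def)

lemma csupp_laplacian: "csupp f \<Longrightarrow> csupp (laplacian f)"
  unfolding laplacian_def by (intro csupp_sum csupp_partial)

lemma csupp_mult: "csupp f \<Longrightarrow> csupp (\<lambda>x. f x * g x)"
  unfolding csupp_def by (metis mult_zero_left)

lemma csupp_uniformly_continuous:
  fixes f :: "'b::euclidean_space \<Rightarrow> real"
  assumes "csupp f" "continuous_on UNIV f" "0 < e"
  obtains d where "0 < d" "\<And>x y. norm (x - y) < d \<Longrightarrow> \<bar>f x - f y\<bar> < e"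
proof -
  obtain r where r: "\<And>x. r < norm x \<Longrightarrow> f x = 0" using assms by (auto simp: csupp_def)
  have "uniformly_continuous_on (cball 0 (r + 1)) f"
    by (intro compact_uniformly_continuous continuous_on_subset[OF assms(2)]) auto
  then obtain d where d: "0 < d"
    "\<And>x y. norm x \<le> r + 1 \<Longrightarrow> norm y \<le> r + 1 \<Longrightarrow> norm (x - y) < d \<Longrightarrow> \<bar>f x - f y\<bar> < e"
    using assms(3) unfolding uniformly_continuous_on_def dist_norm
    by (metis dist_norm mem_cball_0 norm_minus_commute real_norm_def)
  \<comment> \<open>Distances are kept below 1: if the farther point lies beyond radius r + 1, then
    the nearer one lies beyond r and both values are 0.\<close>
  have *: "\<bar>f x - f y\<bar> < e" if "norm (x - y) < min d 1" "norm x \<le> norm y" for x y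
  proof (cases "norm y \<le> r + 1")
    case False
    then have "r < norm x" using that norm_triangle_ineq2[of y x] by (simp add: norm_minus_commute)
    then show ?thesis using r[of x] r[of y] False assms(3) by simp
  qed (use that d(2) in auto)
  have "\<bar>f x - f y\<bar> < e" if "norm (x - y) < min d 1" for x y
    using *[of x y] *[of y x] that by (cases "norm x \<le> norm y") (auto simp: norm_minus_commute abs_minus_commute)
  then show ?thesis using d(1) that[of "min d 1"] by auto
qed

section \<open>Integration by parts for functions of bounded support\<close>

lemma csupp_integrable:
  fixes f :: "'b::euclidean_space \<Rightarrow> real"
  assumes "csupp f" "continuous_on UNIV f"
  shows "integrable lborel f"
proof -
  obtain r where r: "\<And>x. r < norm x \<Longrightarrow> f x = 0" using assms by (auto simp: csupp_def)
  have "integrable lborel (\<lambda>x. indicator (cball 0 r) x *\<^sub>R f x)"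
    by (intro borel_integrable_compact continuous_on_subset[OF assms(2)]) auto
  also have "(\<lambda>x. indicator (cball 0 r) x *\<^sub>R f x) = f"
    using r by (auto simp: fun_eq_iff indicator_def not_le)
  finally show ?thesis .
qed

text \<open>By translation invariance the difference quotients integrate to zero.\<close>

lemma integral_partial_eq_0:
  fixes G :: "'b::euclidean_space \<Rightarrow> real"
  assumes "csupp G" "continuous_on UNIV G" "has_partial i G G'" "G' \<in> bcontfun" "i \<in> Basis"
  shows "integral\<^sup>L lborel G' = 0"
proof -
  obtain r where r: "\<And>x. r < norm x \<Longrightarrow> G x = 0" using assms by (auto simp: csupp_def)
  have "bounded (range G')" using assms by (auto simp: bcontfun_def)
  then obtain B where B: "\<And>x. \<bar>G' x\<bar> \<le> B" unfolding bounded_iff by auto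
  have G'c: "continuous_on UNIV G'" using assms by (auto simp: bcontfun_def)
  define q where "q n w = (G (w + inverse (real (Suc n)) *\<^sub>R i) - G w) / inverse (real (Suc n))" for n w
  have [measurable]: "G \<in> borel_measurable borel" "G' \<in> borel_measurable borel"
    by (intro borel_measurable_continuous_onI assms G'c)+
  have GI: "integrable lborel G" by (intro csupp_integrable assms)
  have q0: "integral\<^sup>L lborel (q n) = 0" for n
  proof -
    let ?c = "inverse (real (Suc n)) *\<^sub>R i"
    have "integrable (distr lborel borel ((+) ?c)) G" using GI by (simp add: lborel_distr_plus)
    then have I: "integrable lborel (\<lambda>w. G (w + ?c))" by (simp add: integrable_distr_eq add.commute)
    have "integral\<^sup>L lborel G = integral\<^sup>L (distr lborel borel ((+) ?c)) G" by (simp add: lborel_distr_plus)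
    also have "\<dots> = (\<integral>w. G (w + ?c) \<partial>lborel)" by (subst integral_distr) (simp_all add: add.commute)
    finally have "(\<integral>w. G (w + ?c) - G w \<partial>lborel) = 0" using I GI by (subst Bochner_Integration.integral_diff) auto
    then show ?thesis unfolding q_def by (subst integral_divide_zero) simp
  qed
  have "(\<lambda>n. integral\<^sup>L lborel (q n)) \<longlonglongrightarrow> integral\<^sup>L lborel G'"
  \<comment> \<open>The mean value theorem bounds the difference quotients by \<open>B\<close>. The
    increments have length at most 1, so the quotients all vanish outside the ball of radius r +
    1.\<close>
  proof (rule integral_dominated_convergence[where w="\<lambda>x. indicator (cball 0 (r + 1)) x *\<^sub>R B"])
    show "integrable lborel (\<lambda>x::'b. indicator (cball 0 (r + 1)) x *\<^sub>R B)"
      by (intro borel_integrable_compact) auto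
    show "AE x in lborel. (\<lambda>n. q n x) \<longlonglongrightarrow> G' x"
    proof (rule AE_I2)
      fix x
      have "(\<lambda>h. (G (x + h *\<^sub>R i) - G x) / h) \<midarrow>0\<rightarrow> G' x"
        using assms(3) by (simp add: has_partial_def has_field_derivative_iff)
      moreover have "filterlim (\<lambda>n. inverse (real (Suc n))) (at 0) sequentially"
        using LIMSEQ_inverse_real_of_nat by (auto simp: filterlim_at)
      ultimately have "(\<lambda>n. (G (x + inverse (real (Suc n)) *\<^sub>R i) - G x) / inverse (real (Suc n))) \<longlonglongrightarrow> G' x"
        by (rule filterlim_compose)
      then
      show "(\<lambda>n. q n x) \<longlonglongrightarrow> G' x" by (simp add: q_def)
    qed
    show "AE x in lborel. norm (q n x) \<le> indicator (cball 0 (r + 1)) x *\<^sub>R B" for n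
    proof (rule AE_I2)
      fix x
      let ?h = "inverse (real (Suc n))"
      have h: "0 < ?h" "?h \<le> 1" by (auto simp: inverse_le_1_iff)
      show "norm (q n x) \<le> indicator (cball 0 (r + 1)) x *\<^sub>R B"
      proof (cases "norm x \<le> r + 1")
        case True
        obtain z where z: "G (x + ?h *\<^sub>R i) - G (x + 0 *\<^sub>R i) = (?h - 0) * G' (x + z *\<^sub>R i)"
          using MVT2[OF h(1), of "\<lambda>h. G (x + h *\<^sub>R i)" "\<lambda>s. G' (x + s *\<^sub>R i)"] has_partial_line[OF assms(3)]
          by blast
        then have "q n x = G' (x + z *\<^sub>R i)" using h by (simp add: q_def)
        then show ?thesis using B True by simp
      next
        case False
        have "norm x - norm (?h *\<^sub>R i) \<le> norm (x + ?h *\<^sub>R i)" by (metis norm_diff_ineq)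
        then have "r < norm (x + ?h *\<^sub>R i)" using False h assms(5) by simp
        then show ?thesis using False r by (simp add: q_def)
      qed
    qed
  qed (auto simp: q_def[abs_def])
  then have "(\<lambda>n. 0) \<longlonglongrightarrow> integral\<^sup>L lborel G'" by (simp add: q0)
  then show ?thesis by (simp add: LIMSEQ_const_iff)
qed

lemma has_partial_reflect:
  assumes "has_partial i f f'"
  shows "has_partial i (\<lambda>w. f (z - w)) (\<lambda>w. - f' (z - w))"
  unfolding has_partial_def
proof
  fix x
  have "((\<lambda>h. f (z - x + h *\<^sub>R i)) has_real_derivative f' (z - x)) (at (- 0))"
    using assms unfolding has_partial_def by simp
  then have "((\<lambda>h. f (z - x + (- h) *\<^sub>R i)) has_real_derivative - f' (z - x)) (at 0)"
    by (subst (asm) DERIV_mirror)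
  then show "((\<lambda>h. f (z - (x + h *\<^sub>R i))) has_real_derivative - f' (z - x)) (at 0)"
    by (simp add: algebra_simps)
qed

text \<open>Both integrations by parts are done at once: reflection flips the sign of the
  derivatives of \<rho>, so in the derivative of \<open>?G\<close> the mixed products of first
  derivatives cancel and the difference of the two integrands remains.\<close>

lemma integral_by_parts_laplacian:
  fixes F \<rho> :: "'b::euclidean_space \<Rightarrow> real"
  assumes F: "F \<in> C2b" "csupp F" and \<rho>: "\<rho> \<in> C2b"
  shows "(\<integral>w. F w * laplacian \<rho> (z - w) \<partial>lborel) = (\<integral>w. laplacian F w * \<rho> (z - w) \<partial>lborel)"
proof -
  have reflect: "(\<lambda>w. f (z - w)) \<in> bcontfun" if "f \<in> bcontfun" for f :: "'b \<Rightarrow> real"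
    by (rule bcontfun_compose[OF that]) (intro continuous_intros)
  have cont: "continuous_on UNIV f" if "f \<in> bcontfun" for f :: "'b \<Rightarrow> real"
    using that by (simp add: bcontfun_def)
  have int: "integrable lborel (\<lambda>w. f w * h (z - w))" if "f \<in> bcontfun" "csupp f" "h \<in> bcontfun" for f h
    using that by (intro csupp_integrable csupp_mult cont bcontfun_mult reflect)
  have i: "(\<integral>w. F w * partial i (partial i \<rho>) (z - w) \<partial>lborel) = (\<integral>w. partial i (partial i F) w * \<rho> (z - w) \<partial>lborel)"
    if "i \<in> Basis" for i
  proof -
    note b = C2bD(2)[OF F(1)] C1bD(3)[OF C2bD(1)[OF F(1)] that] C1bD(3)[OF C2bD(3)[OF F(1) that] that]
      C2bD(2)[OF \<rho>] C1bD(3)[OF C2bD(1)[OF \<rho>] that] C1bD(3)[OF C2bD(3)[OF \<rho> that] that]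
    note p = C1bD(2)[OF C2bD(1)[OF F(1)] that] C1bD(2)[OF C2bD(3)[OF F(1) that] that]
      has_partial_reflect[OF C1bD(2)[OF C2bD(1)[OF \<rho>] that], of z] has_partial_reflect[OF C1bD(2)[OF C2bD(3)[OF \<rho> that] that], of z]
    let ?G = "\<lambda>w. F w * partial i \<rho> (z - w) + partial i F w * \<rho> (z - w)"
    let ?G' = "\<lambda>w. partial i (partial i F) w * \<rho> (z - w) - F w * partial i (partial i \<rho>) (z - w)"
    have s: "csupp F" "csupp (partial i F)" "csupp (partial i (partial i F))"
      using F(2) by (auto intro: csupp_partial)
    have "integral\<^sup>L lborel ?G' = 0"
    proof (rule integral_partial_eq_0)
      show "has_partial i ?G ?G'"
        using p unfolding has_partial_def by (auto intro!: derivative_eq_intros)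
      show "continuous_on UNIV ?G" by (intro cont plus_cont bcontfun_mult reflect b)
      show "?G' \<in> bcontfun" by (intro minus_cont bcontfun_mult reflect b)
      show "csupp ?G"
        by (intro csupp_add csupp_mult s)
    qed fact
    then show ?thesis using int b s by simp
  qed
  have "(\<integral>w. F w * laplacian \<rho> (z - w) \<partial>lborel) = (\<integral>w. (\<Sum>i\<in>Basis. F w * partial i (partial i \<rho>) (z - w)) \<partial>lborel)"
    by (simp add: laplacian_def sum_distrib_left)
  also have "\<dots> = (\<Sum>i\<in>Basis. \<integral>w. F w * partial i (partial i \<rho>) (z - w) \<partial>lborel)"
    by (intro Bochner_Integration.integral_sum int F(2) C2bD(2)[OF F(1)]) (auto intro: C1bD(3) C2bD(3) \<rho>)
  also have "\<dots> = (\<Sum>i\<in>Basis. \<integral>w. partial i (partial i F) w * \<rho> (z - w) \<partial>lborel)"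
    by (intro sum.cong i HOL.refl)
  also have "\<dots> = (\<integral>w. (\<Sum>i\<in>Basis. partial i (partial i F) w * \<rho> (z - w)) \<partial>lborel)"
    by (intro Bochner_Integration.integral_sum[symmetric] int csupp_partial F(2) C2bD(2)[OF \<rho>])
       (auto intro: C1bD(3) C2bD(3) F)
  finally show ?thesis by (simp add: laplacian_def sum_distrib_right)
qed

text \<open>The third power of a positive part is twice continuously differentiable, exactly the
  smoothness that \<open>C2b\<close> asks for, and the squared norm keeps the formula polynomial
  inside the ball.\<close>

definition bump :: "real \<Rightarrow> 'b::euclidean_space \<Rightarrow> real" where
  "bump r x = (max 0 (r\<^sup>2 - x \<bullet> x)) ^ 3"

text \<open>Only u = 0 is delicate: there the difference quotient is at most
  \<open>\<bar>h\<bar> ^ k\<close> in absolute value, which tends to 0 because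
  \<open>k \<noteq> 0\<close>.\<close>

lemma DERIV_pos_part_power:
  fixes u :: real
  assumes "k \<noteq> 0"
  shows "((\<lambda>u. max 0 u ^ Suc k) has_real_derivative real (Suc k) * max 0 u ^ k) (at u)"
proof -
  consider "0 < u" | "u < 0" | "u = 0" by linarith
  then show ?thesis
  proof cases
    case 1
    have "((\<lambda>u. u ^ Suc k) has_real_derivative real (Suc k) * u ^ k) (at u)"
      using DERIV_pow[of "Suc k" u] by simp
    moreover have ev: "\<forall>\<^sub>F v in nhds u. v ^ Suc k = max 0 v ^ Suc k"
      using eventually_nhds_in_open[of "{0<..}" u] 1 by (auto elim!: eventually_mono)
    ultimately have "((\<lambda>u. max 0 u ^ Suc k) has_real_derivative real (Suc k) * u ^ k) (at u)"
      using DERIV_cong_ev[OF refl ev refl] by blast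
    then show ?thesis using 1 by simp
  next
    case 2
    have "((\<lambda>u. 0) has_real_derivative 0) (at u)" by simp
    moreover have ev: "\<forall>\<^sub>F v in nhds u. 0 = max 0 v ^ Suc k"
      using eventually_nhds_in_open[of "{..<0}" u] 2 by (auto elim!: eventually_mono)
    ultimately have "((\<lambda>u. max 0 u ^ Suc k) has_real_derivative 0) (at u)"
      using DERIV_cong_ev[OF refl ev refl] by blast
    then show ?thesis using 2 assms by (simp add: power_0_left)
  next
    case 3
    have "((\<lambda>h::real. max 0 h ^ Suc k / h) \<longlongrightarrow> 0) (at 0)"
    proof (rule Lim_null_comparison)
      show "((\<lambda>h::real. \<bar>h\<bar> ^ k) \<longlongrightarrow> 0) (at 0)"
        using assms by (auto intro!: tendsto_eq_intros)
      show "\<forall>\<^sub>F h::real in at 0. norm (max 0 h ^ Suc k / h) \<le> \<bar>h\<bar> ^ k"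
        by (rule always_eventually) (auto simp: max_def abs_mult abs_divide power_abs)
    qed
    then show ?thesis using 3 assms by (simp add: power_0_left has_field_derivative_iff)
  qed
qed

lemma C2b_bump: "(bump r :: 'b::euclidean_space \<Rightarrow> real) \<in> C2b"
  and csupp_bump: "csupp (bump r :: 'b::euclidean_space \<Rightarrow> real)"
proof -
  let ?m = "\<lambda>x::'b. max 0 (r\<^sup>2 - x \<bullet> x)"
  have line: "((\<lambda>h. ?m (x + h *\<^sub>R i) ^ Suc k) has_real_derivative real (Suc k) * ?m x ^ k * (- 2 * (x \<bullet> i))) (at 0)"
    if "k \<noteq> 0" for x i :: 'b and k
  proof -
    have "((\<lambda>h. r\<^sup>2 - (x + h *\<^sub>R i) \<bullet> (x + h *\<^sub>R i)) has_real_derivative - 2 * (x \<bullet> i)) (at 0)"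
      by (auto simp: inner_add_left inner_add_right inner_commute intro!: derivative_eq_intros)
    from DERIV_chain2[where x=0, OF _ this, of "\<lambda>u. max 0 u ^ Suc k"] DERIV_pos_part_power[OF that, of "r\<^sup>2 - x \<bullet> x"]
    show ?thesis by simp
  qed
  have m0: "?m x = 0" if "\<bar>r\<bar> < norm x" for x
  proof -
    have "r\<^sup>2 \<le> (norm x)\<^sup>2" using that by (metis abs_ge_zero less_imp_le power2_abs power_mono)
    then show ?thesis by (simp add: power2_norm_eq_inner)
  qed
  have supp: "csupp (\<lambda>x. f x * ?m x)" for f unfolding csupp_def using m0 by (intro exI[of _ "\<bar>r\<bar>"]) auto
  have supp': "csupp (\<lambda>x. f x * ?m x ^ Suc k)" for f k
    using supp[of "\<lambda>x. f x * ?m x ^ k"] by (simp add: mult_ac)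
  \<comment> \<open>First and second partial derivatives of the bump. The exponents are written as
    successors to match \<open>line\<close> and \<open>supp'\<close>.\<close>
  define d where "d i x = - 6 * (x \<bullet> i) * ?m x ^ Suc 1" for i x :: 'b
  define dd where "dd i j x = - 6 * (j \<bullet> i) * ?m x ^ Suc 1 + 24 * (x \<bullet> i) * (x \<bullet> j) * ?m x ^ Suc 0" for i j x :: 'b
  have b: "bump r = (\<lambda>x::'b. 1 * ?m x ^ Suc 2)" by (simp add: bump_def fun_eq_iff numeral_3_eq_3)
  show csupp: "csupp (bump r :: 'b \<Rightarrow> real)" unfolding b by (rule supp')
  have bc: "bump r \<in> (bcontfun :: ('b \<Rightarrow> real) set)"
    using csupp unfolding b by (rule csupp_bcontfun) (intro continuous_intros)
  have dc: "d i \<in> bcontfun" for i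
    unfolding d_def by (rule csupp_bcontfun[OF supp']) (intro continuous_intros)
  have ddc: "dd i j \<in> bcontfun" for i j
    unfolding dd_def by (rule csupp_bcontfun[OF csupp_add[OF supp' supp']]) (intro continuous_intros)
  have p: "has_partial i (bump r) (d i)" for i :: 'b
    unfolding has_partial_def using line[of 2 _ i] by (simp add: b d_def numeral_2_eq_2 mult_ac)
  have pp: "has_partial j (d i) (dd i j)" for i j :: 'b
    unfolding has_partial_def
  proof
    fix x
    have "((\<lambda>h. - 6 * ((x + h *\<^sub>R j) \<bullet> i)) has_real_derivative - 6 * (j \<bullet> i)) (at 0)"
      by (auto simp: inner_add_left intro!: derivative_eq_intros)
    from DERIV_mult[OF this line[of 1 x j]]
    show "((\<lambda>h. d i (x + h *\<^sub>R j)) has_real_derivative dd i j x) (at 0)"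
      by (simp add: d_def dd_def algebra_simps)
  qed
  show "bump r \<in> (C2b :: ('b \<Rightarrow> real) set)"
    by (rule C2bI[OF C1bI[OF bc p dc] p C1bI[OF dc pp ddc]])
qed

lemma bump_nonneg: "0 \<le> bump r x"
  by (simp add: bump_def)

lemma bump_eq_0:
  assumes "0 \<le> r" "r \<le> norm x" shows "bump r x = 0"
proof -
  have "r\<^sup>2 \<le> (norm x)\<^sup>2" using assms by (intro power_mono)
  then show ?thesis by (simp add: bump_def power2_norm_eq_inner)
qed

section \<open>Mollification as a vector-valued integral\<close>

definition translate :: "('b::euclidean_space \<Rightarrow> real) \<Rightarrow> 'b \<Rightarrow> ('b \<Rightarrow>\<^sub>C real)" where
  "translate \<psi> w = Bcontfun (\<lambda>z. \<psi> (z - w))"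

lemma apply_translate:
  assumes "\<psi> \<in> bcontfun"
  shows "apply_bcontfun (translate \<psi> w) z = \<psi> (z - w)"
proof -
  have "(\<lambda>z. \<psi> (z - w)) \<in> bcontfun" by (rule bcontfun_compose[OF assms]) (intro continuous_intros)
  then show ?thesis by (simp add: translate_def Bcontfun_inverse)
qed

text \<open>Continuity in the supremum norm is uniform continuity of \<psi>, which bounded support
  provides. It makes integrals of translates exist as elements of the function space.\<close>

lemma continuous_translate:
  assumes "csupp \<psi>" "continuous_on UNIV \<psi>"
  shows "continuous_on S (translate \<psi>)"
  unfolding continuous_on_iff
proof safe
  fix x e assume "x \<in> S" "0 < (e::real)"
  then have "0 < e/2" by simp
  from csupp_uniformly_continuous[OF assms this] obtain d where d: "0 < d"
    "\<And>x y. norm (x - y) < d \<Longrightarrow> \<bar>\<psi> x - \<psi> y\<bar> < e/2" by blast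
  have "dist (translate \<psi> y) (translate \<psi> x) < e" if "dist y x < d" for y
  proof -
    have "dist (translate \<psi> y) (translate \<psi> x) \<le> e/2"
    proof (rule dist_bound)
      fix z
      have "norm ((z - y) - (z - x)) < d" using that by (simp add: dist_norm norm_minus_commute)
      from d(2)[OF this] show "dist (translate \<psi> y z) (translate \<psi> x z) \<le> e/2"
        by (simp add: apply_translate csupp_bcontfun assms dist_norm less_imp_le)
    qed
    then show ?thesis using \<open>0 < e\<close> by simp
  qed
  then show "\<exists>d>0. \<forall>x'\<in>S. dist x' x < d \<longrightarrow> dist (translate \<psi> x') (translate \<psi> x) < e" using d(1) by blast
qed

text \<open>The convolution of \<open>F\<close> and \<psi>, for a box containing the support of
  \<open>F\<close>. The integral takes values in the bounded continuous functions, so a bounded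
  functional of it becomes an integral over its values on translates of \<psi>.\<close>

definition mollify :: "'b::euclidean_space \<Rightarrow> ('b \<Rightarrow> real) \<Rightarrow> ('b \<Rightarrow> real) \<Rightarrow> ('b \<Rightarrow>\<^sub>C real)" where
  "mollify a F \<psi> = integral (cbox (- a) a) (\<lambda>w. F w *\<^sub>R translate \<psi> w)"

lemma mollify_integrable:
  assumes "continuous_on UNIV F" "csupp \<psi>" "continuous_on UNIV \<psi>"
  shows "(\<lambda>w. F w *\<^sub>R translate \<psi> w) integrable_on cbox (- a) a"
  using assms by (intro integrable_continuous continuous_intros continuous_translate) (auto intro: continuous_on_subset)

lemma apply_mollify:
  assumes F: "continuous_on UNIV F" "\<And>x. x \<notin> cbox (- a) a \<Longrightarrow> F x = 0"
    and \<psi>: "csupp \<psi>" "continuous_on UNIV \<psi>"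
  shows "apply_bcontfun (mollify a F \<psi>) z = (\<integral>w. F w * \<psi> (z - w) \<partial>lborel)"
proof -
  have c: "continuous_on UNIV (\<lambda>w. F w * \<psi> (z - w))"
    by (intro continuous_intros F(1) continuous_on_compose2[OF \<psi>(2)]) auto
  have "csupp F"
  proof -
    obtain r where "\<And>x. x \<in> cbox (- a) a \<Longrightarrow> norm x \<le> r" using bounded_cbox[of "- a" a] by (auto simp: bounded_iff)
    then show ?thesis using F(2) unfolding csupp_def by (intro exI[of _ r]) (meson not_less)
  qed
  then have I: "integrable lborel (\<lambda>w. F w * \<psi> (z - w))" by (intro csupp_integrable csupp_mult c)
  have "apply_bcontfun (mollify a F \<psi>) z = integral (cbox (- a) a) (\<lambda>w. F w * \<psi> (z - w))"
    using integral_linear[OF mollify_integrable[OF F(1) \<psi>] bounded_linear_apply_bcontfun, of a z]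
    by (simp add: mollify_def o_def apply_translate csupp_bcontfun \<psi>)
  also have "\<dots> = integral UNIV (\<lambda>w. F w * \<psi> (z - w))"
    by (subst integral_restrict_UNIV[symmetric], rule integral_cong) (use F(2) in auto)
  also have "\<dots> = (\<integral>w. F w * \<psi> (z - w) \<partial>lborel)"
    using has_integral_integral_lborel[OF I] by (rule integral_unique)
  finally show ?thesis .
qed

lemma lborel_integral_reflect:
  fixes f :: "'b::euclidean_space \<Rightarrow> real"
  assumes "f \<in> borel_measurable borel"
  shows "(\<integral>w. f (z - w) \<partial>lborel) = (\<integral>w. f w \<partial>lborel)"
proof -
  have "lborel = distr lborel borel (\<lambda>x. z - x)"
    using lborel_affine[of "-1" z] by (simp add: density_1)
  then have "(\<integral>w. f w \<partial>lborel) = (\<integral>w. f w \<partial>distr lborel borel (\<lambda>x. z - x))" by simp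
  also have "\<dots> = (\<integral>w. f (z - w) \<partial>lborel)" by (rule integral_distr) (use assms in auto)
  finally show ?thesis by simp
qed

text \<open>After division by the total mass \<open>c\<close> of \<rho>, the value at z is an
  average of \<open>F\<close> over points within distance d of z.\<close>

lemma mollify_approx:
  fixes F \<rho> :: "'b::euclidean_space \<Rightarrow> real"
  assumes F: "continuous_on UNIV F" "\<And>x. x \<notin> cbox (- a) a \<Longrightarrow> F x = 0" "csupp F"
    and \<rho>: "csupp \<rho>" "continuous_on UNIV \<rho>" "\<And>x. 0 \<le> \<rho> x" "\<And>x. d \<le> norm x \<Longrightarrow> \<rho> x = 0"
    and c: "c = (\<integral>w. \<rho> w \<partial>lborel)" "0 < c"
    and close: "\<And>x y. norm (x - y) < d \<Longrightarrow> \<bar>F x - F y\<bar> \<le> e"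
  shows "norm (mollify a F \<rho> /\<^sub>R c - Bcontfun F) \<le> e"
proof (rule norm_bound)
  fix z
  have [measurable]: "\<rho> \<in> borel_measurable borel" using \<rho> by (intro borel_measurable_continuous_onI)
  have mass_\<rho>: "(\<integral>w. \<rho> (z - w) \<partial>lborel) = c" by (simp add: c lborel_integral_reflect)
  have cont: "continuous_on UNIV (\<lambda>w. \<rho> (z - w))"
    by (intro continuous_on_compose2[OF \<rho>(2)] continuous_intros) auto
  obtain r where r: "\<And>x. r < norm x \<Longrightarrow> \<rho> x = 0" using \<rho>(1) by (auto simp: csupp_def)
  have "csupp (\<lambda>w. \<rho> (z - w))"
    unfolding csupp_def
  proof (intro exI[of _ "r + norm z"] allI impI r)
    fix x :: 'b assume "r + norm z < norm x"
    then show "r < norm (z - x)" using norm_triangle_ineq2[of x z] by (simp add: norm_minus_commute)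
  qed
  then have I: "integrable lborel (\<lambda>w. \<rho> (z - w))" by (intro csupp_integrable cont)
  have I2: "integrable lborel (\<lambda>w. F w * \<rho> (z - w))"
    by (intro csupp_integrable csupp_mult F(3) continuous_intros cont F(1))
  have "\<bar>(\<integral>w. F w * \<rho> (z - w) \<partial>lborel) - F z * c\<bar> = \<bar>\<integral>w. F w * \<rho> (z - w) - F z * \<rho> (z - w) \<partial>lborel\<bar>"
    using I I2 mass_\<rho> by simp
  also have "\<dots> \<le> (\<integral>w. \<bar>F w * \<rho> (z - w) - F z * \<rho> (z - w)\<bar> \<partial>lborel)" by (rule integral_abs_bound)
  also have "\<dots> \<le> (\<integral>w. e * \<rho> (z - w) \<partial>lborel)"
  proof (rule integral_mono)
    fix w
    have "\<bar>F w - F z\<bar> * \<rho> (z - w) \<le> e * \<rho> (z - w)"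
    proof (cases "norm (z - w) < d")
      case True
      then show ?thesis using close[of w z] \<rho>(3) by (intro mult_right_mono) (auto simp: norm_minus_commute)
    next
      case False
      then show ?thesis using \<rho>(4)[of "z - w"] by simp
    qed
    then show "\<bar>F w * \<rho> (z - w) - F z * \<rho> (z - w)\<bar> \<le> e * \<rho> (z - w)"
      using \<rho>(3)[of "z - w"] by (simp add: abs_mult flip: left_diff_distrib)
  qed (use I I2 in auto)
  also have "\<dots> = e * c" using mass_\<rho> by simp
  finally have *: "\<bar>(\<integral>w. F w * \<rho> (z - w) \<partial>lborel) - F z * c\<bar> \<le> e * c" .
  have "\<bar>apply_bcontfun (mollify a F \<rho>) z / c - F z\<bar> = \<bar>(\<integral>w. F w * \<rho> (z - w) \<partial>lborel) - F z * c\<bar> / c"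
  proof -
    have "apply_bcontfun (mollify a F \<rho>) z / c - F z = ((\<integral>w. F w * \<rho> (z - w) \<partial>lborel) - F z * c) / c"
      using c(2) apply_mollify[OF F(1,2) \<rho>(1,2), of a z] by (simp add: diff_divide_distrib)
    then show ?thesis using c(2) by (simp add: abs_divide)
  qed
  also have "\<dots> \<le> e" using * c(2) by (simp add: field_simps)
  finally show "norm (apply_bcontfun (mollify a F \<rho> /\<^sub>R c - Bcontfun F) z) \<le> e"
    using F by (simp add: Bcontfun_inverse csupp_bcontfun divide_inverse mult.commute)
qed

text \<open>
  An identity between functionals of \<open>(F, \<Delta>F)\<close> passes from the translates of product bumps to
  all of $C^2_c$, since mollification by such a bump superposes its translates.
\<close>

lemma tensor_bumps_determine:
  fixes \<Phi> \<Psi> :: "(('a::euclidean_space \<times> 'a) \<Rightarrow>\<^sub>C real) \<Rightarrow> real"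
  assumes lin: "bounded_linear \<Phi>" "bounded_linear \<Psi>"
    and eq: "\<And>r w. 0 < r \<Longrightarrow> \<Phi> (translate (bump r \<otimes>\<^sub>f bump r) w) = \<Psi> (translate (laplacian (bump r \<otimes>\<^sub>f bump r)) w)"
    and F: "F \<in> C2b" "csupp F"
  shows "\<Phi> (Bcontfun F) = \<Psi> (Bcontfun (laplacian F))"
proof (rule ccontr)
  assume neq: "\<Phi> (Bcontfun F) \<noteq> \<Psi> (Bcontfun (laplacian F))"
  define D where "D = \<bar>\<Phi> (Bcontfun F) - \<Psi> (Bcontfun (laplacian F))\<bar>"
  have D: "0 < D" using neq by (simp add: D_def)
  obtain A where A: "0 < A" "\<And>x. \<bar>\<Phi> x\<bar> \<le> norm x * A" using bounded_linear.pos_bounded[OF lin(1)] by auto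
  obtain B where B: "0 < B" "\<And>x. \<bar>\<Psi> x\<bar> \<le> norm x * B" using bounded_linear.pos_bounded[OF lin(2)] by auto
  \<comment> \<open>Approximating \<open>F\<close> and its Laplacian within e disturbs the identity
    by at most \<open>e * A + e * B = D / 2\<close>, less than the supposed defect
    \<open>D\<close>.\<close>
  define e where "e = D / (2 * (A + B))"
  have e: "0 < e" using D A B by (simp add: e_def)
  let ?\<Delta>F = "laplacian F"
  have cF: "continuous_on UNIV F" "continuous_on UNIV ?\<Delta>F"
    using C2bD(2)[OF F(1)] laplacian_bcontfun[OF F(1)] by (auto simp: bcontfun_def)
  have sF: "csupp ?\<Delta>F" by (rule csupp_laplacian[OF F(2)])
  obtain d1 where d1: "0 < d1" "\<And>x y. norm (x - y) < d1 \<Longrightarrow> \<bar>F x - F y\<bar> < e"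
    using csupp_uniformly_continuous[OF F(2) cF(1) e] by blast
  obtain d2 where d2: "0 < d2" "\<And>x y. norm (x - y) < d2 \<Longrightarrow> \<bar>?\<Delta>F x - ?\<Delta>F y\<bar> < e"
    using csupp_uniformly_continuous[OF sF cF(2) e] by blast
  define d where "d = min d1 d2"
  \<comment> \<open>The norm of a pair is at most the sum of the norms of its components, so the
    product of two bumps of radius d/2 vanishes at distance d.\<close>
  define r where "r = d / 2"
  have r: "0 < r" "2 * r = d" using d1 d2 by (auto simp: r_def d_def)
  define \<rho> :: "'a \<times> 'a \<Rightarrow> real" where "\<rho> = bump r \<otimes>\<^sub>f bump r"
  have \<rho>2: "\<rho> \<in> C2b" unfolding \<rho>_def by (intro C2b_tensor C2b_bump)
  have \<rho>s: "csupp \<rho>" unfolding \<rho>_def by (intro csupp_tensor csupp_bump)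
  have \<rho>c: "continuous_on UNIV \<rho>" using C2bD(2)[OF \<rho>2] by (simp add: bcontfun_def)
  have \<Delta>c: "continuous_on UNIV (laplacian \<rho>)" using laplacian_bcontfun[OF \<rho>2] by (simp add: bcontfun_def)
  have \<rho>0: "0 \<le> \<rho> x" for x by (auto simp: \<rho>_def tensor_def split_beta bump_nonneg)
  have \<rho>z: "\<rho> x = 0" if "d \<le> norm x" for x
  proof -
    have "norm x \<le> norm (fst x) + norm (snd x)" by (metis norm_Pair_le prod.collapse)
    then have "r \<le> norm (fst x) \<or> r \<le> norm (snd x)" using that r by linarith
    then show ?thesis using r bump_eq_0[of r] by (auto simp: \<rho>_def tensor_def split_beta)
  qed
  define c where "c = (\<integral>w. \<rho> w \<partial>lborel)"
  have c: "0 < c"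
  proof -
    have I: "integrable lborel \<rho>" by (intro csupp_integrable \<rho>s \<rho>c)
    have "c \<noteq> 0"
    proof
      assume "c = 0"
      then have "AE x in lborel. \<rho> x = 0" using integral_nonneg_eq_0_iff_AE[OF I] \<rho>0 by (simp add: c_def)
      moreover have "open {x. \<rho> x \<noteq> 0}" using \<rho>c by (intro open_Collect_neq continuous_intros)
      ultimately have "{x. \<rho> x \<noteq> 0} \<in> null_sets lborel" by (subst (asm) AE_iff_null) auto
      then have "negligible {x. \<rho> x \<noteq> 0}" by (simp add: negligible_iff_null_sets null_sets_completionI)
      moreover have "open {x. \<rho> x \<noteq> 0}" by fact
      moreover have "0 \<in> {x. \<rho> x \<noteq> 0}" using r by (auto simp: \<rho>_def tensor_def bump_def zero_prod_def)
      ultimately show False using open_not_negligible by blast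
    qed
    moreover have "0 \<le> c" unfolding c_def by (intro integral_nonneg_AE) (simp add: \<rho>0)
    ultimately show ?thesis by simp
  qed
  have "bounded ({x. F x \<noteq> 0} \<union> {x. ?\<Delta>F x \<noteq> 0})"
  proof -
    have "bounded {x. f x \<noteq> 0}" if "csupp f" for f :: "'a \<times> 'a \<Rightarrow> real"
      using that unfolding csupp_def bounded_iff by (metis (mono_tags) mem_Collect_eq not_less)
    then show ?thesis using F(2) sF by simp
  qed
  then obtain a where a: "{x. F x \<noteq> 0} \<union> {x. ?\<Delta>F x \<noteq> 0} \<subseteq> cbox (- a) a" using bounded_subset_cbox_symmetric by blast
  then have az: "x \<notin> cbox (- a) a \<Longrightarrow> F x = 0" "x \<notin> cbox (- a) a \<Longrightarrow> ?\<Delta>F x = 0" for x by auto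
  \<comment> \<open>Integration by parts moves the Laplacian from the bump to \<open>F\<close>; this
    is how the hypothesis about bumps reaches the Laplacian of \<open>F\<close>.\<close>
  have mollify_eq: "mollify a F (laplacian \<rho>) = mollify a ?\<Delta>F \<rho>"
    by (rule bcontfun_eqI)
       (simp add: apply_mollify cF az \<Delta>c \<rho>c \<rho>s csupp_laplacian integral_by_parts_laplacian F \<rho>2)
  have "\<Phi> (mollify a F \<rho>) = integral (cbox (- a) a) (\<lambda>w. F w * \<Phi> (translate \<rho> w))"
    using integral_linear[OF mollify_integrable[OF cF(1) \<rho>s \<rho>c] lin(1), of a]
    by (simp add: mollify_def o_def linear_simps lin bounded_linear.linear linear_scale)
  also have "\<dots> = integral (cbox (- a) a) (\<lambda>w. F w * \<Psi> (translate (laplacian \<rho>) w))"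
    using eq[OF r(1)] by (simp add: \<rho>_def)
  also have "\<dots> = \<Psi> (mollify a F (laplacian \<rho>))"
    using integral_linear[OF mollify_integrable[OF cF(1) csupp_laplacian[OF \<rho>s] \<Delta>c] lin(2), of a]
    by (simp add: mollify_def o_def linear_simps lin bounded_linear.linear linear_scale)
  finally have conv: "\<Phi> (mollify a F \<rho>) = \<Psi> (mollify a ?\<Delta>F \<rho>)" by (simp add: mollify_eq)
  have n1: "norm (mollify a F \<rho> /\<^sub>R c - Bcontfun F) \<le> e"
    using d1(2) d_def
    by (intro mollify_approx[where d=d] cF az F \<rho>s \<rho>c \<rho>0 \<rho>z c_def c less_imp_le[OF d1(2)]) auto
  have n2: "norm (mollify a ?\<Delta>F \<rho> /\<^sub>R c - Bcontfun ?\<Delta>F) \<le> e"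
    using d2(2) d_def
    by (intro mollify_approx[where d=d] cF az sF \<rho>s \<rho>c \<rho>0 \<rho>z c_def c less_imp_le[OF d2(2)]) auto
  have "\<Phi> (mollify a F \<rho> /\<^sub>R c - Bcontfun F) - \<Psi> (mollify a ?\<Delta>F \<rho> /\<^sub>R c - Bcontfun ?\<Delta>F)
      = - (\<Phi> (Bcontfun F) - \<Psi> (Bcontfun ?\<Delta>F))"
    using conv lin by (simp add: bounded_linear.linear linear_diff linear_scale)
  then have "D \<le> \<bar>\<Phi> (mollify a F \<rho> /\<^sub>R c - Bcontfun F)\<bar> + \<bar>\<Psi> (mollify a ?\<Delta>F \<rho> /\<^sub>R c - Bcontfun ?\<Delta>F)\<bar>"
    unfolding D_def by linarith
  moreover have "\<bar>\<Phi> (mollify a F \<rho> /\<^sub>R c - Bcontfun F)\<bar> \<le> e * A"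
    by (rule order_trans[OF A(2) mult_right_mono[OF n1]]) (use A(1) in simp)
  moreover have "\<bar>\<Psi> (mollify a ?\<Delta>F \<rho> /\<^sub>R c - Bcontfun ?\<Delta>F)\<bar> \<le> e * B"
    by (rule order_trans[OF B(2) mult_right_mono[OF n2]]) (use B(1) in simp)
  moreover have "e * A + e * B = D / 2"
  proof -
    have "A + B \<noteq> 0" using A(1) B(1) by simp
    moreover have "D / (2 * s) * s = D / 2" if "s \<noteq> 0" for s :: real using that by simp
    ultimately have "e * (A + B) = D / 2" unfolding e_def by blast
    then show ?thesis by (simp only: distrib_left)
  qed
  ultimately show False using D by linarith
qed

section \<open>Joint measurability\<close>

text \<open>Round the time down to the grid of mesh 1/(n+1): each approximation takes countably many
  times and is jointly measurable, and path continuity gives the limit. \<open>max 0\<close> extends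
  the process to negative times.\<close>

lemma caratheodory_measurable:
  fixes h :: "real \<Rightarrow> 'w \<Rightarrow> real"
  assumes meas: "\<And>s. 0 \<le> s \<Longrightarrow> h s \<in> borel_measurable M"
    and cont: "\<And>\<omega>. \<omega> \<in> space M \<Longrightarrow> continuous_on {0..} (\<lambda>s. h s \<omega>)"
  shows "(\<lambda>(s, \<omega>). h (max 0 s) \<omega>) \<in> borel_measurable (borel \<Otimes>\<^sub>M M)"
proof -
  define q where "q n s = of_int \<lfloor>max 0 s * real (Suc n)\<rfloor> / real (Suc n)" for n s
  have q0: "0 \<le> q n s" for n s by (simp add: q_def)
  have qlim: "(\<lambda>n. q n s) \<longlonglongrightarrow> max 0 s" for s
  proof (rule LIMSEQ_I)
    fix e :: real assume "0 < e"
    then obtain N where N: "inverse (real (Suc N)) < e" using reals_Archimedean by blast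
    have "norm (q n s - max 0 s) < e" if "N \<le> n" for n
    proof -
      let ?u = "max 0 s * real (Suc n)"
      have "q n s - max 0 s = (of_int \<lfloor>?u\<rfloor> - ?u) / real (Suc n)"
        unfolding q_def by (simp add: diff_divide_distrib del: of_nat_Suc)
      then have "\<bar>q n s - max 0 s\<bar> = \<bar>of_int \<lfloor>?u\<rfloor> - ?u\<bar> / real (Suc n)"
        by (simp add: abs_divide del: of_nat_Suc)
      also have "\<dots> \<le> 1 / real (Suc n)" by (rule divide_right_mono) linarith+
      also have "\<dots> = inverse (real (Suc n))" by (simp add: inverse_eq_divide)
      also have "\<dots> \<le> inverse (real (Suc N))" using that by (intro le_imp_inverse_le) auto
      finally show ?thesis using N by simp
    qed
    then show "\<exists>N. \<forall>n\<ge>N. norm (q n s - max 0 s) < e" by blast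

  qed
  have "(\<lambda>x. h (q n (fst x)) (snd x)) \<in> borel_measurable (borel \<Otimes>\<^sub>M M)" for n
  proof -
    have "(\<lambda>x. h (of_int (max 0 \<lfloor>max 0 (fst x) * real (Suc n)\<rfloor>) / real (Suc n)) (snd x))
        \<in> borel_measurable (borel \<Otimes>\<^sub>M M)"
    proof (rule measurable_compose_countable'[where I=UNIV
          and f="\<lambda>k x. h (of_int (max 0 k) / real (Suc n)) (snd x)"
          and g="\<lambda>x. \<lfloor>max 0 (fst x) * real (Suc n)\<rfloor>"])
      show "(\<lambda>x. h (of_int (max 0 k) / real (Suc n)) (snd x)) \<in> borel_measurable (borel \<Otimes>\<^sub>M M)" for k
        by (rule measurable_compose[OF measurable_snd meas]) auto
      show "(\<lambda>x. \<lfloor>max 0 (fst x) * real (Suc n)\<rfloor>) \<in> borel \<Otimes>\<^sub>M M \<rightarrow>\<^sub>M count_space UNIV" by measurable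
    qed auto
    then show ?thesis by (simp add: q_def)
  qed
  then have "(\<lambda>x. h (max 0 (fst x)) (snd x)) \<in> borel_measurable (borel \<Otimes>\<^sub>M M)"
  proof (rule borel_measurable_LIMSEQ_real[rotated])
    fix x :: "real \<times> 'w" assume "x \<in> space (borel \<Otimes>\<^sub>M M)"
    then have "snd x \<in> space M" by (auto simp: space_pair_measure)
    from continuous_on_tendsto_compose[OF cont[OF this] qlim] q0
    show "(\<lambda>n. h (q n (fst x)) (snd x)) \<longlonglongrightarrow> h (max 0 (fst x)) (snd x)" by simp
  qed
  then show ?thesis by (simp add: split_beta)
qed

lemma bounded_measurable_interval:
  fixes w :: "real \<Rightarrow> real"
  assumes "w \<in> borel_measurable borel" "\<And>s. s \<in> {0..t} \<Longrightarrow> \<bar>w s\<bar> \<le> C"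
  shows "set_integrable lborel {0..t} w" "w integrable_on {0..t}"
    "(LBINT s:{0..t}. w s) = integral {0..t} w"
proof -
  show *: "set_integrable lborel {0..t} w"
    unfolding set_integrable_def
  proof (rule Bochner_Integration.integrable_bound)
    show "integrable lborel (\<lambda>s. indicator {0..t} s *\<^sub>R C)" by (rule borel_integrable_compact) auto
    show "(\<lambda>s. indicator {0..t} s *\<^sub>R w s) \<in> borel_measurable lborel" using assms(1) by auto
    have "\<bar>w s\<bar> \<le> \<bar>C\<bar>" if "s \<in> {0..t}" for s using assms(2)[OF that] by linarith
    then show "AE s in lborel. norm (indicator {0..t} s *\<^sub>R w s) \<le> norm (indicator {0..t} s *\<^sub>R C)"
      by (intro AE_I2) (auto split: split_indicator)
  qed
  show "w integrable_on {0..t}" "(LBINT s:{0..t}. w s) = integral {0..t} w"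
    using set_borel_integral_eq_integral[OF *] by auto
qed

text \<open>Absolute moments bounded uniformly over [0,t] yield joint integrability on the product
  of the time interval with the probability space.\<close>

lemma fubini_time:
  fixes h :: "real \<Rightarrow> 'w \<Rightarrow> real"
  assumes "prob_space M"
    and meas: "(\<lambda>(s, \<omega>). h s \<omega>) \<in> borel_measurable (borel \<Otimes>\<^sub>M M)"
    and int: "\<And>s. s \<in> {0..t} \<Longrightarrow> integrable M (h s)"
    and bd: "\<And>s. s \<in> {0..t} \<Longrightarrow> (\<integral>\<omega>. \<bar>h s \<omega>\<bar> \<partial>M) \<le> C"
  shows "integrable M (\<lambda>\<omega>. LBINT s:{0..t}. h s \<omega>)"
    and "(\<integral>\<omega>. (LBINT s:{0..t}. h s \<omega>) \<partial>M) = integral {0..t} (\<lambda>s. \<integral>\<omega>. h s \<omega> \<partial>M)"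
    and "(\<lambda>s. \<integral>\<omega>. h s \<omega> \<partial>M) integrable_on {0..t}"
proof -
  interpret prob_space M by fact
  have m[measurable]: "(\<lambda>x. h (fst x) (snd x)) \<in> borel_measurable (borel \<Otimes>\<^sub>M M)"
    using meas by (simp add: split_beta)
  have [measurable]: "(\<lambda>s. \<integral>\<omega>. h s \<omega> \<partial>M) \<in> borel_measurable borel"
    by (rule borel_measurable_lebesgue_integral) (simp add: split_beta)
  have [measurable]: "(\<lambda>s. \<integral>\<omega>. \<bar>h s \<omega>\<bar> \<partial>M) \<in> borel_measurable borel"
    by (rule borel_measurable_lebesgue_integral) (simp add: split_beta)
  interpret pair_sigma_finite lborel M ..
  have abs: "\<bar>\<integral>\<omega>. h s \<omega> \<partial>M\<bar> \<le> C" if "s \<in> {0..t}" for s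
    using order_trans[OF integral_abs_bound bd[OF that]] .
  have C: "\<bar>\<integral>\<omega>. \<bar>h s \<omega>\<bar> \<partial>M\<bar> \<le> C" if "s \<in> {0..t}" for s
    using bd[OF that] by simp
  have I: "integrable (lborel \<Otimes>\<^sub>M M) (\<lambda>(s, \<omega>). indicator {0..t} s *\<^sub>R h s \<omega>)"
  proof (rule Fubini_integrable)
    show "(\<lambda>(s, \<omega>). indicator {0..t} s *\<^sub>R h s \<omega>) \<in> borel_measurable (lborel \<Otimes>\<^sub>M M)"
      by (simp add: split_beta)
    have "set_integrable lborel {0..t} (\<lambda>s. \<integral>\<omega>. \<bar>h s \<omega>\<bar> \<partial>M)"
      by (rule bounded_measurable_interval(1)[OF _ C]) auto
    then show "integrable lborel (\<lambda>s. \<integral>\<omega>. norm (case (s, \<omega>) of (s, \<omega>) \<Rightarrow> indicator {0..t} s *\<^sub>R h s \<omega>) \<partial>M)"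
      by (simp add: set_integrable_def abs_mult)
    show "AE s in lborel. integrable M (\<lambda>\<omega>. case (s, \<omega>) of (s, \<omega>) \<Rightarrow> indicator {0..t} s *\<^sub>R h s \<omega>)"
      using int by (intro AE_I2) (auto split: split_indicator)
  qed
  show "integrable M (\<lambda>\<omega>. LBINT s:{0..t}. h s \<omega>)"
    using integrable_snd[OF I] by (simp add: set_lebesgue_integral_def)
  have "(\<integral>\<omega>. (LBINT s:{0..t}. h s \<omega>) \<partial>M) = (LBINT s:{0..t}. (\<integral>\<omega>. h s \<omega> \<partial>M))"
    using Fubini_integral[OF I] by (simp add: set_lebesgue_integral_def)
  also have "\<dots> = integral {0..t} (\<lambda>s. \<integral>\<omega>. h s \<omega> \<partial>M)"
    by (rule bounded_measurable_interval(3)[OF _ abs]) auto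
  finally show "(\<integral>\<omega>. (LBINT s:{0..t}. h s \<omega>) \<partial>M) = integral {0..t} (\<lambda>s. \<integral>\<omega>. h s \<omega> \<partial>M)" .
  show "(\<lambda>s. \<integral>\<omega>. h s \<omega> \<partial>M) integrable_on {0..t}"
    by (rule bounded_measurable_interval(2)[OF _ abs]) auto
qed

lemma integrable_product_L2:
  fixes f g :: "'w \<Rightarrow> real"
  assumes [measurable]: "f \<in> borel_measurable M" "g \<in> borel_measurable M"
    and f2: "integrable M (\<lambda>\<omega>. (f \<omega>)\<^sup>2)" and g2: "integrable M (\<lambda>\<omega>. (g \<omega>)\<^sup>2)"
  shows "integrable M (\<lambda>\<omega>. f \<omega> * g \<omega>)"
    and "(\<integral>\<omega>. \<bar>f \<omega> * g \<omega>\<bar> \<partial>M) \<le> (\<integral>\<omega>. (f \<omega>)\<^sup>2 \<partial>M) + (\<integral>\<omega>. (g \<omega>)\<^sup>2 \<partial>M)"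
proof -
  have le: "\<bar>f \<omega> * g \<omega>\<bar> \<le> (f \<omega>)\<^sup>2 + (g \<omega>)\<^sup>2" for \<omega>
  proof -
    have "2 * (\<bar>f \<omega>\<bar> * \<bar>g \<omega>\<bar>) \<le> (f \<omega>)\<^sup>2 + (g \<omega>)\<^sup>2"
      using sum_squares_bound[of "\<bar>f \<omega>\<bar>" "\<bar>g \<omega>\<bar>"] by (simp add: mult.assoc)
    moreover have "0 \<le> \<bar>f \<omega>\<bar> * \<bar>g \<omega>\<bar>" by simp
    ultimately show ?thesis unfolding abs_mult by linarith
  qed
  show I: "integrable M (\<lambda>\<omega>. f \<omega> * g \<omega>)"
    by (rule Bochner_Integration.integrable_bound[OF Bochner_Integration.integrable_add[OF f2 g2]])
       (use le in \<open>auto intro!: AE_I2\<close>)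
  have "(\<integral>\<omega>. \<bar>f \<omega> * g \<omega>\<bar> \<partial>M) \<le> (\<integral>\<omega>. (f \<omega>)\<^sup>2 + (g \<omega>)\<^sup>2 \<partial>M)"
    by (intro integral_mono integrable_abs I Bochner_Integration.integrable_add f2 g2 le)
  then show "(\<integral>\<omega>. \<bar>f \<omega> * g \<omega>\<bar> \<partial>M) \<le> (\<integral>\<omega>. (f \<omega>)\<^sup>2 \<partial>M) + (\<integral>\<omega>. (g \<omega>)\<^sup>2 \<partial>M)"
    using f2 g2 by simp
qed

text \<open>The indicator of a nonempty closed set is the pointwise limit of bounded continuous
  functions of the distance to it; dominated convergence carries measurability over.\<close>

lemma measure_closed_kernel_measurable:
  fixes \<nu> :: "'c \<Rightarrow> 'b::metric_space measure"
  assumes fin: "\<And>x. x \<in> space N \<Longrightarrow> finite_measure (\<nu> x) \<and> sets (\<nu> x) = sets borel"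
    and meas: "\<And>f :: 'b \<Rightarrow> real. f \<in> bcontfun \<Longrightarrow> (\<lambda>x. integral\<^sup>L (\<nu> x) f) \<in> borel_measurable N"
    and C: "closed C"
  shows "(\<lambda>x. measure (\<nu> x) C) \<in> borel_measurable N"
proof (cases "C = {}")
  case False
  define f where "f n y = max 0 (1 - real n * infdist y C)" for n y
  have f01: "0 \<le> f n y" "f n y \<le> 1" for n y by (auto simp: f_def infdist_nonneg)
  have fb: "f n \<in> bcontfun" for n
    by (rule bcontfun_normI[of _ 1]) (use f01 in \<open>auto simp: f_def intro!: continuous_intros\<close>)
  have lim: "(\<lambda>n. f n y) \<longlonglongrightarrow> indicator C y" for y
  proof (cases "y \<in> C")
    case True
    then show ?thesis by (simp add: f_def)
  next
    case n: False
    then have "0 < infdist y C"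
      using in_closed_iff_infdist_zero[OF C False] infdist_nonneg[of y C] by (metis order_le_less)
    then obtain k :: nat where k: "1 < real k * infdist y C" using reals_Archimedean3 by blast
    have "f m y = 0" if "k \<le> m" for m
    proof -
      have "real k * infdist y C \<le> real m * infdist y C" using that by (intro mult_right_mono) (auto simp: infdist_nonneg)
      then show ?thesis using k by (simp add: f_def)
    qed
    then show ?thesis using n by (intro tendsto_eventually) (auto simp: eventually_sequentially)
  qed
  show ?thesis
  proof (rule borel_measurable_LIMSEQ_real[OF _ meas[OF fb]])
    fix x assume x: "x \<in> space N"
    interpret finite_measure "\<nu> x" using fin[OF x] by simp
    have s: "sets (\<nu> x) = sets borel" using fin[OF x] by simp
    have sp: "space (\<nu> x) = UNIV" using sets_eq_imp_space_eq[OF s] by simp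
    have "(\<lambda>n. \<integral>y. f n y \<partial>\<nu> x) \<longlonglongrightarrow> (\<integral>y. indicator C y \<partial>\<nu> x)"
    proof (rule integral_dominated_convergence[where w="\<lambda>_. 1"])
      show "f n \<in> borel_measurable (\<nu> x)" for n
        using fb[of n] by (auto simp: measurable_cong_sets[OF s refl] bcontfun_def intro: borel_measurable_continuous_onI)
      show "(indicator C :: 'b \<Rightarrow> real) \<in> borel_measurable (\<nu> x)"
        using C by (intro borel_measurable_indicator) (auto simp: s)
    qed (use lim f01 in \<open>auto intro!: AE_I2\<close>)
    then show "(\<lambda>n. \<integral>y. f n y \<partial>\<nu> x) \<longlonglongrightarrow> measure (\<nu> x) C" by (simp add: sp)
  qed
qed simp

text \<open>The Giry monad of the library only has sub-probability measures, hence the normalisation.\<close>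

lemma normalised_kernel_measurable:
  fixes \<nu> :: "'c \<Rightarrow> 'b::metric_space measure"
  assumes fin: "\<And>x. x \<in> space N \<Longrightarrow> finite_measure (\<nu> x) \<and> sets (\<nu> x) = sets borel"
    and meas: "\<And>f :: 'b \<Rightarrow> real. f \<in> bcontfun \<Longrightarrow> (\<lambda>x. integral\<^sup>L (\<nu> x) f) \<in> borel_measurable N"
  shows "(\<lambda>x. density (\<nu> x) (\<lambda>_. ennreal (1 / (1 + measure (\<nu> x) UNIV)))) \<in> N \<rightarrow>\<^sub>M subprob_algebra borel"
proof -
  let ?c = "\<lambda>x. 1 / (1 + measure (\<nu> x) UNIV)"
  let ?Y = "\<lambda>x. density (\<nu> x) (\<lambda>_. ennreal (?c x))"
  have em: "emeasure (?Y x) A = ennreal (?c x * measure (\<nu> x) A)" if "x \<in> space N" "A \<in> sets borel" for x A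
  proof -
    interpret finite_measure "\<nu> x" using fin[OF that(1)] by simp
    show ?thesis using that fin[OF that(1)]
      by (simp add: emeasure_density_const emeasure_eq_measure flip: ennreal_mult)
  qed
  have sp: "space (\<nu> x) = UNIV" if "x \<in> space N" for x
    using fin[OF that] sets_eq_imp_space_eq[of "\<nu> x" borel] by simp
  have m: "(\<lambda>x. measure (\<nu> x) A) \<in> borel_measurable N" if "closed A" for A
    using fin meas that by (rule measure_closed_kernel_measurable)
  have mY: "(\<lambda>x. emeasure (?Y x) A) \<in> borel_measurable N" if "closed A" for A
  proof -
    note [measurable] = m[OF that] m[OF closed_UNIV]
    have "(\<lambda>x. ennreal (?c x * measure (\<nu> x) A)) \<in> borel_measurable N" by measurable
    then show ?thesis by (rule measurable_cong[THEN iffD1, rotated]) (use that in \<open>simp add: em\<close>)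
  qed
  show ?thesis
  \<comment> \<open>Closed sets are stable under intersection and generate the Borel sets, so
    measurability of the kernel need be tested only on them.\<close>
  proof (rule measurable_subprob_algebra_generated[where G="Collect closed" and \<Omega>=UNIV])
    show "sets borel = sigma_sets UNIV (Collect closed)"
      using arg_cong[OF borel_eq_closed, of sets] by simp
    show "Int_stable (Collect closed :: 'b set set)" by (auto simp: Int_stable_def)
    fix x assume x: "x \<in> space N"
    show "subprob_space (?Y x)"
    proof (rule subprob_spaceI)
      show "emeasure (?Y x) (space (?Y x)) \<le> 1"
      proof -
        have "?c x * measure (\<nu> x) UNIV \<le> 1"
          using measure_nonneg[of "\<nu> x" UNIV] by (simp add: pos_divide_le_eq add_nonneg_pos add_pos_nonneg)
        then show ?thesis using x em[OF x, of UNIV] by (simp add: sp)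
      qed
      show "space (?Y x) \<noteq> {}" using x by (simp add: sp)
    qed
    show "sets (?Y x) = sets borel" using fin[OF x] by simp
  qed (auto intro: mY)
qed

text \<open>Products of measurable sub-probability kernels are measurable. Normalisation multiplies
  the product measure by the square of the scalar factor, so the integral is recovered on
  multiplying by \<open>(1 + ?m x)\<^sup>2\<close>.\<close>

lemma pair_kernel_integral_measurable:
  fixes \<nu> :: "'c \<Rightarrow> 'b::euclidean_space measure" and \<psi> :: "'b \<times> 'b \<Rightarrow> real"
  assumes fin: "\<And>x. x \<in> space N \<Longrightarrow> finite_measure (\<nu> x) \<and> sets (\<nu> x) = sets borel"
    and meas: "\<And>f :: 'b \<Rightarrow> real. f \<in> bcontfun \<Longrightarrow> (\<lambda>x. integral\<^sup>L (\<nu> x) f) \<in> borel_measurable N"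
    and \<psi>: "\<psi> \<in> borel_measurable borel"
  shows "(\<lambda>x. integral\<^sup>L (\<nu> x \<Otimes>\<^sub>M \<nu> x) \<psi>) \<in> borel_measurable N"
proof -
  let ?m = "\<lambda>x. measure (\<nu> x) UNIV"
  let ?c = "\<lambda>x. 1 / (1 + ?m x)"
  let ?Y = "\<lambda>x. density (\<nu> x) (\<lambda>_. ennreal (?c x))"
  have [measurable]: "?m \<in> borel_measurable N" using fin meas by (rule measure_closed_kernel_measurable) auto
  have \<psi>': "\<psi> \<in> borel_measurable (borel \<Otimes>\<^sub>M borel)" using \<psi> by (simp add: borel_prod)
  note Y = normalised_kernel_measurable[OF fin meas]
  have "(\<lambda>x. integral\<^sup>L (?Y x \<Otimes>\<^sub>M ?Y x) \<psi>) \<in> borel_measurable N"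
    using measurable_compose[OF measurable_pair_measure[OF Y Y] integral_measurable_subprob_algebra[OF \<psi>']] by simp
  then have "(\<lambda>x. (1 + ?m x)\<^sup>2 * integral\<^sup>L (?Y x \<Otimes>\<^sub>M ?Y x) \<psi>) \<in> borel_measurable N" by measurable
  then show ?thesis
  proof (rule measurable_cong[THEN iffD1, rotated])
    fix x assume x: "x \<in> space N"
    interpret finite_measure "\<nu> x" using fin[OF x] by simp
    have s: "sets (\<nu> x) = sets borel" using fin[OF x] by simp
    have pos: "1 + ?m x \<noteq> 0" by (simp add: add_nonneg_eq_0_iff)
    have "subprob_space (?Y x)" using measurable_space[OF Y x] by (simp add: space_subprob_algebra)
    then have sf: "sigma_finite_measure (?Y x)" by (rule subprob_space_imp_sigma_finite)
    have "?Y x \<Otimes>\<^sub>M ?Y x = density (\<nu> x \<Otimes>\<^sub>M \<nu> x) (\<lambda>(a, b). ennreal (?c x) * ennreal (?c x))"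
      by (rule pair_measure_density) (auto intro: sf sigma_finite_measure_axioms)
    also have "\<dots> = density (\<nu> x \<Otimes>\<^sub>M \<nu> x) (\<lambda>_. ennreal (?c x * ?c x))"
      by (subst ennreal_mult) (simp_all add: split_beta case_prod_unfold)
    finally have eq: "?Y x \<Otimes>\<^sub>M ?Y x = density (\<nu> x \<Otimes>\<^sub>M \<nu> x) (\<lambda>_. ennreal (?c x * ?c x))" .
    have \<psi>x: "\<psi> \<in> borel_measurable (\<nu> x \<Otimes>\<^sub>M \<nu> x)"
      using \<psi>' by (simp add: measurable_cong_sets[OF sets_pair_measure_cong[OF s s] refl])
    have "integral\<^sup>L (?Y x \<Otimes>\<^sub>M ?Y x) \<psi> = (?c x * ?c x) * integral\<^sup>L (\<nu> x \<Otimes>\<^sub>M \<nu> x) \<psi>"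
      unfolding eq by (subst integral_density) (use \<psi>x in auto)
    then show "(1 + ?m x)\<^sup>2 * integral\<^sup>L (?Y x \<Otimes>\<^sub>M ?Y x) \<psi> = integral\<^sup>L (\<nu> x \<Otimes>\<^sub>M \<nu> x) \<psi>"
      using pos by (simp add: power2_eq_square)
  qed
qed

section \<open>Moments of solutions of the martingale problem\<close>

text \<open>Only consequences of the assumptions on \<open>g\<close> are kept: boundedness and
  continuity make multiplication by \<open>g\<close> a bounded operation on test functions, and
  symmetry enters in the polarisation.\<close>

locale sbm = sbm_random_environment M F X g \<mu>
  for M :: "'w measure" and F :: "real \<Rightarrow> 'w measure"
    and X :: "real \<Rightarrow> 'w \<Rightarrow> 'a::euclidean_space measure"
    and g :: "'a \<times> 'a \<Rightarrow> real" and \<mu> :: "'a measure" +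
  assumes g_bcontfun: "g \<in> bcontfun"
    and g_sym: "\<And>x y. g (x, y) = g (y, x)"
    and finite_\<mu>: "finite_measure \<mu>" and sets_\<mu>: "sets \<mu> = sets borel"
begin

definition mass :: "real \<Rightarrow> 'w \<Rightarrow> real" where
  "mass s \<omega> = measure (X s \<omega>) UNIV"

lemma space_X: "0 \<le> s \<Longrightarrow> \<omega> \<in> space M \<Longrightarrow> space (X s \<omega>) = UNIV"
  using finite_measures[of s \<omega>] sets_eq_imp_space_eq[of "X s \<omega>" borel] by simp

lemma mass_eq: "0 \<le> s \<Longrightarrow> \<omega> \<in> space M \<Longrightarrow> mass s \<omega> = integral\<^sup>L (X s \<omega>) (\<lambda>_. 1)"
  by (simp add: mass_def space_X)

lemma mass_nonneg: "0 \<le> mass s \<omega>"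
  by (simp add: mass_def)

lemma adapted_M:
  assumes "Defs.adapted F Y" "0 \<le> s" shows "Y s \<in> borel_measurable M"
  using assms subalgebra[of s] by (auto simp: Defs.adapted_def intro: measurable_from_subalg)

lemma single_measurable: "f \<in> bcontfun \<Longrightarrow> 0 \<le> s \<Longrightarrow> (\<lambda>\<omega>. integral\<^sup>L (X s \<omega>) f) \<in> borel_measurable M"
  for f :: "'a \<Rightarrow> real"
  using adapted_M[OF adapted] .

text \<open>\<open>X\<close> is constrained only at nonnegative times; freezing it at time 0 for
  negative ones gives a jointly measurable process on the whole line.\<close>

lemma single_joint:
  fixes f :: "'a \<Rightarrow> real"
  assumes "f \<in> bcontfun"
  shows "(\<lambda>(s, \<omega>). integral\<^sup>L (X (max 0 s) \<omega>) f) \<in> borel_measurable (borel \<Otimes>\<^sub>M M)"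
  by (rule caratheodory_measurable)
     (use assms single_measurable weakly_continuous in \<open>auto simp: continuous_paths_def\<close>)

text \<open>Here \<psi> need not be a product, so \<open>X\<close> is treated as a kernel from the
  product of time and sample space, whose integrals are measurable by
  \<open>single_joint\<close>.\<close>

lemma pair_joint:
  fixes \<psi> :: "'a \<times> 'a \<Rightarrow> real"
  assumes "\<psi> \<in> bcontfun"
  shows "(\<lambda>(s, \<omega>). integral\<^sup>L (X (max 0 s) \<omega> \<Otimes>\<^sub>M X (max 0 s) \<omega>) \<psi>) \<in> borel_measurable (borel \<Otimes>\<^sub>M M)"
proof -
  have "(\<lambda>x. integral\<^sup>L (X (max 0 (fst x)) (snd x) \<Otimes>\<^sub>M X (max 0 (fst x)) (snd x)) \<psi>)
      \<in> borel_measurable (borel \<Otimes>\<^sub>M M)"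
  proof (rule pair_kernel_integral_measurable)
    show "finite_measure (X (max 0 (fst x)) (snd x)) \<and> sets (X (max 0 (fst x)) (snd x)) = sets borel"
      if "x \<in> space (borel \<Otimes>\<^sub>M M)" for x :: "real \<times> 'w"
      using that by (intro finite_measures) (auto simp: space_pair_measure)
    show "(\<lambda>x. integral\<^sup>L (X (max 0 (fst x)) (snd x)) f) \<in> borel_measurable (borel \<Otimes>\<^sub>M M)"
      if "f \<in> bcontfun" for f :: "'a \<Rightarrow> real"
      using single_joint[OF that] by (simp add: split_beta)
    show "\<psi> \<in> borel_measurable borel" using assms by (auto simp: bcontfun_def intro: borel_measurable_continuous_onI)
  qed
  then show ?thesis by (simp add: split_beta)
qed

lemma pair_measurable:
  fixes \<psi> :: "'a \<times> 'a \<Rightarrow> real"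
  assumes "\<psi> \<in> bcontfun" "0 \<le> s"
  shows "(\<lambda>\<omega>. integral\<^sup>L (X s \<omega> \<Otimes>\<^sub>M X s \<omega>) \<psi>) \<in> borel_measurable M"
proof -
  have "(\<lambda>\<omega>. (\<lambda>(s, \<omega>). integral\<^sup>L (X (max 0 s) \<omega> \<Otimes>\<^sub>M X (max 0 s) \<omega>) \<psi>) (s, \<omega>)) \<in> borel_measurable M"
    by (rule measurable_compose[OF measurable_Pair1' pair_joint[OF assms(1)]]) simp
  then show ?thesis using assms by (simp add: max_def)
qed

lemma pair_finite:
  assumes "0 \<le> s" "\<omega> \<in> space M"
  shows "finite_measure (X s \<omega> \<Otimes>\<^sub>M X s \<omega>)" "sets (X s \<omega> \<Otimes>\<^sub>M X s \<omega>) = sets borel"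
    "measure (X s \<omega> \<Otimes>\<^sub>M X s \<omega>) UNIV = (mass s \<omega>)\<^sup>2"
proof -
  interpret finite_measure "X s \<omega>" using finite_measures assms by blast
  have s: "sets (X s \<omega>) = sets borel" using finite_measures assms by blast
  have U: "UNIV \<in> sets (X s \<omega>)" by (simp add: s)
  have "emeasure (X s \<omega> \<Otimes>\<^sub>M X s \<omega>) (UNIV \<times> UNIV) = ennreal ((mass s \<omega>)\<^sup>2)"
    by (subst emeasure_pair_measure_Times[OF U U])
       (simp add: emeasure_eq_measure mass_def power2_eq_square ennreal_mult)
  then show "measure (X s \<omega> \<Otimes>\<^sub>M X s \<omega>) UNIV = (mass s \<omega>)\<^sup>2"
    by (simp add: measure_def)
  show "finite_measure (X s \<omega> \<Otimes>\<^sub>M X s \<omega>)"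
    by (rule finite_measure_pair_measure) (rule finite_measure_axioms)+
  show "sets (X s \<omega> \<Otimes>\<^sub>M X s \<omega>) = sets borel"
    using sets_pair_measure_cong[OF s s] unfolding borel_prod .
qed

lemma single_bound:
  fixes f :: "'a \<Rightarrow> real"
  assumes "f \<in> bcontfun" "\<And>x. \<bar>f x\<bar> \<le> B" "0 \<le> s" "\<omega> \<in> space M"
  shows "\<bar>integral\<^sup>L (X s \<omega>) f\<bar> \<le> B * mass s \<omega>"
proof -
  have fs: "finite_measure (X s \<omega>)" "sets (X s \<omega>) = sets borel" using finite_measures assms by blast+
  have n: "norm (Bcontfun f) \<le> B" by (rule norm_bound) (simp add: Bcontfun_inverse assms)
  have "\<bar>integral\<^sup>L (X s \<omega>) f\<bar> \<le> mass s \<omega> * norm (Bcontfun f)"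
    using bcontfun_integral_bound[OF fs, of "Bcontfun f"] by (simp add: Bcontfun_inverse assms mass_def)
  also have "\<dots> \<le> mass s \<omega> * B" by (intro mult_left_mono n mass_nonneg)
  finally show ?thesis by (simp add: mult.commute)
qed

lemma pair_bound:
  fixes \<psi> :: "'a \<times> 'a \<Rightarrow> real"
  assumes "\<psi> \<in> bcontfun" "\<And>x. \<bar>\<psi> x\<bar> \<le> B" "0 \<le> s" "\<omega> \<in> space M"
  shows "\<bar>integral\<^sup>L (X s \<omega> \<Otimes>\<^sub>M X s \<omega>) \<psi>\<bar> \<le> B * (mass s \<omega>)\<^sup>2"
proof -
  have n: "norm (Bcontfun \<psi>) \<le> B" by (rule norm_bound) (simp add: Bcontfun_inverse assms)
  have "\<bar>integral\<^sup>L (X s \<omega> \<Otimes>\<^sub>M X s \<omega>) \<psi>\<bar> \<le> (mass s \<omega>)\<^sup>2 * norm (Bcontfun \<psi>)"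
    using bcontfun_integral_bound[OF pair_finite(1,2)[OF assms(3,4)], of "Bcontfun \<psi>"]
    by (simp add: Bcontfun_inverse assms pair_finite(3))
  also have "\<dots> \<le> (mass s \<omega>)\<^sup>2 * B" by (intro mult_left_mono n) simp
  finally show ?thesis by (simp add: mult.commute)
qed

lemma pair_tensor:
  fixes f h :: "'a \<Rightarrow> real"
  assumes "f \<in> bcontfun" "h \<in> bcontfun" "0 \<le> s" "\<omega> \<in> space M"
  shows "integral\<^sup>L (X s \<omega> \<Otimes>\<^sub>M X s \<omega>) (f \<otimes>\<^sub>f h) = integral\<^sup>L (X s \<omega>) f * integral\<^sup>L (X s \<omega>) h"
proof -
  interpret finite_measure "X s \<omega>" using finite_measures assms by blast
  interpret pair_sigma_finite "X s \<omega>" "X s \<omega>" ..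
  have I: "integrable (X s \<omega> \<Otimes>\<^sub>M X s \<omega>) (\<lambda>(x, y). f x * h y)"
    using bcontfun_integrable[OF pair_finite(1,2)[OF assms(3,4)], of "Bcontfun (f \<otimes>\<^sub>f h)"]
    unfolding Bcontfun_inverse[OF tensor_bcontfun[OF assms(1,2)]] by (simp add: tensor_def)
  show ?thesis using integral_fst[OF I] by (simp add: tensor_def)
qed

lemma pair_swap:
  fixes \<psi> :: "'a \<times> 'a \<Rightarrow> real"
  assumes "\<psi> \<in> bcontfun" "0 \<le> s" "\<omega> \<in> space M"
  shows "integral\<^sup>L (X s \<omega> \<Otimes>\<^sub>M X s \<omega>) (\<lambda>(x, y). \<psi> (y, x)) = integral\<^sup>L (X s \<omega> \<Otimes>\<^sub>M X s \<omega>) \<psi>"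
proof -
  interpret finite_measure "X s \<omega>" using finite_measures assms by blast
  interpret pair_sigma_finite "X s \<omega>" "X s \<omega>" ..
  have "\<psi> \<in> borel_measurable (X s \<omega> \<Otimes>\<^sub>M X s \<omega>)"
    using assms(1) by (auto simp: measurable_cong_sets[OF pair_finite(2)[OF assms(2,3)] refl] bcontfun_def
        intro: borel_measurable_continuous_onI)
  from integral_product_swap[OF this] show ?thesis .
qed

section \<open>Martingale expectations and moments of the total mass\<close>

lemma subalg: "sigma_finite_subalgebra M (F s)"
proof -
  interpret finite_measure_subalgebra M "F s" by unfold_locales (rule subalgebra)
  show ?thesis by (rule sigma_finite_subalgebra_axioms)
qed

lemma martingale_expectation:
  assumes Y: "martingale M F Y" and t: "0 \<le> t"
  shows "(\<integral>\<omega>. Y t \<omega> \<partial>M) = (\<integral>\<omega>. Y 0 \<omega> \<partial>M)"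
proof -
  interpret sigma_finite_subalgebra M "F 0" by (rule subalg)
  have I: "integrable M (Y t)" using assms by (auto simp: martingale_def)
  have "(\<integral>\<omega>. Y t \<omega> \<partial>M) = (\<integral>\<omega>. real_cond_exp M (F 0) (Y t) \<omega> \<partial>M)"
    using real_cond_exp_int(2)[OF I] by simp
  also have "\<dots> = (\<integral>\<omega>. Y 0 \<omega> \<partial>M)"
    using assms adapted_M[of Y 0] by (intro integral_cong_AE) (auto simp: martingale_def)
  finally show ?thesis .
qed

text \<open>The factor \<open>b\<close>, known at time s, is pulled out of the conditional
  expectation. It need not be bounded; integrability of the product suffices.\<close>

lemma martingale_test:
  assumes Y: "martingale M F Y" and st: "0 \<le> s" "s \<le> t"
    and b: "b \<in> borel_measurable (F s)" and I: "integrable M (\<lambda>\<omega>. b \<omega> * Y t \<omega>)"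
  shows "(\<integral>\<omega>. b \<omega> * Y t \<omega> \<partial>M) = (\<integral>\<omega>. b \<omega> * Y s \<omega> \<partial>M)"
proof -
  interpret sigma_finite_subalgebra M "F s" by (rule subalg)
  have m: "Y t \<in> borel_measurable M" "Y s \<in> borel_measurable M"
    using Y st adapted_M[of Y] by (auto simp: martingale_def)
  have bM: "b \<in> borel_measurable M" using measurable_from_subalg[OF subalgebra b] .
  have "(\<integral>\<omega>. b \<omega> * Y t \<omega> \<partial>M) = (\<integral>\<omega>. b \<omega> * real_cond_exp M (F s) (Y t) \<omega> \<partial>M)"
    using real_cond_exp_intg(2)[OF I b m(1)] by simp
  also have "\<dots> = (\<integral>\<omega>. b \<omega> * Y s \<omega> \<partial>M)"
  proof (rule integral_cong_AE)
    have "AE \<omega> in M. real_cond_exp M (F s) (Y t) \<omega> = Y s \<omega>" using Y st by (simp add: martingale_def)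
    then show "AE \<omega> in M. b \<omega> * real_cond_exp M (F s) (Y t) \<omega> = b \<omega> * Y s \<omega>"
      by eventually_elim simp
  qed (use m bM in auto)
  finally show ?thesis .
qed

lemma mart_process_0: "AE \<omega> in M. mart_process X \<mu> f 0 \<omega> = 0"
  using start
proof eventually_elim
  case (elim \<omega>)
  have "(LBINT s:{0..0}. integral\<^sup>L (X s \<omega>) (laplacian f)) = 0"
    unfolding set_lebesgue_integral_def using AE_lborel_singleton[of 0]
    by (intro integral_eq_zero_AE) (auto elim: eventually_mono)
  then show ?case using elim by (simp add: mart_process_def)
qed

lemma mart_process_measurable:
  assumes "f \<in> C2b" "0 \<le> s" shows "mart_process X \<mu> f s \<in> borel_measurable M"
  using mart[OF assms(1)] assms(2) adapted_M by (auto simp: continuous_L2_martingale_def martingale_def)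

lemma mart_process_mean:
  assumes "f \<in> C2b" "0 \<le> t"
  shows "integrable M (mart_process X \<mu> f t)" "(\<integral>\<omega>. mart_process X \<mu> f t \<omega> \<partial>M) = 0"
proof -
  have m: "martingale M F (mart_process X \<mu> f)" using mart[OF assms(1)] by (simp add: continuous_L2_martingale_def)
  then show "integrable M (mart_process X \<mu> f t)" using assms by (simp add: martingale_def)
  have "(\<integral>\<omega>. mart_process X \<mu> f 0 \<omega> \<partial>M) = (\<integral>\<omega>. 0 \<partial>M)"
    using mart_process_0 mart_process_measurable[OF assms(1), of 0] by (intro integral_cong_AE) auto
  then show "(\<integral>\<omega>. mart_process X \<mu> f t \<omega> \<partial>M) = 0" using martingale_expectation[OF m assms(2)] by simp
qed

text \<open>The square minus the variation is a martingale that vanishes at time 0 almost surely.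
  The variation is integrable as a difference of two integrable processes.\<close>

lemma mart_process_square:
  assumes "f \<in> C2b" "0 \<le> t"
  shows "integrable M (\<lambda>\<omega>. (mart_process X \<mu> f t \<omega>)\<^sup>2)"
    and "integrable M (mart_variation X g f t)"
    and "(\<integral>\<omega>. (mart_process X \<mu> f t \<omega>)\<^sup>2 \<partial>M) = (\<integral>\<omega>. mart_variation X g f t \<omega> \<partial>M)"
proof -
  let ?Y = "mart_process X \<mu> f" and ?A = "mart_variation X g f"
  let ?N = "\<lambda>t \<omega>. (?Y t \<omega>)\<^sup>2 - ?A t \<omega>"
  show I: "integrable M (\<lambda>\<omega>. (?Y t \<omega>)\<^sup>2)"
    using mart[OF assms(1)] assms(2) by (simp add: continuous_L2_martingale_def)
  have v: "quadratic_variation M F ?Y ?A" using variation[OF assms(1)] .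
  then have N: "martingale M F ?N" by (simp add: quadratic_variation_def)
  then have IN: "integrable M (?N t)" using assms by (simp add: martingale_def)
  have "integrable M (\<lambda>\<omega>. (?Y t \<omega>)\<^sup>2 - ?N t \<omega>)" using I IN by (rule Bochner_Integration.integrable_diff)
  then show IA: "integrable M (?A t)" by simp
  have "(\<integral>\<omega>. ?N 0 \<omega> \<partial>M) = (\<integral>\<omega>. 0 \<partial>M)"
  proof (rule integral_cong_AE)
    show "?N 0 \<in> borel_measurable M" using N adapted_M[of ?N 0] by (simp add: martingale_def)
    show "AE \<omega> in M. ?N 0 \<omega> = 0"
      using mart_process_0[of f] AE_space
    proof eventually_elim
      case (elim \<omega>)
      then show ?case using v by (simp add: quadratic_variation_def)
    qed
  qed simp
  then have "(\<integral>\<omega>. ?N t \<omega> \<partial>M) = 0" using martingale_expectation[OF N assms(2)] by simp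
  then show "(\<integral>\<omega>. (?Y t \<omega>)\<^sup>2 \<partial>M) = (\<integral>\<omega>. ?A t \<omega> \<partial>M)" using I IA by simp
qed

text \<open>Inherited from the increasing variation; it turns a bound at time t into one that is
  uniform on [0,t].\<close>

lemma mart_process_square_mono:
  assumes "f \<in> C2b" "0 \<le> s" "s \<le> t"
  shows "(\<integral>\<omega>. (mart_process X \<mu> f s \<omega>)\<^sup>2 \<partial>M) \<le> (\<integral>\<omega>. (mart_process X \<mu> f t \<omega>)\<^sup>2 \<partial>M)"
proof -
  have "(\<integral>\<omega>. mart_variation X g f s \<omega> \<partial>M) \<le> (\<integral>\<omega>. mart_variation X g f t \<omega> \<partial>M)"
  proof (rule integral_mono)
    fix \<omega> assume "\<omega> \<in> space M"
    then have "mono_on {0..} (\<lambda>t. mart_variation X g f t \<omega>)"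
      using variation[OF assms(1)] by (simp add: quadratic_variation_def)
    then show "mart_variation X g f s \<omega> \<le> mart_variation X g f t \<omega>"
      using assms by (simp add: mono_on_def)
  qed (use assms in \<open>auto intro: mart_process_square\<close>)
  then show ?thesis using assms by (simp add: mart_process_square)
qed

lemma mass_measurable: "0 \<le> s \<Longrightarrow> mass s \<in> borel_measurable M"
  by (rule measurable_cong[THEN iffD2, OF _ single_measurable[OF const_bcontfun[of 1], of s]]) (simp add: mass_eq)

text \<open>For the test function 1 the Laplacian vanishes, so the total mass is its initial value
  plus a square-integrable martingale and no Gronwall argument is required. The first moment follows
  from \<open>mass s \<omega> \<le> 1 + (mass s \<omega>)\<^sup>2\<close>.\<close>

lemma moment_bound:
  obtains C where "1 \<le> C"
    "\<And>s. 0 \<le> s \<Longrightarrow> s \<le> t \<Longrightarrow> integrable M (\<lambda>\<omega>. (mass s \<omega>)\<^sup>2)"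
    "\<And>s. 0 \<le> s \<Longrightarrow> s \<le> t \<Longrightarrow> (\<integral>\<omega>. (mass s \<omega>)\<^sup>2 \<partial>M) \<le> C"
    "\<And>s. 0 \<le> s \<Longrightarrow> s \<le> t \<Longrightarrow> integrable M (mass s)"
    "\<And>s. 0 \<le> s \<Longrightarrow> s \<le> t \<Longrightarrow> (\<integral>\<omega>. mass s \<omega> \<partial>M) \<le> C"
proof -
  let ?Y = "mart_process X \<mu> (\<lambda>_. 1)"
  let ?m = "measure \<mu> UNIV"
  have 1: "(\<lambda>_ :: 'a. 1) \<in> C2b" by (rule C2b_const)
  define D where "D = 2 * (\<integral>\<omega>. (?Y t \<omega>)\<^sup>2 \<partial>M) + 2 * ?m\<^sup>2"
  have sp: "space \<mu> = UNIV" using sets_eq_imp_space_eq[OF sets_\<mu>] by simp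
  have D0: "0 \<le> D" by (simp add: D_def)
  have *: "integrable M (\<lambda>\<omega>. (mass s \<omega>)\<^sup>2)" "(\<integral>\<omega>. (mass s \<omega>)\<^sup>2 \<partial>M) \<le> D" if s: "0 \<le> s" "s \<le> t" for s
  proof -
    have IY: "integrable M (\<lambda>\<omega>. (?Y s \<omega>)\<^sup>2)" by (rule mart_process_square(1)[OF 1 s(1)])
    have eq: "mass s \<omega> = ?Y s \<omega> + ?m" if "\<omega> \<in> space M" for \<omega>
      using s that by (simp add: mart_process_def laplacian_const mass_eq sp set_lebesgue_integral_def)
    have le: "(mass s \<omega>)\<^sup>2 \<le> 2 * (?Y s \<omega>)\<^sup>2 + 2 * ?m\<^sup>2" if "\<omega> \<in> space M" for \<omega>
      using sum_squares_bound[of "?Y s \<omega>" ?m] by (simp add: eq[OF that] power2_sum)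
    have IB: "integrable M (\<lambda>\<omega>. 2 * (?Y s \<omega>)\<^sup>2 + 2 * ?m\<^sup>2)" using IY by simp
    show I: "integrable M (\<lambda>\<omega>. (mass s \<omega>)\<^sup>2)"
      by (rule Bochner_Integration.integrable_bound[OF IB])
         (use le mass_measurable[OF s(1)] in \<open>auto intro!: AE_I2\<close>)
    have "(\<integral>\<omega>. (mass s \<omega>)\<^sup>2 \<partial>M) \<le> (\<integral>\<omega>. 2 * (?Y s \<omega>)\<^sup>2 + 2 * ?m\<^sup>2 \<partial>M)"
      by (rule integral_mono[OF I IB le])
    also have "\<dots> \<le> D"
      using IY mart_process_square_mono[OF 1 s] by (simp add: D_def prob_space)
    finally show "(\<integral>\<omega>. (mass s \<omega>)\<^sup>2 \<partial>M) \<le> D" .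
  qed
  have le1: "mass s \<omega> \<le> 1 + (mass s \<omega>)\<^sup>2" for s \<omega>
    using sum_squares_bound[of 1 "mass s \<omega>"] mass_nonneg[of s \<omega>] by simp
  have **: "integrable M (mass s)" "(\<integral>\<omega>. mass s \<omega> \<partial>M) \<le> 1 + D" if s: "0 \<le> s" "s \<le> t" for s
  proof -
    have IB: "integrable M (\<lambda>\<omega>. 1 + (mass s \<omega>)\<^sup>2)" using *(1)[OF s] by simp
    show I: "integrable M (mass s)"
      by (rule Bochner_Integration.integrable_bound[OF IB])
         (use le1 mass_nonneg mass_measurable[OF s(1)] in \<open>auto intro!: AE_I2\<close>)
    have "(\<integral>\<omega>. mass s \<omega> \<partial>M) \<le> (\<integral>\<omega>. 1 + (mass s \<omega>)\<^sup>2 \<partial>M)"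
      by (rule integral_mono[OF I IB le1])
    also have "\<dots> \<le> 1 + D" using *[OF s] by (simp add: prob_space)
    finally show "(\<integral>\<omega>. mass s \<omega> \<partial>M) \<le> 1 + D" .
  qed
  have e: "(\<integral>\<omega>. (mass s \<omega>)\<^sup>2 \<partial>M) \<le> 1 + D" if s: "0 \<le> s" "s \<le> t" for s
    using *(2)[OF s] by linarith
  show ?thesis
    by (rule that[of "1 + D"]) (use * ** e D0 in auto)
qed

section \<open>First and second moment functionals\<close>

definition m1 :: "real \<Rightarrow> ('a \<Rightarrow> real) \<Rightarrow> real" where
  "m1 s f = (\<integral>\<omega>. integral\<^sup>L (X (max 0 s) \<omega>) f \<partial>M)"

definition m2 :: "real \<Rightarrow> ('a \<times> 'a \<Rightarrow> real) \<Rightarrow> real" where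
  "m2 s \<psi> = (\<integral>\<omega>. integral\<^sup>L (X (max 0 s) \<omega> \<Otimes>\<^sub>M X (max 0 s) \<omega>) \<psi> \<partial>M)"

lemma second_moment_bounds:
  obtains C where "1 \<le> C"
    "\<And>s (f :: 'a \<Rightarrow> real) B. f \<in> bcontfun \<Longrightarrow> (\<And>x. \<bar>f x\<bar> \<le> B) \<Longrightarrow> 0 \<le> s \<Longrightarrow> s \<le> t \<Longrightarrow>
      integrable M (\<lambda>\<omega>. integral\<^sup>L (X s \<omega>) f) \<and> (\<integral>\<omega>. \<bar>integral\<^sup>L (X s \<omega>) f\<bar> \<partial>M) \<le> B * C"
    "\<And>s (f :: 'a \<Rightarrow> real) B. f \<in> bcontfun \<Longrightarrow> (\<And>x. \<bar>f x\<bar> \<le> B) \<Longrightarrow> 0 \<le> s \<Longrightarrow> s \<le> t \<Longrightarrow>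
      integrable M (\<lambda>\<omega>. (integral\<^sup>L (X s \<omega>) f)\<^sup>2) \<and> (\<integral>\<omega>. (integral\<^sup>L (X s \<omega>) f)\<^sup>2 \<partial>M) \<le> B\<^sup>2 * C"
    "\<And>s (\<psi> :: 'a \<times> 'a \<Rightarrow> real) B. \<psi> \<in> bcontfun \<Longrightarrow> (\<And>x. \<bar>\<psi> x\<bar> \<le> B) \<Longrightarrow> 0 \<le> s \<Longrightarrow> s \<le> t \<Longrightarrow>
      integrable M (\<lambda>\<omega>. integral\<^sup>L (X s \<omega> \<Otimes>\<^sub>M X s \<omega>) \<psi>) \<and>
      (\<integral>\<omega>. \<bar>integral\<^sup>L (X s \<omega> \<Otimes>\<^sub>M X s \<omega>) \<psi>\<bar> \<partial>M) \<le> B * C"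
proof -
  obtain C where C: "1 \<le> C"
    "\<And>s. 0 \<le> s \<Longrightarrow> s \<le> t \<Longrightarrow> integrable M (\<lambda>\<omega>. (mass s \<omega>)\<^sup>2)"
    "\<And>s. 0 \<le> s \<Longrightarrow> s \<le> t \<Longrightarrow> (\<integral>\<omega>. (mass s \<omega>)\<^sup>2 \<partial>M) \<le> C"
    "\<And>s. 0 \<le> s \<Longrightarrow> s \<le> t \<Longrightarrow> integrable M (mass s)"
    "\<And>s. 0 \<le> s \<Longrightarrow> s \<le> t \<Longrightarrow> (\<integral>\<omega>. mass s \<omega> \<partial>M) \<le> C"
    using moment_bound by blast
  have dom: "integrable M h \<and> (\<integral>\<omega>. \<bar>h \<omega>\<bar> \<partial>M) \<le> B * C"
    if "h \<in> borel_measurable M" "integrable M m" "(\<integral>\<omega>. m \<omega> \<partial>M) \<le> C" "0 \<le> B"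
      "\<And>\<omega>. \<omega> \<in> space M \<Longrightarrow> \<bar>h \<omega>\<bar> \<le> B * m \<omega>" for h m :: "'w \<Rightarrow> real" and B
  proof -
    have IB: "integrable M (\<lambda>\<omega>. B * m \<omega>)" using that by simp
    have I: "integrable M h"
      by (rule Bochner_Integration.integrable_bound[OF IB])
         (use that in \<open>auto intro!: AE_I2 intro: order_trans[OF _ abs_ge_self]\<close>)
    have "(\<integral>\<omega>. \<bar>h \<omega>\<bar> \<partial>M) \<le> (\<integral>\<omega>. B * m \<omega> \<partial>M)" by (rule integral_mono[OF integrable_abs[OF I] IB that(5)])
    also have "\<dots> \<le> B * C" using that by (simp add: mult_left_mono)
    finally show ?thesis using I by simp
  qed
  show ?thesis
  proof (rule that[OF C(1)])
    fix s :: real and f :: "'a \<Rightarrow> real" and B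
    assume f: "f \<in> bcontfun" "\<And>x. \<bar>f x\<bar> \<le> B" and s: "0 \<le> s" "s \<le> t"
    have B: "0 \<le> B" using f(2)[of 0] by linarith
    show "integrable M (\<lambda>\<omega>. integral\<^sup>L (X s \<omega>) f) \<and> (\<integral>\<omega>. \<bar>integral\<^sup>L (X s \<omega>) f\<bar> \<partial>M) \<le> B * C"
      by (rule dom[OF _ C(4)[OF s] C(5)[OF s] B]) (use f s in \<open>auto intro: single_measurable single_bound\<close>)
    have "\<bar>(integral\<^sup>L (X s \<omega>) f)\<^sup>2\<bar> \<le> B\<^sup>2 * (mass s \<omega>)\<^sup>2" if "\<omega> \<in> space M" for \<omega>
      using power_mono[OF single_bound[OF f s(1) that], of 2] by (simp add: power_mult_distrib)
    then show "integrable M (\<lambda>\<omega>. (integral\<^sup>L (X s \<omega>) f)\<^sup>2) \<and> (\<integral>\<omega>. (integral\<^sup>L (X s \<omega>) f)\<^sup>2 \<partial>M) \<le> B\<^sup>2 * C"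
      using dom[of "\<lambda>\<omega>. (integral\<^sup>L (X s \<omega>) f)\<^sup>2", OF _ C(2)[OF s] C(3)[OF s], of "B\<^sup>2"] single_measurable[OF f(1) s(1)]
      by simp
  next
    fix s :: real and \<psi> :: "'a \<times> 'a \<Rightarrow> real" and B
    assume f: "\<psi> \<in> bcontfun" "\<And>x. \<bar>\<psi> x\<bar> \<le> B" and s: "0 \<le> s" "s \<le> t"
    have B: "0 \<le> B" using f(2)[of 0] by linarith
    show "integrable M (\<lambda>\<omega>. integral\<^sup>L (X s \<omega> \<Otimes>\<^sub>M X s \<omega>) \<psi>) \<and>
      (\<integral>\<omega>. \<bar>integral\<^sup>L (X s \<omega> \<Otimes>\<^sub>M X s \<omega>) \<psi>\<bar> \<partial>M) \<le> B * C"
      by (rule dom[OF _ C(2)[OF s] C(3)[OF s] B]) (use f s in \<open>auto intro: pair_measurable pair_bound\<close>)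
  qed
qed

lemma single_integrable:
  fixes f :: "'a \<Rightarrow> real"
  assumes "f \<in> bcontfun" "0 \<le> s"
  shows "integrable M (\<lambda>\<omega>. integral\<^sup>L (X s \<omega>) f)" "integrable M (\<lambda>\<omega>. (integral\<^sup>L (X s \<omega>) f)\<^sup>2)"
proof -
  obtain B where B: "\<And>x. \<bar>f x\<bar> \<le> B" using bcontfun_abs_bound[OF assms(1)] by blast
  show "integrable M (\<lambda>\<omega>. integral\<^sup>L (X s \<omega>) f)" "integrable M (\<lambda>\<omega>. (integral\<^sup>L (X s \<omega>) f)\<^sup>2)"
    by (rule second_moment_bounds[of s]; use assms B order_refl[of s] in blast)+
qed

lemma pair_integrable:
  fixes \<psi> :: "'a \<times> 'a \<Rightarrow> real"
  assumes "\<psi> \<in> bcontfun" "0 \<le> s"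
  shows "integrable M (\<lambda>\<omega>. integral\<^sup>L (X s \<omega> \<Otimes>\<^sub>M X s \<omega>) \<psi>)"
proof -
  obtain B where B: "\<And>x. \<bar>\<psi> x\<bar> \<le> B" using bcontfun_abs_bound[OF assms(1)] by blast
  show ?thesis by (rule second_moment_bounds[of s]) (use assms B order_refl[of s] in blast)
qed

lemma m1_lincomb:
  fixes f h :: "'a \<Rightarrow> real"
  assumes "f \<in> bcontfun" "h \<in> bcontfun"
  shows "m1 s (\<lambda>x. a * f x + b * h x) = a * m1 s f + b * m1 s h"
proof -
  have "m1 s (\<lambda>x. a * f x + b * h x) =
      (\<integral>\<omega>. a * integral\<^sup>L (X (max 0 s) \<omega>) f + b * integral\<^sup>L (X (max 0 s) \<omega>) h \<partial>M)"
    unfolding m1_def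
  proof (rule Bochner_Integration.integral_cong[OF refl])
    fix \<omega> assume "\<omega> \<in> space M"
    then have "finite_measure (X (max 0 s) \<omega>)" "sets (X (max 0 s) \<omega>) = sets borel"
      using finite_measures[of "max 0 s"] by auto
    then show "(\<integral>x. a * f x + b * h x \<partial>X (max 0 s) \<omega>) = a * integral\<^sup>L (X (max 0 s) \<omega>) f + b * integral\<^sup>L (X (max 0 s) \<omega>) h"
      using assms by (simp add: bcontfun_integrable')
  qed
  also have "\<dots> = a * m1 s f + b * m1 s h" using assms by (simp add: m1_def single_integrable)
  finally show ?thesis .
qed

lemma m2_lincomb:
  assumes "\<psi> \<in> bcontfun" "\<theta> \<in> bcontfun"
  shows "m2 s (\<lambda>x. a * \<psi> x + b * \<theta> x) = a * m2 s \<psi> + b * m2 s \<theta>"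
proof -
  let ?XX = "\<lambda>\<omega>. X (max 0 s) \<omega> \<Otimes>\<^sub>M X (max 0 s) \<omega>"
  have "m2 s (\<lambda>x. a * \<psi> x + b * \<theta> x) = (\<integral>\<omega>. a * integral\<^sup>L (?XX \<omega>) \<psi> + b * integral\<^sup>L (?XX \<omega>) \<theta> \<partial>M)"
    unfolding m2_def
  proof (rule Bochner_Integration.integral_cong[OF refl])
    fix \<omega> assume "\<omega> \<in> space M"
    then have "finite_measure (?XX \<omega>)" "sets (?XX \<omega>) = sets borel"
      using pair_finite[of "max 0 s"] by auto
    then show "(\<integral>x. a * \<psi> x + b * \<theta> x \<partial>?XX \<omega>) = a * integral\<^sup>L (?XX \<omega>) \<psi> + b * integral\<^sup>L (?XX \<omega>) \<theta>"
      using assms by (simp add: bcontfun_integrable')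
  qed
  also have "\<dots> = a * m2 s \<psi> + b * m2 s \<theta>" using assms by (simp add: m2_def pair_integrable)
  finally show ?thesis .
qed

lemma moment_functional_bounds:
  obtains C where "1 \<le> C"
    "\<And>s (f :: 'a \<Rightarrow> real) B. f \<in> bcontfun \<Longrightarrow> (\<And>x. \<bar>f x\<bar> \<le> B) \<Longrightarrow> s \<in> {0..t} \<Longrightarrow> \<bar>m1 s f\<bar> \<le> B * C"
    "\<And>s (\<psi> :: 'a \<times> 'a \<Rightarrow> real) B. \<psi> \<in> bcontfun \<Longrightarrow> (\<And>x. \<bar>\<psi> x\<bar> \<le> B) \<Longrightarrow> s \<in> {0..t} \<Longrightarrow> \<bar>m2 s \<psi>\<bar> \<le> B * C"
proof -
  obtain C where C: "1 \<le> C"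
    "\<And>s (f :: 'a \<Rightarrow> real) B. f \<in> bcontfun \<Longrightarrow> (\<And>x. \<bar>f x\<bar> \<le> B) \<Longrightarrow> 0 \<le> s \<Longrightarrow> s \<le> t \<Longrightarrow>
      integrable M (\<lambda>\<omega>. integral\<^sup>L (X s \<omega>) f) \<and> (\<integral>\<omega>. \<bar>integral\<^sup>L (X s \<omega>) f\<bar> \<partial>M) \<le> B * C"
    "\<And>s (\<psi> :: 'a \<times> 'a \<Rightarrow> real) B. \<psi> \<in> bcontfun \<Longrightarrow> (\<And>x. \<bar>\<psi> x\<bar> \<le> B) \<Longrightarrow> 0 \<le> s \<Longrightarrow> s \<le> t \<Longrightarrow>
      integrable M (\<lambda>\<omega>. integral\<^sup>L (X s \<omega> \<Otimes>\<^sub>M X s \<omega>) \<psi>) \<and>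
      (\<integral>\<omega>. \<bar>integral\<^sup>L (X s \<omega> \<Otimes>\<^sub>M X s \<omega>) \<psi>\<bar> \<partial>M) \<le> B * C"
    by (rule second_moment_bounds[of t]) blast
  show ?thesis
  proof (rule that[OF C(1)])
    fix s B and f :: "'a \<Rightarrow> real" assume f: "f \<in> bcontfun" "\<And>x. \<bar>f x\<bar> \<le> B" and s: "s \<in> {0..t}"
    then have "(\<integral>\<omega>. \<bar>integral\<^sup>L (X s \<omega>) f\<bar> \<partial>M) \<le> B * C" using C(2)[of f B s] by simp
    then show "\<bar>m1 s f\<bar> \<le> B * C" using s order_trans[OF integral_abs_bound] by (auto simp: m1_def max_def)
  next
    fix s B and f :: "'a \<times> 'a \<Rightarrow> real" assume f: "f \<in> bcontfun" "\<And>x. \<bar>f x\<bar> \<le> B" and s: "s \<in> {0..t}"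
    then have "(\<integral>\<omega>. \<bar>integral\<^sup>L (X s \<omega> \<Otimes>\<^sub>M X s \<omega>) f\<bar> \<partial>M) \<le> B * C" using C(3)[of f B s] by simp
    then show "\<bar>m2 s f\<bar> \<le> B * C" using s order_trans[OF integral_abs_bound] by (auto simp: m2_def max_def)
  qed
qed

lemma fubini_single:
  fixes f :: "'a \<Rightarrow> real"
  assumes "f \<in> bcontfun"
  shows "integrable M (\<lambda>\<omega>. LBINT s:{0..t}. integral\<^sup>L (X s \<omega>) f)"
    and "(\<integral>\<omega>. (LBINT s:{0..t}. integral\<^sup>L (X s \<omega>) f) \<partial>M) = integral {0..t} (\<lambda>s. m1 s f)"
    and "(\<lambda>s. m1 s f) integrable_on {0..t}"
proof -
  obtain B where B: "\<And>x. \<bar>f x\<bar> \<le> B" using bcontfun_abs_bound[OF assms(1)] by blast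
  obtain C where C: "\<And>s. 0 \<le> s \<Longrightarrow> s \<le> t \<Longrightarrow>
      integrable M (\<lambda>\<omega>. integral\<^sup>L (X s \<omega>) f) \<and> (\<integral>\<omega>. \<bar>integral\<^sup>L (X s \<omega>) f\<bar> \<partial>M) \<le> B * C"
    by (rule second_moment_bounds[of t]) (use assms B in blast)
  have eq: "(LBINT s:{0..t}. integral\<^sup>L (X (max 0 s) \<omega>) f) = (LBINT s:{0..t}. integral\<^sup>L (X s \<omega>) f)" for \<omega>
    by (rule set_lebesgue_integral_cong) (auto simp: max_def)
  note * = fubini_time[OF prob_space_axioms single_joint[OF assms(1)], of t "B * C", unfolded eq]
  show "integrable M (\<lambda>\<omega>. LBINT s:{0..t}. integral\<^sup>L (X s \<omega>) f)"
    "(\<integral>\<omega>. (LBINT s:{0..t}. integral\<^sup>L (X s \<omega>) f) \<partial>M) = integral {0..t} (\<lambda>s. m1 s f)"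
    "(\<lambda>s. m1 s f) integrable_on {0..t}"
    using * C by (auto simp: m1_def max_def)
qed

lemma fubini_pair:
  fixes \<psi> :: "'a \<times> 'a \<Rightarrow> real"
  assumes "\<psi> \<in> bcontfun"
  shows "integrable M (\<lambda>\<omega>. LBINT s:{0..t}. integral\<^sup>L (X s \<omega> \<Otimes>\<^sub>M X s \<omega>) \<psi>)"
    and "(\<integral>\<omega>. (LBINT s:{0..t}. integral\<^sup>L (X s \<omega> \<Otimes>\<^sub>M X s \<omega>) \<psi>) \<partial>M) = integral {0..t} (\<lambda>s. m2 s \<psi>)"
    and "(\<lambda>s. m2 s \<psi>) integrable_on {0..t}"
proof -
  obtain B where B: "\<And>x. \<bar>\<psi> x\<bar> \<le> B" using bcontfun_abs_bound[OF assms(1)] by blast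
  obtain C where C: "\<And>s. 0 \<le> s \<Longrightarrow> s \<le> t \<Longrightarrow>
      integrable M (\<lambda>\<omega>. integral\<^sup>L (X s \<omega> \<Otimes>\<^sub>M X s \<omega>) \<psi>) \<and> (\<integral>\<omega>. \<bar>integral\<^sup>L (X s \<omega> \<Otimes>\<^sub>M X s \<omega>) \<psi>\<bar> \<partial>M) \<le> B * C"
    by (rule second_moment_bounds[of t]) (use assms B in blast)
  have eq: "(LBINT s:{0..t}. integral\<^sup>L (X (max 0 s) \<omega> \<Otimes>\<^sub>M X (max 0 s) \<omega>) \<psi>)
      = (LBINT s:{0..t}. integral\<^sup>L (X s \<omega> \<Otimes>\<^sub>M X s \<omega>) \<psi>)" for \<omega>
    by (rule set_lebesgue_integral_cong) (auto simp: max_def)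
  note * = fubini_time[OF prob_space_axioms pair_joint[OF assms(1)], of t "B * C", unfolded eq]
  show "integrable M (\<lambda>\<omega>. LBINT s:{0..t}. integral\<^sup>L (X s \<omega> \<Otimes>\<^sub>M X s \<omega>) \<psi>)"
    "(\<integral>\<omega>. (LBINT s:{0..t}. integral\<^sup>L (X s \<omega> \<Otimes>\<^sub>M X s \<omega>) \<psi>) \<partial>M) = integral {0..t} (\<lambda>s. m2 s \<psi>)"
    "(\<lambda>s. m2 s \<psi>) integrable_on {0..t}"
    using * C by (auto simp: m2_def max_def)
qed

text \<open>The martingale has mean zero, and Fubini moves the expectation inside the time
  integral.\<close>

lemma m1_evolution:
  assumes "f \<in> C2b" "0 \<le> t"
  shows "m1 t f = integral\<^sup>L \<mu> f + integral {0..t} (\<lambda>s. m1 s (laplacian f))"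
proof -
  let ?Y = "mart_process X \<mu> f" and ?B = "\<lambda>\<omega>. LBINT s:{0..t}. integral\<^sup>L (X s \<omega>) (laplacian f)"
  note fb = C2bD(2)[OF assms(1)] and lb = laplacian_bcontfun[OF assms(1)]
  have "m1 t f = (\<integral>\<omega>. ?Y t \<omega> + (integral\<^sup>L \<mu> f + ?B \<omega>) \<partial>M)"
    using assms by (simp add: m1_def mart_process_def)
  also have "\<dots> = (\<integral>\<omega>. ?Y t \<omega> \<partial>M) + (integral\<^sup>L \<mu> f + (\<integral>\<omega>. ?B \<omega> \<partial>M))"
    using mart_process_mean[OF assms] fubini_single(1)[OF lb, of t] by (simp add: prob_space)
  finally show ?thesis using mart_process_mean[OF assms] by (simp add: fubini_single(2)[OF lb])
qed

lemma m2_0: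
  assumes "\<psi> \<in> bcontfun"
  shows "m2 0 \<psi> = integral\<^sup>L (\<mu> \<Otimes>\<^sub>M \<mu>) \<psi>"
proof -
  have "m2 0 \<psi> = (\<integral>\<omega>. integral\<^sup>L (\<mu> \<Otimes>\<^sub>M \<mu>) \<psi> \<partial>M)"
    unfolding m2_def using start pair_measurable[OF assms, of 0]
    by (intro integral_cong_AE) (auto elim: eventually_mono)
  then show ?thesis by (simp add: prob_space)
qed

lemma m1_0:
  fixes f :: "'a \<Rightarrow> real"
  assumes "f \<in> bcontfun"
  shows "m1 0 f = integral\<^sup>L \<mu> f"
proof -
  have "m1 0 f = (\<integral>\<omega>. integral\<^sup>L \<mu> f \<partial>M)"
    unfolding m1_def using start single_measurable[OF assms, of 0]
    by (intro integral_cong_AE) (auto elim: eventually_mono)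
  then show ?thesis by (simp add: prob_space)
qed

lemma m2_tensor:
  assumes "f \<in> bcontfun" "h \<in> bcontfun" "0 \<le> s"
  shows "m2 s (f \<otimes>\<^sub>f h) = (\<integral>\<omega>. integral\<^sup>L (X s \<omega>) f * integral\<^sup>L (X s \<omega>) h \<partial>M)"
  unfolding m2_def using assms by (intro Bochner_Integration.integral_cong) (simp_all add: pair_tensor)

lemma m2_swap:
  assumes "\<psi> \<in> bcontfun"
  shows "m2 s (\<lambda>(x, y). \<psi> (y, x)) = m2 s \<psi>"
  unfolding m2_def by (rule Bochner_Integration.integral_cong[OF refl]) (simp add: pair_swap[OF assms])

text \<open>
  With \<open>Y = U + B\<close>, \<open>U\<close> a martingale and \<open>B' = b\<close>, the martingale property turns
  $E[U_t B_t]$ into $\int E[U_s b_s] ds$, which replaces Ito's formula for $Y^2$.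
\<close>

lemma square_evolution:
  assumes f: "f \<in> C2b" and t: "0 \<le> t"
  shows "m2 t (f \<otimes>\<^sub>f f) = m2 0 (f \<otimes>\<^sub>f f) + integral {0..t} (\<lambda>s.
    2 * m2 s (f \<otimes>\<^sub>f laplacian f) + m2 s (\<lambda>z. g z * (f \<otimes>\<^sub>f f) z) + m1 s (\<lambda>x. (f x)\<^sup>2))"
proof -
  let ?b = "laplacian f" and ?m = "integral\<^sup>L \<mu> f"
  define Y where "Y s \<omega> = integral\<^sup>L (X s \<omega>) f" for s \<omega>
  define b where "b s \<omega> = integral\<^sup>L (X s \<omega>) ?b" for s \<omega>
  define U where "U s \<omega> = ?m + mart_process X \<mu> f s \<omega>" for s \<omega>
  define B where "B s \<omega> = (LBINT r:{0..s}. b r \<omega>)" for s \<omega>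
  note fb = C2bD(2)[OF f] and lb = laplacian_bcontfun[OF f]
  have YUB: "Y s \<omega> = U s \<omega> + B s \<omega>" for s \<omega>
    by (simp add: Y_def U_def B_def b_def mart_process_def)
  have meas: "Y s \<in> borel_measurable M" "b s \<in> borel_measurable M" "U s \<in> borel_measurable M" if "0 \<le> s" for s
    using that single_measurable[OF fb that] single_measurable[OF lb that] mart_process_measurable[OF f that]
    by (auto simp: Y_def[abs_def] b_def[abs_def] U_def[abs_def])
  have contm: "continuous_on {0..} (\<lambda>s. mart_process X \<mu> f s \<omega>)" if "\<omega> \<in> space M" for \<omega>
    using mart[OF f] that by (simp add: continuous_L2_martingale_def continuous_paths_def)
  have cont: "continuous_on {0..} (\<lambda>s. Y s \<omega>)" "continuous_on {0..} (\<lambda>s. b s \<omega>)" "continuous_on {0..} (\<lambda>s. U s \<omega>)"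
    if "\<omega> \<in> space M" for \<omega>
    using weakly_continuous[OF fb] weakly_continuous[OF lb] contm[OF that] that
    by (auto simp: Y_def b_def U_def continuous_paths_def intro: continuous_intros)
  obtain Bf where Bf: "\<And>x. \<bar>f x\<bar> \<le> Bf" using bcontfun_abs_bound[OF fb] by blast
  obtain Bl where Bl: "\<And>x. \<bar>?b x\<bar> \<le> Bl" using bcontfun_abs_bound[OF lb] by blast
  obtain C where C: "\<And>s (f :: 'a \<Rightarrow> real) B. f \<in> bcontfun \<Longrightarrow> (\<And>x. \<bar>f x\<bar> \<le> B) \<Longrightarrow> 0 \<le> s \<Longrightarrow> s \<le> t \<Longrightarrow>
      integrable M (\<lambda>\<omega>. (integral\<^sup>L (X s \<omega>) f)\<^sup>2) \<and> (\<integral>\<omega>. (integral\<^sup>L (X s \<omega>) f)\<^sup>2 \<partial>M) \<le> B\<^sup>2 * C"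
    by (rule second_moment_bounds[of t]) blast
  have Y2: "integrable M (\<lambda>\<omega>. (Y s \<omega>)\<^sup>2)" "(\<integral>\<omega>. (Y s \<omega>)\<^sup>2 \<partial>M) \<le> Bf\<^sup>2 * C" if "0 \<le> s" "s \<le> t" for s
    using C[OF fb Bf that] by (auto simp: Y_def)
  have b2: "integrable M (\<lambda>\<omega>. (b s \<omega>)\<^sup>2)" "(\<integral>\<omega>. (b s \<omega>)\<^sup>2 \<partial>M) \<le> Bl\<^sup>2 * C" if "0 \<le> s" "s \<le> t" for s
    using C[OF lb Bl that] by (auto simp: b_def)
  \<comment> \<open>The cross term drops out because the martingale has mean zero.\<close>
  have U2: "integrable M (\<lambda>\<omega>. (U s \<omega>)\<^sup>2)"
    "(\<integral>\<omega>. (U s \<omega>)\<^sup>2 \<partial>M) = ?m\<^sup>2 + (\<integral>\<omega>. (mart_process X \<mu> f s \<omega>)\<^sup>2 \<partial>M)" if "0 \<le> s" for s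
    using mart_process_square(1)[OF f that] mart_process_mean[OF f that]
    by (auto simp: U_def power2_sum prob_space mult.assoc)
  define D where "D = ?m\<^sup>2 + (\<integral>\<omega>. (mart_process X \<mu> f t \<omega>)\<^sup>2 \<partial>M)"
  have U2D: "(\<integral>\<omega>. (U s \<omega>)\<^sup>2 \<partial>M) \<le> D" if "0 \<le> s" "s \<le> t" for s
    using U2(2)[OF that(1)] mart_process_square_mono[OF f that] by (simp add: D_def)
  have Yb: "integrable M (\<lambda>\<omega>. Y s \<omega> * b s \<omega>)" "(\<integral>\<omega>. \<bar>Y s \<omega> * b s \<omega>\<bar> \<partial>M) \<le> Bf\<^sup>2 * C + Bl\<^sup>2 * C"
    if "0 \<le> s" "s \<le> t" for s
    using integrable_product_L2[OF meas(1)[OF that(1)] meas(2)[OF that(1)] Y2(1)[OF that] b2(1)[OF that]]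
      Y2(2)[OF that] b2(2)[OF that] by auto
  have Ub: "integrable M (\<lambda>\<omega>. U r \<omega> * b s \<omega>)" "(\<integral>\<omega>. \<bar>U r \<omega> * b s \<omega>\<bar> \<partial>M) \<le> D + Bl\<^sup>2 * C"
    if "0 \<le> s" "s \<le> t" "0 \<le> r" "r \<le> t" for s r
    using integrable_product_L2[OF meas(3)[OF that(3)] meas(2)[OF that(1)] U2(1)[OF that(3)] b2(1)[OF that(1,2)]]
      U2D[OF that(3,4)] b2(2)[OF that(1,2)] by auto
  have jointY: "(\<lambda>x. Y (max 0 (fst x)) (snd x)) \<in> borel_measurable (borel \<Otimes>\<^sub>M M)"
    and jointb: "(\<lambda>x. b (max 0 (fst x)) (snd x)) \<in> borel_measurable (borel \<Otimes>\<^sub>M M)"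
    and jointU: "(\<lambda>x. U (max 0 (fst x)) (snd x)) \<in> borel_measurable (borel \<Otimes>\<^sub>M M)"
    using caratheodory_measurable[of Y M] caratheodory_measurable[of b M] caratheodory_measurable[of U M] meas cont
    by (auto simp: split_beta)
  have jointUt: "(\<lambda>x. U t (snd x)) \<in> borel_measurable (borel \<Otimes>\<^sub>M M)"
    by (rule measurable_compose[OF measurable_snd meas(3)[OF t]])
  have F1: "integrable M (\<lambda>\<omega>. LBINT s:{0..t}. U t \<omega> * b (max 0 s) \<omega>)"
    "(\<integral>\<omega>. (LBINT s:{0..t}. U t \<omega> * b (max 0 s) \<omega>) \<partial>M) = integral {0..t} (\<lambda>s. \<integral>\<omega>. U t \<omega> * b (max 0 s) \<omega> \<partial>M)"
    using fubini_time[OF prob_space_axioms, of "\<lambda>s \<omega>. U t \<omega> * b (max 0 s) \<omega>" t "D + Bl\<^sup>2 * C"] Ub t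
      borel_measurable_times[OF jointUt jointb] by (auto simp: split_beta max_def)
  have F2: "integrable M (\<lambda>\<omega>. LBINT s:{0..t}. U (max 0 s) \<omega> * b (max 0 s) \<omega>)"
    "(\<integral>\<omega>. (LBINT s:{0..t}. U (max 0 s) \<omega> * b (max 0 s) \<omega>) \<partial>M) = integral {0..t} (\<lambda>s. \<integral>\<omega>. U (max 0 s) \<omega> * b (max 0 s) \<omega> \<partial>M)"
    using fubini_time[OF prob_space_axioms, of "\<lambda>s \<omega>. U (max 0 s) \<omega> * b (max 0 s) \<omega>" t "D + Bl\<^sup>2 * C"] Ub t
      borel_measurable_times[OF jointU jointb] by (auto simp: split_beta max_def)
  have F3: "integrable M (\<lambda>\<omega>. LBINT s:{0..t}. Y (max 0 s) \<omega> * b (max 0 s) \<omega>)"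
    "(\<integral>\<omega>. (LBINT s:{0..t}. Y (max 0 s) \<omega> * b (max 0 s) \<omega>) \<partial>M) = integral {0..t} (\<lambda>s. \<integral>\<omega>. Y (max 0 s) \<omega> * b (max 0 s) \<omega> \<partial>M)"
    using fubini_time[OF prob_space_axioms, of "\<lambda>s \<omega>. Y (max 0 s) \<omega> * b (max 0 s) \<omega>" t "Bf\<^sup>2 * C + Bl\<^sup>2 * C"] Yb t
      borel_measurable_times[OF jointY jointb] by (auto simp: split_beta max_def)
  \<comment> \<open>The drift density \<open>b s\<close> is measurable at time s, hence an
    admissible factor in \<open>martingale_test\<close>.\<close>
  have test: "(\<integral>\<omega>. U t \<omega> * b s \<omega> \<partial>M) = (\<integral>\<omega>. U s \<omega> * b s \<omega> \<partial>M)" if s: "0 \<le> s" "s \<le> t" for s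
  proof -
    have mm: "martingale M F (mart_process X \<mu> f)" using mart[OF f] by (simp add: continuous_L2_martingale_def)
    have bF: "b s \<in> borel_measurable (F s)" using adapted[OF lb] s by (simp add: Defs.adapted_def b_def[abs_def])
    have bI: "integrable M (b s)" using single_integrable(1)[OF lb s(1)] by (simp add: b_def[abs_def])
    have bM: "integrable M (\<lambda>\<omega>. b s \<omega> * mart_process X \<mu> f r \<omega>)" if r: "0 \<le> r" "r \<le> t" for r
    proof -
      have "integrable M (\<lambda>\<omega>. U r \<omega> * b s \<omega> - ?m * b s \<omega>)" using Ub(1)[OF s r] bI by simp
      then show ?thesis by (simp add: U_def algebra_simps)
    qed
    have "(\<integral>\<omega>. b s \<omega> * mart_process X \<mu> f t \<omega> \<partial>M) = (\<integral>\<omega>. b s \<omega> * mart_process X \<mu> f s \<omega> \<partial>M)"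
      by (rule martingale_test[OF mm s bF bM[OF t order_refl]])
    then show ?thesis
      using bM[OF t order_refl] bM[OF s] bI by (simp add: U_def algebra_simps)
  qed
  \<comment> \<open>Expand the square of U + B. The cross term is \<open>U t\<close> times the
    integral of b; the square of B is twice the integral of B b, and B = Y - U there. Continuity of
    b in time justifies the fundamental theorem of calculus.\<close>
  have path: "(Y t \<omega>)\<^sup>2 = (U t \<omega>)\<^sup>2 + 2 * (LBINT s:{0..t}. U t \<omega> * b (max 0 s) \<omega>)
      + 2 * (LBINT s:{0..t}. Y (max 0 s) \<omega> * b (max 0 s) \<omega>) - 2 * (LBINT s:{0..t}. U (max 0 s) \<omega> * b (max 0 s) \<omega>)"
    if \<omega>: "\<omega> \<in> space M" for \<omega>
  proof -
    have cb: "continuous_on {0..t} (\<lambda>s. b s \<omega>)" using cont(2)[OF \<omega>] by (rule continuous_on_subset) auto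
    have cY: "continuous_on {0..t} (\<lambda>s. Y s \<omega> * b s \<omega>)" "continuous_on {0..t} (\<lambda>s. U s \<omega> * b s \<omega>)"
      using cont[OF \<omega>] by (auto intro!: continuous_intros intro: continuous_on_subset)
    have HK: "(LBINT s:{0..t}. w s) = integral {0..t} w" if "continuous_on {0..t} w" for w :: "real \<Rightarrow> real"
      using borel_integrable_atLeastAtMost'[OF that] by (rule set_borel_integral_eq_integral(2))
    have Bs: "B s \<omega> = integral {0..s} (\<lambda>r. b r \<omega>)" if "s \<in> {0..t}" for s
      unfolding B_def using that cb
      by (intro set_borel_integral_eq_integral(2) borel_integrable_atLeastAtMost') (auto intro: continuous_on_subset)
    have "((\<lambda>s. 2 * (B s \<omega> * b s \<omega>)) has_integral (B t \<omega>)\<^sup>2 - (B 0 \<omega>)\<^sup>2) {0..t}"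
    proof (rule fundamental_theorem_of_calculus[OF t])
      fix s assume s: "s \<in> {0..t}"
      have "((\<lambda>s. integral {0..s} (\<lambda>r. b r \<omega>)) has_real_derivative b s \<omega>) (at s within {0..t})"
        using integral_has_real_derivative[OF cb s] .
      then have "((\<lambda>s. integral {0..s} (\<lambda>r. b r \<omega>)) has_derivative (*) (b s \<omega>)) (at s within {0..t})"
        by (simp add: has_field_derivative_def)
      from has_derivative_transform[OF s _ this, of "\<lambda>s. B s \<omega>"] Bs
      have "((\<lambda>s. B s \<omega>) has_real_derivative b s \<omega>) (at s within {0..t})"
        by (simp add: has_field_derivative_def)
      then have "((\<lambda>s. (B s \<omega>)\<^sup>2) has_real_derivative 2 * (B s \<omega> * b s \<omega>)) (at s within {0..t})"
        by (auto intro!: derivative_eq_intros)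
      then show "((\<lambda>s. (B s \<omega>)\<^sup>2) has_vector_derivative 2 * (B s \<omega> * b s \<omega>)) (at s within {0..t})"
        by (simp add: has_real_derivative_iff_has_vector_derivative)
    qed
    moreover have "B 0 \<omega> = 0" using Bs[of 0] t by simp
    ultimately have "((\<lambda>s. 2 * (B s \<omega> * b s \<omega>)) has_integral (B t \<omega>)\<^sup>2) {0..t}" by simp
    then have "(B t \<omega>)\<^sup>2 = integral {0..t} (\<lambda>s. 2 * (B s \<omega> * b s \<omega>))"
      by (rule integral_unique[symmetric])
    also have "\<dots> = 2 * integral {0..t} (\<lambda>s. Y s \<omega> * b s \<omega> - U s \<omega> * b s \<omega>)"
      by (simp add: YUB distrib_right)
    also have "\<dots> = 2 * integral {0..t} (\<lambda>s. Y s \<omega> * b s \<omega>) - 2 * integral {0..t} (\<lambda>s. U s \<omega> * b s \<omega>)"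
      using cY by (simp add: Henstock_Kurzweil_Integration.integral_diff integrable_continuous_interval algebra_simps)
    finally have BB: "(B t \<omega>)\<^sup>2 = 2 * (LBINT s:{0..t}. Y s \<omega> * b s \<omega>) - 2 * (LBINT s:{0..t}. U s \<omega> * b s \<omega>)"
      using cY by (simp add: HK)
    have mx: "(LBINT s:{0..t}. w (max 0 s)) = (LBINT s:{0..t}. w s)" for w :: "real \<Rightarrow> real"
      by (rule set_lebesgue_integral_cong) (auto simp: max_def)
    have "(LBINT s:{0..t}. U t \<omega> * b s \<omega>) = U t \<omega> * B t \<omega>" by (simp add: B_def)
    moreover have "(Y t \<omega>)\<^sup>2 = (U t \<omega>)\<^sup>2 + 2 * (U t \<omega> * B t \<omega>) + (B t \<omega>)\<^sup>2"
      by (simp add: YUB power2_sum)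
    ultimately show ?thesis
      using BB mx[of "\<lambda>s. U t \<omega> * b s \<omega>"] mx[of "\<lambda>s. Y s \<omega> * b s \<omega>"] mx[of "\<lambda>s. U s \<omega> * b s \<omega>"] by linarith
  qed
  have "(\<integral>\<omega>. (Y t \<omega>)\<^sup>2 \<partial>M) = (\<integral>\<omega>. (U t \<omega>)\<^sup>2 + 2 * (LBINT s:{0..t}. U t \<omega> * b (max 0 s) \<omega>)
      + 2 * (LBINT s:{0..t}. Y (max 0 s) \<omega> * b (max 0 s) \<omega>) - 2 * (LBINT s:{0..t}. U (max 0 s) \<omega> * b (max 0 s) \<omega>) \<partial>M)"
    by (rule Bochner_Integration.integral_cong[OF refl path])
  also have "\<dots> = (\<integral>\<omega>. (U t \<omega>)\<^sup>2 \<partial>M) + 2 * (\<integral>\<omega>. (LBINT s:{0..t}. U t \<omega> * b (max 0 s) \<omega>) \<partial>M)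
      + 2 * (\<integral>\<omega>. (LBINT s:{0..t}. Y (max 0 s) \<omega> * b (max 0 s) \<omega>) \<partial>M)
      - 2 * (\<integral>\<omega>. (LBINT s:{0..t}. U (max 0 s) \<omega> * b (max 0 s) \<omega>) \<partial>M)"
    using U2(1)[OF t] F1(1) F2(1) F3(1) by simp
  \<comment> \<open>In expectation \<open>U t\<close> may be replaced by \<open>U s\<close> against
    \<open>b s\<close>, so the two terms containing U and b cancel.\<close>
  also have "(\<integral>\<omega>. (LBINT s:{0..t}. U t \<omega> * b (max 0 s) \<omega>) \<partial>M) = (\<integral>\<omega>. (LBINT s:{0..t}. U (max 0 s) \<omega> * b (max 0 s) \<omega>) \<partial>M)"
    unfolding F1(2) F2(2) by (rule integral_cong) (simp add: test max_def)
  finally have main: "(\<integral>\<omega>. (Y t \<omega>)\<^sup>2 \<partial>M) = (\<integral>\<omega>. (U t \<omega>)\<^sup>2 \<partial>M) + 2 * integral {0..t} (\<lambda>s. \<integral>\<omega>. Y (max 0 s) \<omega> * b (max 0 s) \<omega> \<partial>M)"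
    by (simp add: F3(2))
  have Yb_L: "integral {0..t} (\<lambda>s. \<integral>\<omega>. Y (max 0 s) \<omega> * b (max 0 s) \<omega> \<partial>M) = integral {0..t} (\<lambda>s. m2 s (f \<otimes>\<^sub>f ?b))"
    by (rule integral_cong) (auto simp: m2_tensor fb lb Y_def b_def max_def)
  have gf: "(\<lambda>z. g z * (f \<otimes>\<^sub>f f) z) \<in> bcontfun" by (intro bcontfun_mult g_bcontfun tensor_bcontfun fb)
  have ff: "(\<lambda>x. (f x)\<^sup>2) \<in> bcontfun" unfolding power2_eq_square by (intro bcontfun_mult fb)
  have "(\<integral>\<omega>. (mart_process X \<mu> f t \<omega>)\<^sup>2 \<partial>M) = integral {0..t} (\<lambda>s. m1 s (\<lambda>x. (f x)\<^sup>2)) + integral {0..t} (\<lambda>s. m2 s (\<lambda>z. g z * (f \<otimes>\<^sub>f f) z))"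
    using fubini_single[OF ff, of t] fubini_pair[OF gf, of t]
    by (simp add: mart_process_square(3)[OF f t] mart_variation_def)
  moreover have "m2 t (f \<otimes>\<^sub>f f) = (\<integral>\<omega>. (Y t \<omega>)\<^sup>2 \<partial>M)" using t by (simp add: m2_tensor fb Y_def power2_eq_square)
  moreover have "m2 0 (f \<otimes>\<^sub>f f) = ?m\<^sup>2"
  proof -
    interpret finite_measure \<mu> by (rule finite_\<mu>)
    have "m2 0 (f \<otimes>\<^sub>f f) = (\<integral>\<omega>. ?m * ?m \<partial>M)"
      unfolding m2_tensor[OF fb fb order_refl] using start single_measurable[OF fb, of 0]
      by (intro integral_cong_AE) (auto elim: eventually_mono)
    then show ?thesis by (simp add: prob_space power2_eq_square)
  qed
  ultimately have "m2 t (f \<otimes>\<^sub>f f) = m2 0 (f \<otimes>\<^sub>f f) + (2 * integral {0..t} (\<lambda>s. m2 s (f \<otimes>\<^sub>f ?b))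
      + integral {0..t} (\<lambda>s. m2 s (\<lambda>z. g z * (f \<otimes>\<^sub>f f) z)) + integral {0..t} (\<lambda>s. m1 s (\<lambda>x. (f x)\<^sup>2)))"
    using main U2(2)[OF t] Yb_L by simp
  also have "2 * integral {0..t} (\<lambda>s. m2 s (f \<otimes>\<^sub>f ?b))
      + integral {0..t} (\<lambda>s. m2 s (\<lambda>z. g z * (f \<otimes>\<^sub>f f) z)) + integral {0..t} (\<lambda>s. m1 s (\<lambda>x. (f x)\<^sup>2))
    = integral {0..t} (\<lambda>s. 2 * m2 s (f \<otimes>\<^sub>f ?b) + m2 s (\<lambda>z. g z * (f \<otimes>\<^sub>f f) z) + m1 s (\<lambda>x. (f x)\<^sup>2))"
    using fubini_single(3)[OF ff, of t] fubini_pair(3)[OF gf, of t] fubini_pair(3)[OF tensor_bcontfun[OF fb lb], of t]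
    by (simp add: Henstock_Kurzweil_Integration.integral_add integrable_add integrable_on_mult_right)
  finally show ?thesis .
qed

end

section \<open>Evolution of the second moment\<close>

lemma bounded_linear_integral_family:
  fixes k :: "real \<Rightarrow> 'e::real_normed_vector \<Rightarrow> real"
  assumes fam: "bounded_family t C k"
    and int: "\<And>f. (\<lambda>s. k s f) integrable_on {0..t}"
    and t: "0 \<le> t"
  shows "bounded_linear (\<lambda>f. integral {0..t} (\<lambda>s. k s f))"
proof (rule bounded_linear_intro[of _ "C * t"])
  note lin = bounded_familyD(1)[OF fam] and bd = bounded_familyD(2)[OF fam]
  fix f h :: 'e and r :: real
  have "integral {0..t} (\<lambda>s. k s (f + h)) = integral {0..t} (\<lambda>s. k s f + k s h)"
    by (rule integral_cong) (use lin in \<open>simp add: bounded_linear.linear linear_add\<close>)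
  then show "integral {0..t} (\<lambda>s. k s (f + h)) = integral {0..t} (\<lambda>s. k s f) + integral {0..t} (\<lambda>s. k s h)"
    by (simp add: Henstock_Kurzweil_Integration.integral_add int)
  have "integral {0..t} (\<lambda>s. k s (r *\<^sub>R f)) = integral {0..t} (\<lambda>s. r * k s f)"
    by (rule integral_cong) (use lin in \<open>simp add: bounded_linear.linear linear_scale\<close>)
  then show "integral {0..t} (\<lambda>s. k s (r *\<^sub>R f)) = r *\<^sub>R integral {0..t} (\<lambda>s. k s f)" by simp
  have "norm (integral {0..t} (\<lambda>s. k s f)) \<le> integral {0..t} (\<lambda>s. C * norm f)"
    by (rule integral_norm_bound_integral[OF int integrable_const_ivl]) (use bd in auto)
  then show "norm (integral {0..t} (\<lambda>s. k s f)) \<le> norm f * (C * t)"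
    using t by (simp add: mult_ac)
qed

lemma diag_bcontfun:
  fixes \<psi> :: "'a::topological_space \<times> 'a \<Rightarrow> real"
  assumes "\<psi> \<in> bcontfun" shows "diag \<psi> \<in> bcontfun"
  unfolding diag_def[abs_def] by (rule bcontfun_compose[OF assms]) (intro continuous_intros)

lemma diag_C0:
  assumes "\<psi> \<in> C0" shows "diag \<psi> \<in> C0"
proof -
  have diag: "filterlim (\<lambda>x::'a. (x, x)) at_infinity at_infinity"
    unfolding filterlim_at_infinity_conv_norm_at_top
  proof (rule filterlim_at_top_mono)
    show "filterlim (norm :: 'a \<Rightarrow> real) at_top at_infinity" by (rule filterlim_norm_at_top)
    show "\<forall>\<^sub>F x in at_infinity. norm x \<le> norm (x, x :: 'a)"
      by (intro always_eventually allI norm_fst_le)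
  qed
  have "(\<psi> \<longlongrightarrow> 0) at_infinity" using assms by (simp add: C0_def)
  from filterlim_compose[OF this diag] have "((\<lambda>x. \<psi> (x, x)) \<longlongrightarrow> 0) at_infinity" .
  moreover have "continuous_on UNIV (\<lambda>x. \<psi> (x, x))"
    using diag_bcontfun[OF C0_bcontfun[OF assms]] by (simp add: bcontfun_def diag_def[abs_def])
  ultimately show ?thesis by (simp add: C0_def diag_def[abs_def])
qed

lemma csupp_of_bounded_support:
  assumes "bounded (support_on UNIV f)" shows "csupp f"
proof -
  from assms obtain r where r: "\<And>x. f x \<noteq> 0 \<Longrightarrow> norm x \<le> r" by (auto simp: bounded_iff support_on_def)
  show ?thesis unfolding csupp_def using r by (intro exI[of _ r]) (meson not_less)
qed

text \<open>A pair in the generator is a uniform limit of pairs from C^2_c, since the generator is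
  the closure of the differential operator, and both functionals are continuous for uniform
  convergence.\<close>

lemma generator_evolution:
  fixes \<Phi> \<Psi> :: "('b::euclidean_space \<Rightarrow>\<^sub>C real) \<Rightarrow> real"
  assumes gen: "generated_by_laplacian_plus K V" and lin: "bounded_linear \<Phi>" "bounded_linear \<Psi>"
    and V: "V \<in> bcontfun"
    and core: "\<And>f. f \<in> C2b \<Longrightarrow> csupp f \<Longrightarrow>
      \<Phi> (Bcontfun f) = \<Psi> (Bcontfun (\<lambda>x. laplacian f x + V x * f x))"
    and fh: "(apply_bcontfun f, apply_bcontfun h) \<in> generator K"
  shows "\<Phi> f = \<Psi> h"
proof -
  have "(apply_bcontfun f, apply_bcontfun h) \<in> graph_closure (laplacian_plus V)"
    using gen fh by (simp add: generated_by_laplacian_plus_def)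
  then obtain u v where uv: "\<And>n::nat. (u n, v n) \<in> laplacian_plus V"
    and lim: "uniform_limit UNIV u f sequentially" "uniform_limit UNIV v h sequentially"
    by (auto simp: graph_closure_def)
  have u: "u n \<in> C2b" "csupp (u n)" "v n = (\<lambda>x. laplacian (u n) x + V x * u n x)" for n
    using uv[of n] csupp_of_bounded_support by (auto simp: laplacian_plus_def)
  have ub: "u n \<in> bcontfun" "v n \<in> bcontfun" for n
  proof -
    show ub: "u n \<in> bcontfun" using u(1) by (rule C2bD)
    show "v n \<in> bcontfun" unfolding u(3) by (intro plus_cont bcontfun_mult laplacian_bcontfun V ub u(1))
  qed
  have "(\<lambda>n. Bcontfun (u n)) \<longlonglongrightarrow> f" "(\<lambda>n. Bcontfun (v n)) \<longlonglongrightarrow> h"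
    using lim by (auto intro!: uniform_limit_tendsto_bcontfun simp: Bcontfun_inverse ub)
  then have "(\<lambda>n. \<Phi> (Bcontfun (u n))) \<longlonglongrightarrow> \<Phi> f" "(\<lambda>n. \<Psi> (Bcontfun (v n))) \<longlonglongrightarrow> \<Psi> h"
    using bounded_linear.tendsto[OF lin(1)] bounded_linear.tendsto[OF lin(2)] by auto
  moreover have "\<Phi> (Bcontfun (u n)) = \<Psi> (Bcontfun (v n))" for n
    using core[OF u(1,2)[of n]] by (simp add: u(3))
  ultimately show ?thesis by (simp add: LIMSEQ_unique)
qed

section \<open>Evolution equations on the generator domains\<close>

context sbm
begin

lemma C2b_tensor_laplacian:
  fixes f h :: "'a \<Rightarrow> real"
  assumes "f \<in> C2b" "h \<in> C2b"
  shows "laplacian (f \<otimes>\<^sub>f h) = (\<lambda>z. 1 * (f \<otimes>\<^sub>f laplacian h) z + 1 * (laplacian f \<otimes>\<^sub>f h) z)"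
  using C2b_tensor(2)[OF assms] by (auto simp: fun_eq_iff)

text \<open>Polarisation with p = f + h and q = f - h: the difference of their tensor squares is
  twice the sum of \<open>f \<otimes>\<^sub>f h\<close> and \<open>h \<otimes>\<^sub>f f\<close>.
  These have equal second moments, also after multiplication by the symmetric
  \<open>g\<close>.\<close>

lemma tensor_evolution:
  assumes f: "f \<in> C2b" and h: "h \<in> C2b" and t: "0 \<le> t"
  shows "m2 t (f \<otimes>\<^sub>f h) = m2 0 (f \<otimes>\<^sub>f h) + integral {0..t} (\<lambda>s.
    m2 s (laplacian (f \<otimes>\<^sub>f h)) + (m2 s (\<lambda>z. g z * (f \<otimes>\<^sub>f h) z) + m1 s (\<lambda>x. f x * h x)))"
proof -
  \<comment> \<open>The explicit coefficients 1 and - 1 put p and q in the form of the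
    linear-combination lemmas.\<close>
  define p where "p x = 1 * f x + 1 * h x" for x
  define q where "q x = 1 * f x + (- 1) * h x" for x
  have p: "p \<in> C2b" "laplacian p = (\<lambda>x. 1 * laplacian f x + 1 * laplacian h x)"
    using C2b_lincomb[OF f h, of 1 1] unfolding p_def[abs_def] by auto
  have q: "q \<in> C2b" "laplacian q = (\<lambda>x. 1 * laplacian f x + (- 1) * laplacian h x)"
    using C2b_lincomb[OF f h, of 1 "- 1"] unfolding q_def[abs_def] by auto
  note b = C2bD(2)[OF f] C2bD(2)[OF h] C2bD(2)[OF p(1)] C2bD(2)[OF q(1)]
    laplacian_bcontfun[OF f] laplacian_bcontfun[OF h] laplacian_bcontfun[OF p(1)] laplacian_bcontfun[OF q(1)]
  note tb = tensor_bcontfun[OF b(1,2)] tensor_bcontfun[OF b(2,1)] tensor_bcontfun[OF b(3,3)] tensor_bcontfun[OF b(4,4)]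
  have swap: "m2 s (k \<otimes>\<^sub>f j) = m2 s (j \<otimes>\<^sub>f k)" if "j \<in> bcontfun" "k \<in> bcontfun" for s and j k :: "'a \<Rightarrow> real"
  proof -
    have "(\<lambda>(x, y). (j \<otimes>\<^sub>f k) (y, x)) = k \<otimes>\<^sub>f j" by (auto simp: tensor_def fun_eq_iff)
    then show ?thesis using m2_swap[OF tensor_bcontfun[OF that], of s] by simp
  qed
  have gb: "(\<lambda>z. g z * \<psi> z) \<in> bcontfun" if "\<psi> \<in> bcontfun" for \<psi> :: "'a \<times> 'a \<Rightarrow> real"
    by (intro bcontfun_mult g_bcontfun that)
  have gswap: "m2 s (\<lambda>z. g z * (h \<otimes>\<^sub>f f) z) = m2 s (\<lambda>z. g z * (f \<otimes>\<^sub>f h) z)" for s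
  proof -
    have "(\<lambda>(x, y). (\<lambda>z. g z * (f \<otimes>\<^sub>f h) z) (y, x)) = (\<lambda>z. g z * (h \<otimes>\<^sub>f f) z)"
      using g_sym by (auto simp: tensor_def fun_eq_iff)
    then show ?thesis using m2_swap[OF gb[OF tb(1)], of s] by simp
  qed
  have pq: "m2 s (p \<otimes>\<^sub>f p) - m2 s (q \<otimes>\<^sub>f q) = 4 * m2 s (f \<otimes>\<^sub>f h)" for s
  proof -
    have "(\<lambda>z. 1 * (p \<otimes>\<^sub>f p) z + (- 1) * (q \<otimes>\<^sub>f q) z) = (\<lambda>z. 2 * (f \<otimes>\<^sub>f h) z + 2 * (h \<otimes>\<^sub>f f) z)"
      by (auto simp: fun_eq_iff tensor_def p_def q_def algebra_simps)
    then show ?thesis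
      using m2_lincomb[OF tb(3,4), of s 1 "- 1"] m2_lincomb[OF tb(1,2), of s 2 2] swap[OF b(1,2), of s] by simp
  qed
  \<comment> \<open>For each square the evolution contains twice the Laplacian on one factor; in the
    difference the Laplacian falls once on \<open>f\<close> and once on \<open>h\<close>, which
    together is the Laplacian of the product.\<close>
  have pqD: "2 * m2 s (p \<otimes>\<^sub>f laplacian p) - 2 * m2 s (q \<otimes>\<^sub>f laplacian q) = 4 * m2 s (laplacian (f \<otimes>\<^sub>f h))" for s
  proof -
    have "(\<lambda>z. 2 * (p \<otimes>\<^sub>f laplacian p) z + (- 2) * (q \<otimes>\<^sub>f laplacian q) z)
        = (\<lambda>z. 4 * (f \<otimes>\<^sub>f laplacian h) z + 4 * (h \<otimes>\<^sub>f laplacian f) z)"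
      by (auto simp: fun_eq_iff tensor_def p(2) q(2) p_def q_def algebra_simps)
    then have "2 * m2 s (p \<otimes>\<^sub>f laplacian p) - 2 * m2 s (q \<otimes>\<^sub>f laplacian q)
        = 4 * m2 s (f \<otimes>\<^sub>f laplacian h) + 4 * m2 s (h \<otimes>\<^sub>f laplacian f)"
      using m2_lincomb[OF tensor_bcontfun[OF b(3,7)] tensor_bcontfun[OF b(4,8)], of s 2 "- 2"]
        m2_lincomb[OF tensor_bcontfun[OF b(1,6)] tensor_bcontfun[OF b(2,5)], of s 4 4] by simp
    also have "m2 s (h \<otimes>\<^sub>f laplacian f) = m2 s (laplacian f \<otimes>\<^sub>f h)" by (rule swap[OF b(5,2)])
    finally show ?thesis
      unfolding C2b_tensor_laplacian[OF f h]
      by (subst m2_lincomb[OF tensor_bcontfun[OF b(1,6)] tensor_bcontfun[OF b(5,2)]]) simp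
  qed
  have pqg: "m2 s (\<lambda>z. g z * (p \<otimes>\<^sub>f p) z) - m2 s (\<lambda>z. g z * (q \<otimes>\<^sub>f q) z) = 4 * m2 s (\<lambda>z. g z * (f \<otimes>\<^sub>f h) z)" for s
  proof -
    have "(\<lambda>z. 1 * (g z * (p \<otimes>\<^sub>f p) z) + (- 1) * (g z * (q \<otimes>\<^sub>f q) z))
        = (\<lambda>z. 2 * (g z * (f \<otimes>\<^sub>f h) z) + 2 * (g z * (h \<otimes>\<^sub>f f) z))"
      by (auto simp: fun_eq_iff tensor_def p_def q_def algebra_simps)
    then show ?thesis
      using m2_lincomb[OF gb[OF tb(3)] gb[OF tb(4)], of s 1 "- 1"] m2_lincomb[OF gb[OF tb(1)] gb[OF tb(2)], of s 2 2]
        gswap[of s] by simp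
  qed
  have sq: "(\<lambda>x. (k x)\<^sup>2) \<in> bcontfun" if "k \<in> bcontfun" for k :: "'a \<Rightarrow> real"
    unfolding power2_eq_square by (intro bcontfun_mult that)
  have pql: "m1 s (\<lambda>x. (p x)\<^sup>2) - m1 s (\<lambda>x. (q x)\<^sup>2) = 4 * m1 s (\<lambda>x. f x * h x)" for s
  proof -
    have "(\<lambda>x. 1 * (p x)\<^sup>2 + (- 1) * (q x)\<^sup>2) = (\<lambda>x. 4 * (f x * h x) + 0 * (f x * h x))"
      by (auto simp: fun_eq_iff p_def q_def power2_eq_square algebra_simps)
    then show ?thesis
      using m1_lincomb[OF sq[OF b(3)] sq[OF b(4)], of s 1 "- 1"]
        m1_lincomb[OF bcontfun_mult[OF b(1,2)] bcontfun_mult[OF b(1,2)], of s 4 0] by simp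
  qed
  let ?I = "\<lambda>k s. 2 * m2 s (k \<otimes>\<^sub>f laplacian k) + m2 s (\<lambda>z. g z * (k \<otimes>\<^sub>f k) z) + m1 s (\<lambda>x. (k x)\<^sup>2)"
  let ?J = "\<lambda>s. m2 s (laplacian (f \<otimes>\<^sub>f h)) + (m2 s (\<lambda>z. g z * (f \<otimes>\<^sub>f h) z) + m1 s (\<lambda>x. f x * h x))"
  have Iint: "?I k integrable_on {0..t}" if "k \<in> C2b" for k
    using C2bD(2)[OF that] laplacian_bcontfun[OF that]
    by (intro integrable_add integrable_on_mult_right fubini_pair(3) fubini_single(3) tensor_bcontfun gb sq)
  have "integral {0..t} (?I p) - integral {0..t} (?I q) = integral {0..t} (\<lambda>s. ?I p s - ?I q s)"
    by (rule Henstock_Kurzweil_Integration.integral_diff[symmetric, OF Iint[OF p(1)] Iint[OF q(1)]])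
  also have "\<dots> = integral {0..t} (\<lambda>s. 4 * ?J s)"
    by (rule integral_cong) (use pqD pqg pql in \<open>smt (verit)\<close>)
  also have "\<dots> = 4 * integral {0..t} ?J" by (rule integral_mult_right)
  finally have "4 * m2 t (f \<otimes>\<^sub>f h) = 4 * m2 0 (f \<otimes>\<^sub>f h) + 4 * integral {0..t} ?J"
    using square_evolution[OF p(1) t] square_evolution[OF q(1) t] pq[of t] pq[of 0] by linarith
  then show ?thesis by simp
qed

text \<open>One constant serves all families, because \<open>duhamel\<close> takes the same constant
  for both of its families.\<close>

lemma moment_functionals_bounded_linear:
  assumes "0 \<le> t"
  obtains C where "0 \<le> C"
    "bounded_family t C (\<lambda>s (\<psi> :: ('a \<times> 'a) \<Rightarrow>\<^sub>C real). m2 s (apply_bcontfun \<psi>))"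
    "bounded_family t C (\<lambda>s (f :: 'a \<Rightarrow>\<^sub>C real). m1 s (apply_bcontfun f))"
    "bounded_family t C (\<lambda>s (\<psi> :: ('a \<times> 'a) \<Rightarrow>\<^sub>C real). m1 s (diag (apply_bcontfun \<psi>)))"
    "bounded_family t C (\<lambda>s (\<psi> :: ('a \<times> 'a) \<Rightarrow>\<^sub>C real). m2 s (\<lambda>z. g z * apply_bcontfun \<psi> z))"
proof -
  obtain C where C: "1 \<le> C"
    "\<And>s (f :: 'a \<Rightarrow> real) B. f \<in> bcontfun \<Longrightarrow> (\<And>x. \<bar>f x\<bar> \<le> B) \<Longrightarrow> s \<in> {0..t} \<Longrightarrow> \<bar>m1 s f\<bar> \<le> B * C"
    "\<And>s (\<psi> :: 'a \<times> 'a \<Rightarrow> real) B. \<psi> \<in> bcontfun \<Longrightarrow> (\<And>x. \<bar>\<psi> x\<bar> \<le> B) \<Longrightarrow> s \<in> {0..t} \<Longrightarrow> \<bar>m2 s \<psi>\<bar> \<le> B * C"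
    by (rule moment_functional_bounds[of t]) blast
  obtain G where G: "\<And>z. \<bar>g z\<bar> \<le> G" using bcontfun_abs_bound[OF g_bcontfun] by blast
  have G0: "0 \<le> G" using G[of 0] by linarith
  \<comment> \<open>\<open>C\<close> serves the unweighted functionals and \<open>G * C\<close> the
    one weighted by \<open>g\<close>.\<close>
  define D where "D = C + G * C"
  have D: "0 \<le> D" "C \<le> D" "G * C \<le> D" using C(1) G0 by (auto simp: D_def)
  have up: "x \<le> D * norm \<psi>" if "x \<le> C' * norm \<psi>" "C' \<le> D" for x C' and \<psi> :: "'b::real_normed_vector"
    using order_trans[OF that(1) mult_right_mono[OF that(2)]] by simp
  have bL: "\<bar>m2 s (apply_bcontfun \<psi>)\<bar> \<le> D * norm \<psi>" if "s \<in> {0..t}" for s and \<psi> :: "('a \<times> 'a) \<Rightarrow>\<^sub>C real"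
    using C(3)[OF apply_bcontfun abs_apply_bcontfun_le that, of \<psi>] D(2) by (intro up) (simp_all add: mult.commute)
  have bl: "\<bar>m1 s (apply_bcontfun f)\<bar> \<le> D * norm f" if "s \<in> {0..t}" for s and f :: "'a \<Rightarrow>\<^sub>C real"
    using C(2)[OF apply_bcontfun abs_apply_bcontfun_le that, of f] D(2) by (intro up) (simp_all add: mult.commute)
  have bd: "\<bar>m1 s (diag (apply_bcontfun \<psi>))\<bar> \<le> D * norm \<psi>" if "s \<in> {0..t}" for s and \<psi> :: "('a \<times> 'a) \<Rightarrow>\<^sub>C real"
    using C(2)[OF diag_bcontfun[OF apply_bcontfun] _ that, of \<psi> "norm \<psi>"] D(2)
    by (intro up) (simp_all add: mult.commute diag_def abs_apply_bcontfun_le)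
  have gb: "(\<lambda>z. g z * apply_bcontfun \<psi> z) \<in> bcontfun" for \<psi> :: "('a \<times> 'a) \<Rightarrow>\<^sub>C real"
    by (intro bcontfun_mult g_bcontfun apply_bcontfun)
  have bg: "\<bar>m2 s (\<lambda>z. g z * apply_bcontfun \<psi> z)\<bar> \<le> D * norm \<psi>" if "s \<in> {0..t}" for s and \<psi> :: "('a \<times> 'a) \<Rightarrow>\<^sub>C real"
  proof -
    have "\<bar>g z * apply_bcontfun \<psi> z\<bar> \<le> G * norm \<psi>" for z
      unfolding abs_mult by (intro mult_mono G abs_apply_bcontfun_le G0) auto
    from C(3)[OF gb this that] show ?thesis using D(3) by (intro up) (simp_all add: mult_ac)
  qed
  show ?thesis
  proof (rule that[OF D(1)]; unfold bounded_family_def; intro ballI conjI allI bL bl bd bg)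
    fix s assume s: "s \<in> {0..t}"
    show "bounded_linear (\<lambda>\<psi> :: ('a \<times> 'a) \<Rightarrow>\<^sub>C real. m2 s (apply_bcontfun \<psi>))"
      \<comment> \<open>Coefficients 1 and 1 give additivity; second coefficient 0 gives
        homogeneity.\<close>
      using m2_lincomb[OF apply_bcontfun apply_bcontfun, of s 1 _ 1] m2_lincomb[OF apply_bcontfun apply_bcontfun, of s _ _ 0] bL[OF s]
      by (intro bounded_linear_intro[of _ D]) (simp_all add: plus_bcontfun.rep_eq[abs_def] scaleR_bcontfun.rep_eq[abs_def] mult.commute)
    show "bounded_linear (\<lambda>f :: 'a \<Rightarrow>\<^sub>C real. m1 s (apply_bcontfun f))"
      using m1_lincomb[OF apply_bcontfun apply_bcontfun, of s 1 _ 1] m1_lincomb[OF apply_bcontfun apply_bcontfun, of s _ _ 0] bl[OF s]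
      by (intro bounded_linear_intro[of _ D]) (simp_all add: plus_bcontfun.rep_eq[abs_def] scaleR_bcontfun.rep_eq[abs_def] mult.commute)
    note db = diag_bcontfun[OF apply_bcontfun]
    show "bounded_linear (\<lambda>\<psi> :: ('a \<times> 'a) \<Rightarrow>\<^sub>C real. m1 s (diag (apply_bcontfun \<psi>)))"
      using m1_lincomb[OF db db, of s 1 _ 1] m1_lincomb[OF db db, of s _ _ 0] bd[OF s]
      by (intro bounded_linear_intro[of _ D]) (simp_all add: diag_def[abs_def] mult.commute)
    show "bounded_linear (\<lambda>\<psi> :: ('a \<times> 'a) \<Rightarrow>\<^sub>C real. m2 s (\<lambda>z. g z * apply_bcontfun \<psi> z))"
      using m2_lincomb[OF gb gb, of s 1 _ 1] m2_lincomb[OF gb gb, of s _ _ 0] bg[OF s]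
      by (intro bounded_linear_intro[of _ D]) (simp_all add: mult_ac distrib_left)
  qed
qed

lemma diag_tensor: "diag (f \<otimes>\<^sub>f h) = (\<lambda>x. f x * h x)"
  by (simp add: diag_def[abs_def] tensor_def)

text \<open>The terms are sorted by what they act on. Product bumps give the identity for \<psi> and
  its Laplacian, with the potential term on the side of \<psi>; moving that term across yields the
  form in which the closure of the Laplacian plus \<open>g\<close> can be taken.\<close>

lemma m2_generator_evolution:
  fixes u v :: "('a \<times> 'a) \<Rightarrow>\<^sub>C real"
  assumes Q: "generated_by_laplacian_plus Q g" and t: "0 \<le> t"
    and gen: "(apply_bcontfun u, apply_bcontfun v) \<in> generator Q"
  shows "m2 t u = m2 0 u + integral {0..t} (\<lambda>s. m2 s v + m1 s (diag u))"
proof -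
  obtain C where fam:
    "bounded_family t C (\<lambda>s (\<psi> :: ('a \<times> 'a) \<Rightarrow>\<^sub>C real). m2 s (apply_bcontfun \<psi>))"
    "bounded_family t C (\<lambda>s (\<psi> :: ('a \<times> 'a) \<Rightarrow>\<^sub>C real). m1 s (diag (apply_bcontfun \<psi>)))"
    "bounded_family t C (\<lambda>s (\<psi> :: ('a \<times> 'a) \<Rightarrow>\<^sub>C real). m2 s (\<lambda>z. g z * apply_bcontfun \<psi> z))"
    by (rule moment_functionals_bounded_linear[OF t]) blast
  have gb: "(\<lambda>z. g z * \<psi> z) \<in> bcontfun" if "\<psi> \<in> bcontfun" for \<psi> :: "'a \<times> 'a \<Rightarrow> real"
    by (intro bcontfun_mult g_bcontfun that)
  have int: "(\<lambda>s. m2 s (apply_bcontfun \<psi>)) integrable_on {0..t}"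
    "(\<lambda>s. m1 s (diag (apply_bcontfun \<psi>))) integrable_on {0..t}"
    "(\<lambda>s. m2 s (\<lambda>z. g z * apply_bcontfun \<psi> z)) integrable_on {0..t}" for \<psi> :: "('a \<times> 'a) \<Rightarrow>\<^sub>C real"
    by (intro fubini_pair(3) fubini_single(3) gb diag_bcontfun apply_bcontfun)+
  define A where "A \<psi> = m2 t (apply_bcontfun \<psi>) - m2 0 (apply_bcontfun \<psi>)
      - integral {0..t} (\<lambda>s. m1 s (diag (apply_bcontfun \<psi>)))" for \<psi> :: "('a \<times> 'a) \<Rightarrow>\<^sub>C real"
  define G where "G \<psi> = integral {0..t} (\<lambda>s. m2 s (\<lambda>z. g z * apply_bcontfun \<psi> z))" for \<psi> :: "('a \<times> 'a) \<Rightarrow>\<^sub>C real"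
  define I where "I \<psi> = integral {0..t} (\<lambda>s. m2 s (apply_bcontfun \<psi>))" for \<psi> :: "('a \<times> 'a) \<Rightarrow>\<^sub>C real"
  have linA: "bounded_linear A" unfolding A_def
    using t by (intro bounded_linear_sub bounded_familyD(1)[OF fam(1)] bounded_linear_integral_family[OF fam(2) int(2)]) auto
  have linG: "bounded_linear G" unfolding G_def by (rule bounded_linear_integral_family[OF fam(3) int(3) t])
  have linI: "bounded_linear I" unfolding I_def by (rule bounded_linear_integral_family[OF fam(1) int(1) t])
  have core: "A (Bcontfun \<psi>) - G (Bcontfun \<psi>) = I (Bcontfun (laplacian \<psi>))" if \<psi>: "\<psi> \<in> C2b" "csupp \<psi>" for \<psi>
  proof (rule tensor_bumps_determine[OF bounded_linear_sub[OF linA linG] linI _ \<psi>])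
    fix r :: real and w :: "'a \<times> 'a" assume "0 < r"
    \<comment> \<open>A translate of a product bump is the product of two translated bumps, so
      \<open>tensor_evolution\<close> applies to it.\<close>
    define f where "f x = bump r (x - fst w)" for x :: 'a
    define h where "h x = bump r (x - snd w)" for x :: 'a
    have fh: "f \<in> C2b" "h \<in> C2b" unfolding f_def[abs_def] h_def[abs_def] by (intro C2b_translate(1) C2b_bump)+
    have fb: "f \<otimes>\<^sub>f h \<in> bcontfun" "laplacian (f \<otimes>\<^sub>f h) \<in> bcontfun"
      using C2b_tensor(1)[OF fh] by (auto intro: C2bD laplacian_bcontfun)
    have eq: "(\<lambda>z. (bump r \<otimes>\<^sub>f bump r) (z - w)) = f \<otimes>\<^sub>f h"
      by (auto simp: fun_eq_iff tensor_def f_def h_def split_beta)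
    have 1: "translate (bump r \<otimes>\<^sub>f bump r) w = Bcontfun (f \<otimes>\<^sub>f h)" by (simp add: translate_def eq)
    have "laplacian (f \<otimes>\<^sub>f h) = (\<lambda>z. laplacian (bump r \<otimes>\<^sub>f bump r) (z - w))"
      unfolding eq[symmetric] by (rule C2b_translate(2)[OF C2b_tensor(1)[OF C2b_bump C2b_bump]])
    then have 2: "translate (laplacian (bump r \<otimes>\<^sub>f bump r)) w = Bcontfun (laplacian (f \<otimes>\<^sub>f h))" by (simp add: translate_def)
    have i: "(\<lambda>s. m2 s (laplacian (f \<otimes>\<^sub>f h))) integrable_on {0..t}"
      "(\<lambda>s. m2 s (\<lambda>z. g z * (f \<otimes>\<^sub>f h) z)) integrable_on {0..t}"
      "(\<lambda>s. m1 s (\<lambda>x. f x * h x)) integrable_on {0..t}"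
      by (intro fubini_pair(3) fubini_single(3) gb fb bcontfun_mult C2bD(2) fh)+
    show "A (translate (bump r \<otimes>\<^sub>f bump r) w) - G (translate (bump r \<otimes>\<^sub>f bump r) w) = I (translate (laplacian (bump r \<otimes>\<^sub>f bump r)) w)"
      using tensor_evolution[OF fh t] i
      by (simp add: 1 2 A_def G_def I_def Bcontfun_inverse fb diag_tensor Henstock_Kurzweil_Integration.integral_add integrable_add)
  qed
  have "A u = I v"
  proof (rule generator_evolution[OF Q linA linI g_bcontfun _ gen])
    fix \<psi> :: "'a \<times> 'a \<Rightarrow> real" assume \<psi>: "\<psi> \<in> C2b" "csupp \<psi>"
    note b = C2bD(2)[OF \<psi>(1)] laplacian_bcontfun[OF \<psi>(1)]
    have "(\<lambda>z. 1 * laplacian \<psi> z + 1 * (g z * \<psi> z)) = (\<lambda>z. laplacian \<psi> z + g z * \<psi> z)" by simp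
    then have "m2 s (\<lambda>z. laplacian \<psi> z + g z * \<psi> z) = m2 s (laplacian \<psi>) + m2 s (\<lambda>z. g z * \<psi> z)" for s
      using m2_lincomb[OF b(2) gb[OF b(1)], of s 1 1] by simp
    moreover have "(\<lambda>s. m2 s (laplacian \<psi>)) integrable_on {0..t}" "(\<lambda>s. m2 s (\<lambda>z. g z * \<psi> z)) integrable_on {0..t}"
      by (intro fubini_pair(3) gb b)+
    ultimately show "A (Bcontfun \<psi>) = I (Bcontfun (\<lambda>z. laplacian \<psi> z + g z * \<psi> z))"
      using core[OF \<psi>]
      by (simp add: I_def G_def Bcontfun_inverse b gb plus_cont Henstock_Kurzweil_Integration.integral_add)
  qed
  then show ?thesis using int[of u] int[of v] by (simp add: A_def I_def Henstock_Kurzweil_Integration.integral_add)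
qed

text \<open>\<open>m1_evolution\<close> already covers every C^2_c function, so here the closure
  argument applies directly, without mollification.\<close>

lemma m1_generator_evolution:
  fixes f h :: "'a \<Rightarrow>\<^sub>C real"
  assumes P: "generated_by_laplacian_plus P (\<lambda>x. 0)" and t: "0 \<le> t"
    and gen: "(apply_bcontfun f, apply_bcontfun h) \<in> generator P"
  shows "m1 t f = m1 0 f + integral {0..t} (\<lambda>s. m1 s h)"
proof -
  obtain C where fam:
    "bounded_family t C (\<lambda>s (f :: 'a \<Rightarrow>\<^sub>C real). m1 s (apply_bcontfun f))"
    by (rule moment_functionals_bounded_linear[OF t]) blast
  have int: "(\<lambda>s. m1 s (apply_bcontfun f)) integrable_on {0..t}" for f :: "'a \<Rightarrow>\<^sub>C real"
    by (intro fubini_single(3) apply_bcontfun)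
  have lin: "bounded_linear (\<lambda>f :: 'a \<Rightarrow>\<^sub>C real. m1 t (apply_bcontfun f) - m1 0 (apply_bcontfun f))"
    "bounded_linear (\<lambda>f :: 'a \<Rightarrow>\<^sub>C real. integral {0..t} (\<lambda>s. m1 s (apply_bcontfun f)))"
    using t by (auto intro!: bounded_linear_sub bounded_familyD(1)[OF fam] bounded_linear_integral_family[OF fam int])
  have "m1 t f - m1 0 f = integral {0..t} (\<lambda>s. m1 s h)"
  proof (rule generator_evolution[OF P lin const_bcontfun _ gen])
    fix f :: "'a \<Rightarrow> real" assume f: "f \<in> C2b" "csupp f"
    then show "m1 t (apply_bcontfun (Bcontfun f)) - m1 0 (apply_bcontfun (Bcontfun f)) =
        integral {0..t} (\<lambda>s. m1 s (apply_bcontfun (Bcontfun (\<lambda>x. laplacian f x + 0 * f x))))"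
      using m1_evolution[OF f(1) t] m1_0[OF C2bD(2)[OF f(1)]] by (simp add: Bcontfun_inverse C2bD laplacian_bcontfun)
  qed
  then show ?thesis by simp
qed

text \<open>\<open>duhamel\<close> with vanishing source term.\<close>

lemma m1_semigroup:
  assumes P: "generated_by_laplacian_plus P (\<lambda>x. 0)" and t: "0 \<le> t" and f: "f \<in> C0"
  shows "m1 t f = integral\<^sup>L \<mu> (kernel_op P t f)"
proof -
  interpret P: C0_sg P using P by unfold_locales (simp add: generated_by_laplacian_plus_def)
  obtain C where C: "0 \<le> C" and fam:
    "bounded_family t C (\<lambda>s (f :: 'a \<Rightarrow>\<^sub>C real). m1 s (apply_bcontfun f))"
    by (rule moment_functionals_bounded_linear[OF t]) blast
  let ?f = "Bcontfun f"
  have fC: "?f \<in> C0c" by (rule Bcontfun_C0c[OF f])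
  have "m1 t (apply_bcontfun ?f) = m1 0 (apply_bcontfun (P.T t ?f)) + integral {0..t} (\<lambda>s. 0)"
  proof (rule P.duhamel[OF t fam, where k="\<lambda>_ _. 0"])
    show "(\<lambda>s. m1 s (apply_bcontfun f)) integrable_on {0..t}" for f :: "'a \<Rightarrow>\<^sub>C real"
      by (intro fubini_single(3) apply_bcontfun)
    show "m1 s (apply_bcontfun f) = m1 0 (apply_bcontfun f) + integral {0..s} (\<lambda>v. m1 v (apply_bcontfun h) + 0)"
      if "P.gen f h" "s \<in> {0..t}" for f h s
      using m1_generator_evolution[OF P, of s f h] that by (auto simp: P.gen_def)
  qed (use C fC in \<open>auto simp: bounded_family_def\<close>)
  also have "\<dots> = integral\<^sup>L \<mu> (apply_bcontfun (P.T t ?f))" by (simp add: m1_0[OF apply_bcontfun])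
  finally show ?thesis by (simp add: P.apply_T'[OF t fC] Bcontfun_inverse C0_bcontfun f)
qed

text \<open>\<open>duhamel\<close> for \<open>Q\<close>, with the first moment on the diagonal as
  source term; \<open>m1_semigroup\<close> then rewrites this source through \<open>P\<close>.
  Continuity of the integrand is recorded because the final limit needs its measurability.\<close>

lemma m2_semigroup:
  assumes P: "generated_by_laplacian_plus P (\<lambda>x. 0)" and Q: "generated_by_laplacian_plus Q g"
    and t: "0 \<le> t" and u: "u \<in> C0"
  shows "continuous_on {0..t} (\<lambda>s. integral\<^sup>L \<mu> (kernel_op P s (diag (kernel_op Q (t - s) u))))"
    and "m2 t u = integral\<^sup>L (\<mu> \<Otimes>\<^sub>M \<mu>) (kernel_op Q t u) +
      integral {0..t} (\<lambda>s. integral\<^sup>L \<mu> (kernel_op P s (diag (kernel_op Q (t - s) u))))"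
proof -
  interpret P: C0_sg P using P by unfold_locales (simp add: generated_by_laplacian_plus_def)
  interpret Q: C0_sg Q using Q by unfold_locales (simp add: generated_by_laplacian_plus_def)
  obtain C where fam:
    "bounded_family t C (\<lambda>s (\<psi> :: ('a \<times> 'a) \<Rightarrow>\<^sub>C real). m2 s (apply_bcontfun \<psi>))"
    "bounded_family t C (\<lambda>s (\<psi> :: ('a \<times> 'a) \<Rightarrow>\<^sub>C real). m1 s (diag (apply_bcontfun \<psi>)))"
    by (rule moment_functionals_bounded_linear[OF t]) blast
  let ?u = "Bcontfun u"
  have ap: "apply_bcontfun ?u = u" by (simp add: Bcontfun_inverse C0_bcontfun u)
  have uC: "?u \<in> C0c" by (rule Bcontfun_C0c[OF u])
  \<comment> \<open>\<open>duhamel\<close> asks for a source continuous in time. The first moment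
    formula turns it into the integral of a norm-continuous orbit of \<open>P\<close> against
    \<mu>.\<close>
  have kcont: "continuous_on {0..t} (\<lambda>s. m1 s (diag (apply_bcontfun \<psi>)))" if \<psi>: "\<psi> \<in> C0c" for \<psi>
  proof -
    have d: "diag (apply_bcontfun \<psi>) \<in> C0" using \<psi> by (intro diag_C0) (simp add: C0c_def)
    let ?d = "Bcontfun (diag (apply_bcontfun \<psi>))"
    have dC: "?d \<in> C0c" by (rule Bcontfun_C0c[OF d])
    have "continuous_on {0..t} (\<lambda>s. integral\<^sup>L \<mu> (apply_bcontfun (P.T s ?d)))"
      by (rule bounded_linear.continuous_on[OF bcontfun_integral_bounded_linear[OF finite_\<mu> sets_\<mu>]])
         (rule continuous_on_subset[OF P.T_continuous[OF dC]], auto)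
    moreover have "m1 s (diag (apply_bcontfun \<psi>)) = integral\<^sup>L \<mu> (apply_bcontfun (P.T s ?d))" if "s \<in> {0..t}" for s
      using that m1_semigroup[OF P _ d, of s] dC by (simp add: P.apply_T' Bcontfun_inverse C0_bcontfun d)
    ultimately show ?thesis by (rule continuous_on_eq[OF _ sym])
  qed
  have eq: "m1 s (diag (apply_bcontfun (Q.T (t - s) ?u))) = integral\<^sup>L \<mu> (kernel_op P s (diag (kernel_op Q (t - s) u)))"
    if "s \<in> {0..t}" for s
  proof -
    have "kernel_op Q (t - s) u \<in> C0" using Q.T_C0c[of "t - s" ?u] that uC by (simp add: C0c_def Q.apply_T' ap)
    then show ?thesis using that uC by (simp add: Q.apply_T' ap m1_semigroup[OF P] diag_C0)
  qed
  have "continuous_on {0..t} (\<lambda>s. m1 s (diag (apply_bcontfun (Q.T (t - s) ?u))))"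
  proof (rule Q.continuous_on_family[OF fam(2) kcont])
    show "continuous_on {0..t} (\<lambda>s. Q.T (t - s) ?u)"
      by (rule continuous_on_compose2[OF Q.T_continuous[OF uC]]) (auto intro!: continuous_intros)
  qed (use uC in \<open>auto intro: Q.T_C0c\<close>)
  then show "continuous_on {0..t} (\<lambda>s. integral\<^sup>L \<mu> (kernel_op P s (diag (kernel_op Q (t - s) u))))"
    by (rule continuous_on_eq) (rule eq)
  have "m2 t (apply_bcontfun ?u) = m2 0 (apply_bcontfun (Q.T t ?u)) + integral {0..t} (\<lambda>s. m1 s (diag (apply_bcontfun (Q.T (t - s) ?u))))"
  proof (rule Q.duhamel[OF t fam _ kcont])
    show "(\<lambda>s. m2 s (apply_bcontfun f)) integrable_on {0..t}" for f :: "('a \<times> 'a) \<Rightarrow>\<^sub>C real"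
      by (intro fubini_pair(3) apply_bcontfun)
    show "m2 s (apply_bcontfun f) = m2 0 (apply_bcontfun f) + integral {0..s} (\<lambda>v. m2 v (apply_bcontfun h) + m1 v (diag (apply_bcontfun f)))"
      if "Q.gen f h" "s \<in> {0..t}" for f h s
      using m2_generator_evolution[OF Q, of s f h] that by (auto simp: Q.gen_def)
  qed (use uC in auto)
  also have "integral {0..t} (\<lambda>s. m1 s (diag (apply_bcontfun (Q.T (t - s) ?u)))) =
      integral {0..t} (\<lambda>s. integral\<^sup>L \<mu> (kernel_op P s (diag (kernel_op Q (t - s) u))))"
    by (rule integral_cong) (rule eq)
  also have "m2 0 (apply_bcontfun (Q.T t ?u)) = integral\<^sup>L (\<mu> \<Otimes>\<^sub>M \<mu>) (kernel_op Q t u)"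
    by (simp add: m2_0[OF apply_bcontfun]) (simp add: Q.apply_T'[OF t uC] ap)
  finally show "m2 t u = integral\<^sup>L (\<mu> \<Otimes>\<^sub>M \<mu>) (kernel_op Q t u) +
      integral {0..t} (\<lambda>s. integral\<^sup>L \<mu> (kernel_op P s (diag (kernel_op Q (t - s) u))))" by (simp add: ap)
qed

end

section \<open>From test functions in \<open>C0\<close> to bounded continuous ones\<close>

lemma bounded_convergence_borel:
  fixes f :: "nat \<Rightarrow> 'b::topological_space \<Rightarrow> real"
  assumes m: "finite_measure m" "sets m = sets borel"
    and f: "\<And>n. f n \<in> borel_measurable borel" "\<And>n x. \<bar>f n x\<bar> \<le> B"
    and lim: "\<And>x. (\<lambda>n. f n x) \<longlonglongrightarrow> f' x"
  shows "(\<lambda>n. integral\<^sup>L m (f n)) \<longlonglongrightarrow> integral\<^sup>L m f'"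
    and "\<bar>integral\<^sup>L m (f n)\<bar> \<le> B * measure m UNIV"
proof -
  interpret finite_measure m by fact
  have f'm: "f' \<in> borel_measurable borel" using borel_measurable_LIMSEQ_real[OF lim f(1)] by blast
  show "(\<lambda>n. integral\<^sup>L m (f n)) \<longlonglongrightarrow> integral\<^sup>L m f'"
    by (rule integral_dominated_convergence[where w="\<lambda>_. B"])
       (use f f'm lim in \<open>auto simp: measurable_cong_sets[OF m(2) refl]\<close>)
  have I: "integrable m (f n)"
    by (rule integrable_const_bound[of _ B]) (use f in \<open>auto simp: measurable_cong_sets[OF m(2) refl]\<close>)
  have "\<bar>integral\<^sup>L m (f n)\<bar> \<le> (\<integral>x. \<bar>f n x\<bar> \<partial>m)" by (rule integral_abs_bound)
  also have "\<dots> \<le> (\<integral>x. B \<partial>m)" by (rule integral_mono) (use I f(2) in auto)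
  finally show "\<bar>integral\<^sup>L m (f n)\<bar> \<le> B * measure m UNIV"
    using sets_eq_imp_space_eq[OF m(2)] by (simp add: mult.commute)
qed

lemma (in C0_sg) kernel_op_measurable:
  assumes "0 \<le> s" "u \<in> C0"
  shows "kernel_op K s u \<in> borel_measurable borel"
proof -
  have "kernel_op K s u \<in> C0" using assms sg by (auto simp: C0_semigroup_def)
  then show ?thesis by (auto simp: C0_def intro: borel_measurable_continuous_onI)
qed

context sbm
begin

theorem second_moment_formula:
  fixes \<phi> :: "'a \<Rightarrow> real"
  assumes P: "generated_by_laplacian_plus P (\<lambda>x. 0)" and Q: "generated_by_laplacian_plus Q g"
    and \<phi>: "\<phi> \<in> bcontfun" and t: "0 \<le> t"
  shows "(\<integral>\<omega>. (integral\<^sup>L (X t \<omega>) \<phi>)\<^sup>2 \<partial>M) =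
      integral\<^sup>L (\<mu> \<Otimes>\<^sub>M \<mu>) (kernel_op Q t (\<phi> \<otimes>\<^sub>f \<phi>)) +
      (LBINT s:{0..t}. integral\<^sup>L \<mu> (kernel_op P s (diag (kernel_op Q (t - s) (\<phi> \<otimes>\<^sub>f \<phi>)))))"
proof -
  interpret P: C0_sg P using P by unfold_locales (simp add: generated_by_laplacian_plus_def)
  interpret Q: C0_sg Q using Q by unfold_locales (simp add: generated_by_laplacian_plus_def)
  define u where "u = \<phi> \<otimes>\<^sub>f \<phi>"
  \<comment> \<open>The product of \<phi> with itself need not vanish at infinity, so the formula is
    applied to truncations in \<open>C0\<close> and the limit is taken in each term.\<close>
  define v where "v n z = cutoff n z * u z" for n and z :: "'a \<times> 'a"
  have ub: "u \<in> bcontfun" unfolding u_def by (intro tensor_bcontfun \<phi>)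
  have vC0: "v n \<in> C0" for n
    unfolding v_def[abs_def] using ub by (intro cutoff_mult_C0) (simp add: bcontfun_def)
  note vb = C0_bcontfun[OF vC0]
  have borel: "w \<in> borel_measurable borel" if "w \<in> bcontfun" for w :: "'a \<times> 'a \<Rightarrow> real"
    using that by (auto simp: bcontfun_def intro: borel_measurable_continuous_onI)
  obtain B where B: "\<And>z. \<bar>u z\<bar> \<le> B" using bcontfun_abs_bound[OF ub] by blast
  have B0: "0 \<le> B" using B[of 0] by linarith
  have vB: "\<bar>v n z\<bar> \<le> B" for n z
  proof -
    have "\<bar>cutoff n z\<bar> * \<bar>u z\<bar> \<le> 1 * B" by (intro mult_mono cutoff_bounds(3) B) auto
    then show ?thesis by (simp add: v_def abs_mult)
  qed
  have vlim: "(\<lambda>n. v n z) \<longlonglongrightarrow> u z" for z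
    using tendsto_mult[OF cutoff_LIMSEQ[of z] tendsto_const[of "u z"]] by (simp add: v_def)
  \<comment> \<open>Mass bounds uniform over [0,t] for both kernels provide one dominating constant
    for all truncations and all times.\<close>
  obtain CP where CP: "1 \<le> CP" "\<And>s x. s \<in> {0..t} \<Longrightarrow> measure (P s x) UNIV \<le> CP"
    using P.mass_bounded[of t] by blast
  obtain CQ where CQ: "1 \<le> CQ" "\<And>s x. s \<in> {0..t} \<Longrightarrow> measure (Q s x) UNIV \<le> CQ"
    using Q.mass_bounded[of t] by blast
  have Qlim: "(\<lambda>n. kernel_op Q s (v n) z) \<longlonglongrightarrow> kernel_op Q s u z" if "0 \<le> s" for s z
    unfolding kernel_op_def
    by (rule bounded_convergence_borel(1)[OF Q.finite_K[OF that] borel[OF vb] vB vlim])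
  have Qbd: "\<bar>kernel_op Q s (v n) z\<bar> \<le> B * CQ" if "s \<in> {0..t}" for s n z
  proof -
    have s: "0 \<le> s" using that by simp
    have "\<bar>kernel_op Q s (v n) z\<bar> \<le> B * measure (Q s z) UNIV"
      unfolding kernel_op_def by (rule bounded_convergence_borel(2)[OF Q.finite_K[OF s] borel[OF vb] vB vlim])
    also have "\<dots> \<le> B * CQ" using CQ(2)[OF that] B0 by (rule mult_left_mono)
    finally show ?thesis .
  qed
  have dC0: "diag (kernel_op Q s (v n)) \<in> C0" if "0 \<le> s" for s n
    using that vC0[of n] Q.sg by (intro diag_C0) (auto simp: C0_semigroup_def)
  have dm: "diag (kernel_op Q s (v n)) \<in> borel_measurable borel" if "0 \<le> s" for s n
    using dC0[OF that] by (auto simp: C0_def intro: borel_measurable_continuous_onI)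
  define w where "w n s = integral\<^sup>L \<mu> (kernel_op P s (diag (kernel_op Q (t - s) (v n))))" for n s
  define w' where "w' s = integral\<^sup>L \<mu> (kernel_op P s (diag (kernel_op Q (t - s) u)))" for s
  have Plim: "(\<lambda>n. kernel_op P s (diag (kernel_op Q (t - s) (v n))) x) \<longlonglongrightarrow> kernel_op P s (diag (kernel_op Q (t - s) u)) x"
    and Pbd: "\<bar>kernel_op P s (diag (kernel_op Q (t - s) (v n))) x\<bar> \<le> B * CQ * CP"
    if s: "s \<in> {0..t}" for s x n
  proof -
    have s': "0 \<le> s" "0 \<le> t - s" "t - s \<in> {0..t}" using s by auto
    note conv = bounded_convergence_borel[where f="\<lambda>n. diag (kernel_op Q (t - s) (v n))"
        and f'="diag (kernel_op Q (t - s) u)" and B="B * CQ", OF P.finite_K[OF s'(1)] dm[OF s'(2)]]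
    have bd: "\<bar>diag (kernel_op Q (t - s) (v n)) y\<bar> \<le> B * CQ" for n y
      using Qbd[OF s'(3)] by (simp add: diag_def)
    have lim: "(\<lambda>n. diag (kernel_op Q (t - s) (v n)) y) \<longlonglongrightarrow> diag (kernel_op Q (t - s) u) y" for y
      using Qlim[OF s'(2)] by (simp add: diag_def)
    show "(\<lambda>n. kernel_op P s (diag (kernel_op Q (t - s) (v n))) x) \<longlonglongrightarrow> kernel_op P s (diag (kernel_op Q (t - s) u)) x"
      unfolding kernel_op_def[of P] by (rule conv(1)[OF bd lim])
    have "\<bar>kernel_op P s (diag (kernel_op Q (t - s) (v n))) x\<bar> \<le> B * CQ * measure (P s x) UNIV"
      unfolding kernel_op_def[of P] by (rule conv(2)[OF bd lim])
    also have "\<dots> \<le> B * CQ * CP" using CP(2)[OF s] B0 CQ(1) by (intro mult_left_mono) auto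
    finally show "\<bar>kernel_op P s (diag (kernel_op Q (t - s) (v n))) x\<bar> \<le> B * CQ * CP" .
  qed
  have wlim: "(\<lambda>n. w n s) \<longlonglongrightarrow> w' s" and wbd: "\<bar>w n s\<bar> \<le> B * CQ * CP * measure \<mu> UNIV" if s: "s \<in> {0..t}" for s n
    unfolding w_def w'_def
    using bounded_convergence_borel[OF finite_\<mu> sets_\<mu> P.kernel_op_measurable[OF _ dC0] Pbd[OF s] Plim[OF s]] s
    by auto
  have wcont: "continuous_on {0..t} (w n)" for n
    unfolding w_def[abs_def] by (rule m2_semigroup(1)[OF P Q t vC0])
  have main: "m2 t (v n) = integral\<^sup>L (\<mu> \<Otimes>\<^sub>M \<mu>) (kernel_op Q t (v n)) + (LBINT s:{0..t}. w n s)" for n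
    using m2_semigroup(2)[OF P Q t vC0[of n]] set_borel_integral_eq_integral(2)[OF borel_integrable_atLeastAtMost'[OF wcont[of n]]]
    by (simp add: w_def[abs_def])
  have \<mu>\<mu>: "finite_measure (\<mu> \<Otimes>\<^sub>M \<mu>)" "sets (\<mu> \<Otimes>\<^sub>M \<mu>) = sets borel"
  proof -
    show "finite_measure (\<mu> \<Otimes>\<^sub>M \<mu>)" by (rule finite_measure_pair_measure[OF finite_\<mu> finite_\<mu>])
    show "sets (\<mu> \<Otimes>\<^sub>M \<mu>) = sets borel" using sets_pair_measure_cong[OF sets_\<mu> sets_\<mu>] unfolding borel_prod .
  qed
  have "(\<lambda>n. integral\<^sup>L (\<mu> \<Otimes>\<^sub>M \<mu>) (kernel_op Q t (v n))) \<longlonglongrightarrow> integral\<^sup>L (\<mu> \<Otimes>\<^sub>M \<mu>) (kernel_op Q t u)"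
    by (rule bounded_convergence_borel(1)[OF \<mu>\<mu> Q.kernel_op_measurable[OF t vC0] Qbd Qlim[OF t]]) (use t in auto)
  moreover have "(\<lambda>n. LBINT s:{0..t}. w n s) \<longlonglongrightarrow> (LBINT s:{0..t}. w' s)"
    unfolding set_lebesgue_integral_def
  proof (rule integral_dominated_convergence)
    show m: "(\<lambda>s. indicator {0..t} s *\<^sub>R w n s) \<in> borel_measurable lborel" for n
      using borel_integrable_atLeastAtMost'[OF wcont[of n]] unfolding set_integrable_def by (rule borel_measurable_integrable)
    have lim: "(\<lambda>n. indicator {0..t} s *\<^sub>R w n s) \<longlonglongrightarrow> indicator {0..t} s *\<^sub>R w' s" for s
      using wlim[of s] by (auto split: split_indicator)
    \<comment> \<open>Continuity of the integrand is available for the truncations only; the limit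
      inherits measurability in time from them.\<close>
    show "(\<lambda>s. indicator {0..t} s *\<^sub>R w' s) \<in> borel_measurable lborel"
      using lim m by (rule borel_measurable_LIMSEQ_real)
    show "AE s in lborel. (\<lambda>n. indicator {0..t} s *\<^sub>R w n s) \<longlonglongrightarrow> indicator {0..t} s *\<^sub>R w' s"
      using lim by (rule AE_I2)
    show "integrable lborel (\<lambda>s. indicator {0..t} s *\<^sub>R (B * CQ * CP * measure \<mu> UNIV))"
      by (rule borel_integrable_compact) auto
    show "AE s in lborel. norm (indicator {0..t} s *\<^sub>R w n s) \<le> indicator {0..t} s *\<^sub>R (B * CQ * CP * measure \<mu> UNIV)" for n
      using wbd by (intro AE_I2) (auto split: split_indicator)
  qed
  ultimately have "(\<lambda>n. m2 t (v n)) \<longlonglongrightarrow> integral\<^sup>L (\<mu> \<Otimes>\<^sub>M \<mu>) (kernel_op Q t u) + (LBINT s:{0..t}. w' s)"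
    unfolding main by (rule tendsto_add)
  moreover have "(\<lambda>n. m2 t (v n)) \<longlonglongrightarrow> m2 t u"
    unfolding m2_def
  proof (rule integral_dominated_convergence)
    have t': "max 0 t = t" using t by simp
    \<comment> \<open>The squared total mass dominates the pair integrals of all truncations up to
      the factor \<open>B\<close>.\<close>
    have "integrable M (\<lambda>\<omega>. (mass t \<omega>)\<^sup>2)"
      by (rule moment_bound[of t]) (use t in blast)
    then show "integrable M (\<lambda>\<omega>. B * (mass t \<omega>)\<^sup>2)" by simp
    show "(\<lambda>\<omega>. integral\<^sup>L (X (max 0 t) \<omega> \<Otimes>\<^sub>M X (max 0 t) \<omega>) u) \<in> borel_measurable M"
      "(\<lambda>\<omega>. integral\<^sup>L (X (max 0 t) \<omega> \<Otimes>\<^sub>M X (max 0 t) \<omega>) (v n)) \<in> borel_measurable M" for n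
      by (intro pair_measurable ub vb; simp)+
    show "AE \<omega> in M. (\<lambda>n. integral\<^sup>L (X (max 0 t) \<omega> \<Otimes>\<^sub>M X (max 0 t) \<omega>) (v n))
        \<longlonglongrightarrow> integral\<^sup>L (X (max 0 t) \<omega> \<Otimes>\<^sub>M X (max 0 t) \<omega>) u"
      unfolding t'
      by (rule AE_I2, rule bounded_convergence_borel(1)[OF pair_finite(1,2)[OF t] borel[OF vb] vB vlim])
    show "AE \<omega> in M. norm (integral\<^sup>L (X (max 0 t) \<omega> \<Otimes>\<^sub>M X (max 0 t) \<omega>) (v n)) \<le> B * (mass t \<omega>)\<^sup>2" for n
      unfolding t' using pair_bound[OF vb vB t] by (intro AE_I2) simp
  qed
  ultimately have "m2 t u = integral\<^sup>L (\<mu> \<Otimes>\<^sub>M \<mu>) (kernel_op Q t u) + (LBINT s:{0..t}. w' s)"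
    by (rule LIMSEQ_unique[rotated])
  then show ?thesis by (simp add: u_def w'_def m2_tensor[OF \<phi> \<phi> t] power2_eq_square)
qed

end

text \<open>Integrability is stated beside the equation because a Bochner integral is 0 by
  convention when it diverges, so the equation alone would not make the second moment
  finite.\<close>

theorem theorem2p4:
  fixes N :: "'v measure" and \<xi> :: "real ^ 'd \<Rightarrow> 'v \<Rightarrow> real"
    and g :: "(real ^ 'd) \<times> (real ^ 'd) \<Rightarrow> real"
    and \<mu> :: "(real ^ 'd) measure"
    and M :: "'w measure" and F :: "real \<Rightarrow> 'w measure"
    and X :: "real \<Rightarrow> 'w \<Rightarrow> (real ^ 'd) measure"
    and P :: "real \<Rightarrow> real ^ 'd \<Rightarrow> (real ^ 'd) measure"
    and Q :: "real \<Rightarrow> (real ^ 'd) \<times> (real ^ 'd) \<Rightarrow> ((real ^ 'd) \<times> (real ^ 'd)) measure"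
    and \<phi> :: "real ^ 'd \<Rightarrow> real" and t :: real
  assumes "field_covariance N \<xi> g"
    and "bounded (range g)" and "\<And>x. (\<lambda>y. g (x, y)) \<in> C0" and "g \<in> C2b"
    and "finite_measure \<mu>" and "sets \<mu> = sets borel"
    and "sbm_random_environment M F X g \<mu>"
    and "generated_by_laplacian_plus P (\<lambda>x. 0)"
    and "generated_by_laplacian_plus Q g"
    and "\<phi> \<in> bcontfun" and "0 \<le> t"
  shows "integrable M (\<lambda>\<omega>. (integral\<^sup>L (X t \<omega>) \<phi>)\<^sup>2) \<and>
    (\<integral>\<omega>. (integral\<^sup>L (X t \<omega>) \<phi>)\<^sup>2 \<partial>M) =
      integral\<^sup>L (\<mu> \<Otimes>\<^sub>M \<mu>) (kernel_op Q t (\<phi> \<otimes>\<^sub>f \<phi>)) +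
      (LBINT s:{0..t}. integral\<^sup>L \<mu> (kernel_op P s (diag (kernel_op Q (t - s) (\<phi> \<otimes>\<^sub>f \<phi>)))))"
proof -
  \<comment> \<open>Symmetry comes from the representation of \<open>g\<close> as a
    covariance.\<close>
  have "g (x, y) = g (y, x)" for x y
    using assms(1) by (simp add: field_covariance_def mult.commute)
  then interpret sbm M F X g \<mu>
    by (intro sbm.intro assms(7) sbm_axioms.intro C2bD(2)[OF assms(4)] assms(5,6))
  show ?thesis
    using single_integrable(2)[OF assms(10,11)] second_moment_formula[OF assms(8-11)] by blast
qed

end
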